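(* For any finite integer sequence $I=(I_1,\ldots,I_n)$ of length $n$, the element $\Delta(G_I)\in\Gamma\otimes\Gamma$ is given by \[ \Delta(G_I)=\mathcal{G}_{\mathbf{t},\mathbf{s}}\left(t^I\prod_{i=1}^n\frac{(1-s_i)^n}{\prod_{j=1}^n\left(1-s_it_j^{-1}\right)}\right). \]
   Context: For an integer sequence $I=(I_1,\ldots,I_p)$ (not necessarily a partition) the stable Grothendieck polynomial in variables $\boldsymbol\alpha=(\alpha_1,\ldots,\alpha_N)$, $\boldsymbol\beta=(\beta_1,\ldots,\beta_{N'})$ is $G_I=\mathrm{IR}_{\mathbf{z}=0,\infty}\big(\prod_{j=1}^p(1-z_j)^{I_j-j}\,\kappa_p(\boldsymbol{\alpha};\boldsymbol{\beta}|\mathbf{z})\big)$, $\kappa_p=\big(\prod_{i=1}^p\frac{\prod_{b\in\boldsymbol\beta}(1-z_ib)}{\prod_{a\in\boldsymbol\alpha}(1-z_ia)}\frac{dz_i}{z_i(1-z_i)^{N-N'}}\big)\prod_{1\le i<j\le p}(1-z_j/z_i)$, where $\mathrm{IR}_{\mathbf{z}=0,\infty}$ means applying $\mathrm{Res}_{z_k=0}+\mathrm{Res}_{z_k=\infty}$ successively for $k=1,\ldots,p$. Every $G_I$ is a finite $\mathbb{Z}$-linear combination of $G_\lambda$ with $\lambda$ partitions. Let $\Gamma=\bigoplus_\lambda\mathbb{Z}G_\lambda$ (over all partitions $\lambda$); it is a commutative, cocommutative bialgebra whose comultiplication $\Delta:\Gamma\to\Gamma\otimes\Gamma$ is given by $\Delta(G_\nu)=\sum_{\lambda,\mu}d^\nu_{\lambda\mu}G_\lambda\otimes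 G_\mu$, where the integers $d^\nu_{\lambda\mu}$ are determined by the expansion $G_\nu(\mathbf{x},\mathbf{x}')=\sum_{\lambda,\mu}d^\nu_{\lambda\mu}G_\lambda(\mathbf{x})G_\mu(\mathbf{x}')$ of the single stable Grothendieck polynomial in the union of two alphabets; $\Delta$ is extended linearly to $G_I$ for arbitrary $I$. For disjoint ordered alphabets $\mathbf{t}=(t_1,t_2,\ldots)$, $\mathbf{s}=(s_1,s_2,\ldots)$ and finite integer sequences $I,J$, with $t^I=\prod_jt_j^{I_j}$, $s^J=\prod_js_j^{J_j}$, define $\mathcal{G}_{\mathbf{t},\mathbf{s}}(t^Is^J)=G_I\otimes G_J\in\Gamma\otimes\Gamma$, extended $\mathbb{Z}$-linearly to Laurent series with finite image; rational functions are replaced by their Laurent expansions, here with $1/(1-s_it_j^{-1})=\sum_{k\ge0}(s_i/t_j)^k$.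
   Formalization: In the kernel κ_p the exponent of (1-z_i) in the denominator is taken as N'-N instead of the printed N-N'; with the printed sign G_1 and G_2 coincide when β is empty, so the coefficients d are not determined. *)

theory Defs
  imports
    "HOL-Complex_Analysis.Complex_Analysis"
    "HOL-Library.Poly_Mapping"
begin

section \<open>Stable Grothendieck polynomials as iterated residues\<close>

definition residue_infinity :: "(complex \<Rightarrow> complex) \<Rightarrow> complex" where
  "residue_infinity f = - residue (\<lambda>w. f (1 / w) / w ^ 2) 0"

text \<open>
  The list argument holds \<open>z\<^sub>1, \<dots>, z\<^sub>p\<close>; the residues are taken first in
  \<open>z\<^sub>1\<close> (with the other variables as parameters), then in \<open>z\<^sub>2\<close>, and so on.
\<close>

primrec iterated_residue :: "nat \<Rightarrow> (complex list \<Rightarrow> complex) \<Rightarrow> complex" where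
  "iterated_residue 0 f = f []"
| "iterated_residue (Suc p) f =
     iterated_residue p
       (\<lambda>zs. residue (\<lambda>z. f (z # zs)) 0 + residue_infinity (\<lambda>z. f (z # zs)))"

text \<open>
  The density of \<open>\<kappa>\<^sub>p\<close> with respect to \<open>dz\<^sub>1 \<dots> dz\<^sub>p\<close>, where \<open>N = length as\<close> and
  \<open>N' = length bs\<close>. The exponent of \<open>1 - z\<^sub>i\<close> in the denominator is \<open>N' - N\<close>:
  with this sign adjoining a variable \<open>1\<close> to either alphabet changes nothing, which is
  the stability that makes expansions independent of the number of variables meaningful.
  List indices start at \<open>0\<close>.
\<close>

definition kappa :: "nat \<Rightarrow> complex list \<Rightarrow> complex list \<Rightarrow> complex list \<Rightarrow> complex" where
  "kappa p as bs zs =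
     (\<Prod>i<p. (\<Prod>b\<leftarrow>bs. 1 - zs ! i * b) / (\<Prod>a\<leftarrow>as. 1 - zs ! i * a)
             * (1 / (zs ! i * (1 - zs ! i) powi (int (length bs) - int (length as)))))
     * (\<Prod>j<p. \<Prod>i<j. 1 - zs ! j / zs ! i)"

text \<open>
  The value \<open>G\<^sub>I(as; bs)\<close>; meaningful when no entry of \<open>as\<close> is \<open>0\<close>. The single
  polynomial is the case \<open>bs = []\<close>.
\<close>

definition grothendieck :: "int list \<Rightarrow> complex list \<Rightarrow> complex list \<Rightarrow> complex" where
  "grothendieck I as bs =
     iterated_residue (length I)
       (\<lambda>zs. (\<Prod>j<length I. (1 - zs ! j) powi (I ! j - int (Suc j)))
             * kappa (length I) as bs zs)"


section \<open>The bialgebra and its tensor square\<close>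

typedef integer_partition = "{l :: nat list. sorted_wrt (\<ge>) l \<and> 0 \<notin> set l}"
  morphisms parts Abs_integer_partition
  by (rule exI[of _ "[]"]) simp

definition grothendieck_part ::
    "integer_partition \<Rightarrow> complex list \<Rightarrow> complex list \<Rightarrow> complex" where
  "grothendieck_part l = grothendieck (map int (parts l))"

text \<open>
  \<open>\<Gamma>\<close> is the free abelian group on the symbols \<open>G\<^sub>\<lambda>\<close>, and \<open>\<Gamma> \<otimes> \<Gamma>\<close> the one on the
  pairs \<open>G\<^sub>\<lambda> \<otimes> G\<^sub>\<mu>\<close>.
\<close>

type_synonym Gam = "integer_partition \<Rightarrow>\<^sub>0 int"
type_synonym GamGam = "(integer_partition \<times> integer_partition) \<Rightarrow>\<^sub>0 int"

definition tensor :: "Gam \<Rightarrow> Gam \<Rightarrow> GamGam" where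
  "tensor x y = frag_extend (\<lambda>l. frag_extend (\<lambda>m. frag_of (l, m)) y) x"

text \<open>
  The element \<open>G\<^sub>I\<close> of \<open>\<Gamma>\<close>, for an arbitrary integer sequence: its integral expansion in
  the \<open>G\<^sub>\<lambda>\<close>, valid for all numbers of variables.
\<close>

definition Gam_elem :: "int list \<Rightarrow> Gam" where
  "Gam_elem I = (THE c. \<forall>as bs. 0 \<notin> set as \<longrightarrow>
     grothendieck I as bs =
       (\<Sum>l\<in>Poly_Mapping.keys c.
          of_int (Poly_Mapping.lookup c l) * grothendieck_part l as bs))"

text \<open>
  \<open>Poly_Mapping.lookup (coproduct_coeffs \<nu>) (\<lambda>, \<mu>)\<close> is \<open>d\<^sup>\<nu>\<close> at \<open>\<lambda>, \<mu>\<close>.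
\<close>

definition coproduct_coeffs :: "integer_partition \<Rightarrow> GamGam" where
  "coproduct_coeffs n = (THE d. \<forall>xs ys. 0 \<notin> set xs \<longrightarrow> 0 \<notin> set ys \<longrightarrow>
     grothendieck_part n (xs @ ys) [] =
       (\<Sum>(l, m)\<in>Poly_Mapping.keys d.
          of_int (Poly_Mapping.lookup d (l, m))
            * grothendieck_part l xs [] * grothendieck_part m ys []))"

definition coproduct :: "Gam \<Rightarrow> GamGam" where
  "coproduct = frag_extend coproduct_coeffs"


section \<open>The map from Laurent series to the tensor square\<close>

text \<open>
  A formal Laurent series in \<open>t\<^sub>1, \<dots>, t\<^sub>n\<close> and \<open>s\<^sub>1, \<dots>, s\<^sub>n\<close> is given by its coefficients:
  \<open>F A B\<close> is the coefficient of \<open>t\<^sup>A s\<^sup>B\<close>, for integer lists \<open>A\<close>, \<open>B\<close> of length \<open>n\<close>.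

  The image \<open>\<Sum> F A B (G\<^sub>A \<otimes> G\<^sub>B)\<close> has infinitely many nonzero terms even in simple cases
  (\<open>G\<^sub>k = 1\<close> for every \<open>k \<le> 0\<close>), so the sum is formed coefficientwise in the basis
  \<open>G\<^sub>\<lambda> \<otimes> G\<^sub>\<mu>\<close>: each basis coefficient must be a finite sum of integers, and only finitely
  many of the resulting coefficients may be nonzero (\<open>x\<close> below has finite support).
\<close>

type_synonym laurent_series = "int list \<Rightarrow> int list \<Rightarrow> int"

definition has_image :: "nat \<Rightarrow> laurent_series \<Rightarrow> GamGam \<Rightarrow> bool" where
  "has_image n F x \<longleftrightarrow> (\<forall>l m.
     let c = (\<lambda>(A, B). F A B * Poly_Mapping.lookup (tensor (Gam_elem A) (Gam_elem B)) (l, m));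
         S = {(A, B). length A = n \<and> length B = n \<and> c (A, B) \<noteq> 0}
     in finite S \<and> Poly_Mapping.lookup x (l, m) = (\<Sum>p\<in>S. c p))"

definition finite_image :: "nat \<Rightarrow> laurent_series \<Rightarrow> bool" where
  "finite_image n F \<longleftrightarrow> (\<exists>x. has_image n F x)"

definition groth_map :: "nat \<Rightarrow> laurent_series \<Rightarrow> GamGam" where
  "groth_map n F = (THE x. has_image n F x)"

lemma has_image_unique: "has_image n F x \<Longrightarrow> has_image n F y \<Longrightarrow> x = y"
  by (rule poly_mapping_eqI) (auto simp: has_image_def Let_def)

lemma groth_map_eqI: "has_image n F x \<Longrightarrow> groth_map n F = x"
  unfolding groth_map_def by (blast intro: has_image_unique)

text \<open>
  Laurent polynomials in the \<open>t\<^sub>j\<close> are the group ring of the exponent group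
  \<open>nat \<Rightarrow>\<^sub>0 int\<close> (multiplication on \<^typ>\<open>(nat \<Rightarrow>\<^sub>0 int) \<Rightarrow>\<^sub>0 int\<close> is convolution).
\<close>

type_synonym laurent_poly = "(nat \<Rightarrow>\<^sub>0 int) \<Rightarrow>\<^sub>0 int"

definition t_monomial :: "int list \<Rightarrow> laurent_poly" where
  "t_monomial I = Poly_Mapping.single (Poly_Mapping.nth I) 1"

definition t_inverse :: "nat \<Rightarrow> laurent_poly" where
  "t_inverse j = Poly_Mapping.single (Poly_Mapping.single j (-1)) 1"

text \<open>The expansion \<open>1 / (1 - q s) = \<Sum>\<^sub>k q\<^sup>k s\<^sup>k\<close>, as a power series in \<open>s\<close>.\<close>

definition geometric :: "'a::comm_ring_1 \<Rightarrow> 'a fps" where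
  "geometric q = Abs_fps (\<lambda>k. q ^ k)"

lemma geometric_inverse: "geometric q * (1 - fps_const q * fps_X) = 1"
proof (rule fps_ext)
  fix k
  have "geometric q * (1 - fps_const q * fps_X)
          = geometric q - fps_const q * (geometric q * fps_X)"
    by (simp add: algebra_simps)
  then show "fps_nth (geometric q * (1 - fps_const q * fps_X)) k = fps_nth 1 k"
    by (cases k) (simp_all add: geometric_def)
qed

text \<open>
  The series \<open>c(t) P\<^sub>1(s\<^sub>1) \<dots> P\<^sub>n(s\<^sub>n)\<close> where each \<open>P\<^sub>i\<close> is a power series in one variable with
  coefficients Laurent polynomials in \<open>t\<close>. The variables \<open>s\<^sub>i\<close> being distinct, the coefficient
  of \<open>s\<^sup>B\<close> is the product of \<open>c\<close> with the coefficients of \<open>s\<^sub>i\<close> to the power \<open>B\<^sub>i\<close> in the \<open>P\<^sub>i\<close>.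
\<close>

definition separated_series :: "nat \<Rightarrow> laurent_poly \<Rightarrow> (nat \<Rightarrow> laurent_poly fps) \<Rightarrow> laurent_series"
  where
  "separated_series n c P A B =
     (if \<forall>b\<in>set B. 0 \<le> b
      then Poly_Mapping.lookup (c * (\<Prod>i<n. fps_nth (P i) (nat (B ! i)))) (Poly_Mapping.nth A)
      else 0)"

end

theory Submission
  imports Defs "Jordan_Normal_Form.Determinant"
begin

text \<open>
  Write \<open>y = 1 - z\<close> and \<open>x = 1 - 1/a\<close>. Expanding \<open>\<Prod>\<^bsub>i<j\<^esub> (1 - z\<^sub>j/z\<^sub>i)\<close> as a Vandermonde determinant turns the
  iterated residue into a determinant of one-variable moments, from which everything follows by
  linear algebra: exchanging adjacent rows gives the straightening rule
  \<open>G\<^bsub>p,q\<^esub> = G\<^bsub>p+1,q\<^esub> - G\<^bsub>q-1,p+1\<^esub> + G\<^bsub>q,p+1\<^esub>\<close>, and for \<open>N\<close> distinct \<open>x\<close>'s the determinant factors into a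
  bialternant, whose order of vanishing as the \<open>x\<close>'s tend to \<open>0\<close> at very different rates shows that
  the \<open>G\<^sub>\<lambda>\<close> are linearly independent.

  For fixed \<open>ys\<close> the function \<open>xs \<mapsto> G\<^sub>I(xs, ys)\<close> lies in the span of finitely many \<open>G\<^sub>\<lambda>\<close>; by symmetry and
  independence \<open>G\<^sub>I(xs, ys)\<close> is a finite combination of the \<open>G\<^sub>\<lambda>(xs) G\<^sub>\<mu>(ys)\<close>, a priori with complex
  coefficients. On the other hand, if \<open>\<Sum>\<^sub>m g\<^sub>m y\<^bsup>-m\<^esup>\<close> is the factor that \<open>ys\<close> contributes to the integrand,
  then \<open>G\<^sub>I(xs, ys) = \<Sum>\<^sub>C G\<^bsub>I-C\<^esub>(xs) \<Prod>\<^sub>j g\<^bsub>C j\<^esub>(ys)\<close> asymptotically, and a Cauchy identity for as many variables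
  as \<open>I\<close> has entries expresses \<open>\<Prod>\<^sub>j g\<^bsub>C j\<^esub>\<close> through the \<open>G\<^sub>B\<close>, with the coefficients of
  \<open>\<Prod>\<^sub>i (1 - s\<^sub>i)\<^sup>n / \<Prod>\<^sub>j (1 - s\<^sub>i/t\<^sub>j)\<close>. Comparing orders of vanishing identifies the coefficients.
\<close>

text \<open>The obstacle is that the expansion over \<open>C\<close> need not terminate:
  \<open>G_{I-C}\<close> does not die out as \<open>C\<close> grows (\<open>G_k = 1\<close> for
  \<open>k <= 0\<close>), so at given \<open>xs\<close>, \<open>ys\<close> there is no finite
  identity to set against the bilinear expansion. Hence one alphabet tends to 0. Cutting
  \<open>C\<close> off at \<open>M\<close> costs an error \<open>O(\<epsilon>^(W M))\<close>, while
  \<open>G_m\<close> vanishes to an order in \<open>[W |m|, W (|m| + 1))\<close>, so the truncation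
  determines the coefficient of every \<open>G_m\<close> with \<open>|m| < M\<close>. The other
  alphabet enters only through fixed functionals, finite combinations of evaluations that extract
  the coefficient of one \<open>G_l\<close>. A bilinear expansion must be known to exist beforehand,
  for only between finite combinations does agreement to high order force equality of coefficients;
  its integrality is a by-product of the comparison with integer sums. Those sums are finite because
  straightening a sequence with nonnegative entries never lowers its size:
  \<open>|B| <= |m|\<close>, and the total by which \<open>t^I\<close> is lowered is at most
  \<open>|B|\<close>.\<close>

abbreviation "lookup \<equiv> Poly_Mapping.lookup"
abbreviation "keys \<equiv> Poly_Mapping.keys"
abbreviation "single \<equiv> Poly_Mapping.single"

section \<open>Residues at the two ends and one-variable moments\<close>

definition end_residue :: "(complex \<Rightarrow> complex) \<Rightarrow> complex" where
  "end_residue f = residue f 0 + residue_infinity f"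

text \<open>Linearity of \<open>residue\<close> requires an isolated singularity. The second
  conjunct states this at infinity, in the coordinate \<open>w = 1/z\<close>.\<close>

definition isolated_ends :: "(complex \<Rightarrow> complex) \<Rightarrow> bool" where
  "isolated_ends f \<longleftrightarrow>
     (\<exists>U. open U \<and> 0 \<in> U \<and> f holomorphic_on U - {0}) \<and>
     (\<exists>U. open U \<and> 0 \<in> U \<and> (\<lambda>w. f (1 / w) / w ^ 2) holomorphic_on U - {0})"

lemma isolated_endsD:
  assumes "isolated_ends f"
  shows "\<exists>U. open U \<and> 0 \<in> U \<and> f holomorphic_on U - {0}"
    "\<exists>U. open U \<and> 0 \<in> U \<and> (\<lambda>w. f (1 / w) / w ^ 2) holomorphic_on U - {0}"
  using assms by (auto simp: isolated_ends_def)

lemma eventually_at_notin_finite: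
  fixes x :: complex
  assumes "finite S"
  shows "eventually (\<lambda>z. z \<notin> S) (at x)"
proof -
  have "open (- (S - {x}))" by (rule open_Compl, rule finite_imp_closed) (use assms in simp)
  moreover have "x \<in> - (S - {x})" by simp
  ultimately have "eventually (\<lambda>z. z \<in> - (S - {x})) (at x)"
    by (rule eventually_at_in_open')
  moreover have "eventually (\<lambda>z. z \<noteq> x) (at x)" by (simp add: eventually_at_filter)
  ultimately show ?thesis by eventually_elim auto
qed

text \<open>Residues see only punctured neighbourhoods, so a finite exceptional set is harmless at
  both ends. This disposes of points such as 0, 1 and \<open>inverse a\<close>, where totalised
  division and \<open>powi\<close> break the algebraic identities.\<close>

lemma end_residue_cong:
  assumes "finite S" "\<And>z. z \<notin> S \<Longrightarrow> f z = g z"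
  shows "end_residue f = end_residue g"
proof -
  have "residue f 0 = residue g 0"
    by (rule residue_cong) (use eventually_at_notin_finite[OF assms(1), of 0] assms(2) in
        \<open>auto elim!: eventually_mono\<close>)
  moreover have "residue (\<lambda>w. f (1 / w) / w ^ 2) 0 = residue (\<lambda>w. g (1 / w) / w ^ 2) 0"
  proof (rule residue_cong)
    have "eventually (\<lambda>w. w \<notin> (\<lambda>z. 1 / z) ` S) (at 0)"
      by (rule eventually_at_notin_finite) (use assms(1) in simp)
    then show "\<forall>\<^sub>F w in at 0. f (1 / w) / w ^ 2 = g (1 / w) / w ^ 2"
    proof eventually_elim
      case (elim w)
      then have "1 / w \<notin> S" by (metis (no_types, lifting) divide_divide_eq_right image_eqI mult_1 div_by_1)
      then show ?case using assms(2) by simp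
    qed
  qed simp
  ultimately show ?thesis by (simp add: end_residue_def residue_infinity_def)
qed

lemma isolated_ends_cmult: "isolated_ends f \<Longrightarrow> isolated_ends (\<lambda>z. c * f z)"
  unfolding isolated_ends_def
  by (auto simp: times_divide_eq_right[symmetric] simp del: times_divide_eq_right
      intro!: holomorphic_on_mult)

lemma holomorphic_punctured_add:
  assumes "\<exists>U. open U \<and> 0 \<in> U \<and> f holomorphic_on U - {0::complex}"
    and "\<exists>U. open U \<and> 0 \<in> U \<and> g holomorphic_on U - {0}"
  obtains U where "open U" "0 \<in> U" "f holomorphic_on U - {0}" "g holomorphic_on U - {0}"
proof -
  obtain U V where "open U" "0 \<in> U" "f holomorphic_on U - {0}"
    "open V" "0 \<in> V" "g holomorphic_on V - {0}" using assms by blast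
  then show thesis by (intro that[of "U \<inter> V"]) (auto elim: holomorphic_on_subset)
qed

lemma isolated_ends_add:
  assumes "isolated_ends f" "isolated_ends g"
  shows "isolated_ends (\<lambda>z. f z + g z)"
  unfolding isolated_ends_def
proof
  obtain U where "open U" "0 \<in> U" "f holomorphic_on U - {0}" "g holomorphic_on U - {0}"
    by (rule holomorphic_punctured_add[OF isolated_endsD(1)[OF assms(1)] isolated_endsD(1)[OF assms(2)]])
  then show "\<exists>U. open U \<and> 0 \<in> U \<and> (\<lambda>z. f z + g z) holomorphic_on U - {0}"
    by (intro exI[of _ U] conjI holomorphic_on_add)
  obtain U where "open U" "0 \<in> U" "(\<lambda>w. f (1 / w) / w ^ 2) holomorphic_on U - {0}"
      "(\<lambda>w. g (1 / w) / w ^ 2) holomorphic_on U - {0}"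
    by (rule holomorphic_punctured_add[OF isolated_endsD(2)[OF assms(1)] isolated_endsD(2)[OF assms(2)]])
  then show "\<exists>U. open U \<and> 0 \<in> U \<and> (\<lambda>w. (f (1 / w) + g (1 / w)) / w\<^sup>2) holomorphic_on U - {0}"
    unfolding add_divide_distrib by (intro exI[of _ U] conjI holomorphic_on_add)
qed

lemma end_residue_add:
  assumes "isolated_ends f" "isolated_ends g"
  shows "end_residue (\<lambda>z. f z + g z) = end_residue f + end_residue g"
proof -
  obtain U where U: "open U" "0 \<in> U" "f holomorphic_on U - {0}" "g holomorphic_on U - {0}"
    by (rule holomorphic_punctured_add[OF isolated_endsD(1)[OF assms(1)] isolated_endsD(1)[OF assms(2)]])
  obtain V where V: "open V" "0 \<in> V" "(\<lambda>w. f (1 / w) / w ^ 2) holomorphic_on V - {0}"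
      "(\<lambda>w. g (1 / w) / w ^ 2) holomorphic_on V - {0}"
    by (rule holomorphic_punctured_add[OF isolated_endsD(2)[OF assms(1)] isolated_endsD(2)[OF assms(2)]])
  show ?thesis
    using residue_add[OF U] residue_add[OF V]
    by (simp add: end_residue_def residue_infinity_def add_divide_distrib)
qed

lemma end_residue_cmult:
  assumes "isolated_ends f"
  shows "end_residue (\<lambda>z. c * f z) = c * end_residue f"
proof -
  obtain U V where U: "open U" "0 \<in> U" "f holomorphic_on U - {0}"
    and V: "open V" "0 \<in> V" "(\<lambda>w. f (1 / w) / w ^ 2) holomorphic_on V - {0}"
    using assms unfolding isolated_ends_def by blast
  show ?thesis
    using residue_lmul[OF U, of c] residue_lmul[OF V, of c]
    by (simp add: end_residue_def residue_infinity_def right_diff_distrib)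
qed

lemma end_residue_lincomb:
  assumes "isolated_ends f" "isolated_ends g"
  shows "end_residue (\<lambda>z. f z + c * g z) = end_residue f + c * end_residue g"
  using assms by (simp add: end_residue_add end_residue_cmult isolated_ends_cmult)

lemma end_residue_zero: "end_residue (\<lambda>z. 0) = 0"
  by (simp add: end_residue_def residue_infinity_def residue_const)

lemma isolated_ends_zero: "isolated_ends (\<lambda>z. 0)"
  by (auto simp: isolated_ends_def intro!: exI[of _ UNIV])

lemma end_residue_sum:
  assumes "finite S" "\<And>s. s \<in> S \<Longrightarrow> isolated_ends (f s)"
  shows "end_residue (\<lambda>z. \<Sum>s\<in>S. c s * f s z) = (\<Sum>s\<in>S. c s * end_residue (f s))
    \<and> isolated_ends (\<lambda>z. \<Sum>s\<in>S. c s * f s z)"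
  using assms
  by (induction S)
    (auto simp: end_residue_zero isolated_ends_zero end_residue_add end_residue_cmult
      isolated_ends_cmult isolated_ends_add)

lemma iterated_residue_cong:
  assumes "\<And>zs. length zs = p \<Longrightarrow> 0 \<notin> set zs \<Longrightarrow> f zs = g zs"
  shows "iterated_residue p f = iterated_residue p g"
  using assms
proof (induction p arbitrary: f g)
  case (Suc p)
  have "end_residue (\<lambda>z. f (z # zs)) = end_residue (\<lambda>z. g (z # zs))"
    if "length zs = p" "0 \<notin> set zs" for zs
    by (rule end_residue_cong[of "{0}"]) (use Suc.prems that in auto)
  then show ?case
    using Suc.IH[of "\<lambda>zs. end_residue (\<lambda>z. f (z # zs))" "\<lambda>zs. end_residue (\<lambda>z. g (z # zs))"]
    by (simp add: end_residue_def)
qed simp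

text \<open>For a sum of separated products each residue acts on a single factor, the others being
  constants, so the order of the residues leaves no trace.\<close>

lemma iterated_residue_sum_prod:
  assumes "finite S" "\<And>s i. s \<in> S \<Longrightarrow> i < p \<Longrightarrow> isolated_ends (\<psi> s i)"
  shows "iterated_residue p (\<lambda>zs. \<Sum>s\<in>S. c s * (\<Prod>i<p. \<psi> s i (zs ! i)))
    = (\<Sum>s\<in>S. c s * (\<Prod>i<p. end_residue (\<psi> s i)))"
  using assms(2)
proof (induction p arbitrary: \<psi> c)
  case (Suc p)
  have *: "end_residue (\<lambda>z. \<Sum>s\<in>S. c s * (\<Prod>i<Suc p. \<psi> s i ((z # zs) ! i)))
     = (\<Sum>s\<in>S. (c s * end_residue (\<psi> s 0)) * (\<Prod>i<p. \<psi> s (Suc i) (zs ! i)))" for zs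
  proof -
    have "end_residue (\<lambda>z. \<Sum>s\<in>S. c s * (\<Prod>i<Suc p. \<psi> s i ((z # zs) ! i)))
      = end_residue (\<lambda>z. \<Sum>s\<in>S. (c s * (\<Prod>i<p. \<psi> s (Suc i) (zs ! i))) * \<psi> s 0 z)"
      by (simp add: prod.lessThan_Suc_shift mult_ac del: prod.lessThan_Suc)
    also have "\<dots> = (\<Sum>s\<in>S. (c s * (\<Prod>i<p. \<psi> s (Suc i) (zs ! i))) * end_residue (\<psi> s 0))"
      using assms(1) Suc.prems by (intro end_residue_sum[THEN conjunct1]) auto
    finally show ?thesis by (simp add: mult_ac)
  qed
  have "iterated_residue (Suc p) (\<lambda>zs. \<Sum>s\<in>S. c s * (\<Prod>i<Suc p. \<psi> s i (zs ! i)))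
    = iterated_residue p (\<lambda>zs. end_residue (\<lambda>z. \<Sum>s\<in>S. c s * (\<Prod>i<Suc p. \<psi> s i ((z # zs) ! i))))"
    by (simp add: end_residue_def)
  also have "\<dots> = (\<Sum>s\<in>S. (c s * end_residue (\<psi> s 0)) * (\<Prod>i<p. end_residue (\<psi> s (Suc i))))"
    unfolding * by (rule Suc.IH) (use Suc.prems in auto)
  finally show ?case by (simp add: prod.lessThan_Suc_shift mult_ac del: prod.lessThan_Suc)
qed simp

text \<open>The linear functional \<open>(1 - z)\<^sup>k z\<^sup>e \<mapsto> (Res\<^sub>0 + Res\<^sub>\<infinity>) (1 - z)\<^sup>k z\<^sup>e A(z) dz/z\<close>.\<close>

definition ratio :: "complex list \<Rightarrow> complex list \<Rightarrow> complex \<Rightarrow> complex" where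
  "ratio as bs z = (\<Prod>b\<leftarrow>bs. 1 - z * b) / (\<Prod>a\<leftarrow>as. 1 - z * a)
     * (1 - z) powi (int (length as) - int (length bs))"

definition integrand :: "complex list \<Rightarrow> complex list \<Rightarrow> int \<Rightarrow> int \<Rightarrow> complex \<Rightarrow> complex" where
  "integrand as bs k e z = z powi (e - 1) * (1 - z) powi k * ratio as bs z"

definition moment :: "complex list \<Rightarrow> complex list \<Rightarrow> int \<Rightarrow> int \<Rightarrow> complex" where
  "moment as bs k e = end_residue (integrand as bs k e)"

lemma holomorphic_on_prod_list [holomorphic_intros]:
  assumes "\<And>x. x \<in> set xs \<Longrightarrow> f x holomorphic_on U"
  shows "(\<lambda>z. \<Prod>x\<leftarrow>xs. f x z) holomorphic_on U"
  using assms by (induction xs) (auto intro!: holomorphic_intros)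

lemma powi_add': "(x::complex) \<noteq> 0 \<Longrightarrow> x powi (a + b) = x powi a * x powi b"
  by (simp add: power_int_add)

lemma ratio_holomorphic:
  assumes "\<And>z. z \<in> U \<Longrightarrow> z \<noteq> 1" "\<And>z a. z \<in> U \<Longrightarrow> a \<in> set as \<Longrightarrow> z * a \<noteq> 1"
  shows "ratio as bs holomorphic_on U"
  unfolding ratio_def[abs_def]
  using assms by (auto intro!: holomorphic_intros simp: prod_list_zero_iff)

text \<open>This is \<open>ratio\<close> in the coordinate \<open>w = 1/z\<close>. The exponent of
  \<open>1 - z\<close> balances the degrees of numerator and denominator, so all powers of
  \<open>w\<close> cancel and the factor is regular at infinity when no letter of \<open>as\<close>
  is 0.\<close>

definition ratio_infinity :: "complex list \<Rightarrow> complex list \<Rightarrow> complex \<Rightarrow> complex" where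
  "ratio_infinity as bs w = (\<Prod>b\<leftarrow>bs. w - b) / (\<Prod>a\<leftarrow>as. w - a)
     * (w - 1) powi (int (length as) - int (length bs))"

lemma ratio_infinity_holomorphic:
  assumes "\<And>z. z \<in> U \<Longrightarrow> z \<noteq> 1" "\<And>z. z \<in> U \<Longrightarrow> z \<notin> set as"
  shows "ratio_infinity as bs holomorphic_on U"
  unfolding ratio_infinity_def[abs_def]
  using assms by (auto intro!: holomorphic_intros simp: prod_list_zero_iff)

lemma prod_list_one_minus_inverse:
  "(w::complex) \<noteq> 0 \<Longrightarrow> (\<Prod>b\<leftarrow>bs. 1 - 1 / w * b) = (\<Prod>b\<leftarrow>bs. w - b) / w ^ length bs"
  by (induction bs) (auto simp: field_simps)

lemma ratio_inverse:
  assumes "w \<noteq> 0"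
  shows "ratio as bs (1 / w) = ratio_infinity as bs w"
proof -
  have 1: "1 - 1 / w = (w - 1) / w" using assms by (simp add: field_simps)
  have 2: "w powi (int (length as) - int (length bs)) = w ^ length as / w ^ length bs"
    using assms by (simp add: power_int_diff)
  show ?thesis
    unfolding ratio_def ratio_infinity_def prod_list_one_minus_inverse[OF assms] 1 power_int_divide_distrib 2
    using assms by (simp add: field_simps)
qed

text \<open>The pole at infinity is governed by \<open>k + e\<close> alone: it is absent as soon as
  \<open>k + e < 0\<close>.\<close>

lemma integrand_inverse:
  assumes "w \<noteq> 0"
  shows "integrand as bs k e (1 / w) / w ^ 2
    = w powi (- e - k - 1) * ((w - 1) powi k * ratio_infinity as bs w)"
proof -
  have 1: "1 - 1 / w = (w - 1) / w" using assms by (simp add: field_simps)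
  have 2: "w powi (- e - k - 1) = w powi (1 - e) * w powi (- k) * w powi (- 2)"
    using assms by (simp flip: power_int_add)
  have 3: "(1 / w) powi (e - 1) = w powi (1 - e)"
  proof -
    have e: "1 - e = - (e - 1)" by simp
    show ?thesis unfolding e power_int_minus power_int_divide_distrib by (simp add: inverse_eq_divide)
  qed
  show ?thesis
    unfolding integrand_def ratio_inverse[OF assms] 3 2 unfolding 1 power_int_divide_distrib
    by (simp add: power_int_minus divide_inverse mult_ac)
qed

abbreviation nonzero :: "complex list \<Rightarrow> bool" where
  "nonzero as \<equiv> 0 \<notin> set as"

definition zero_domain :: "complex list \<Rightarrow> complex set" where
  "zero_domain as = - (insert 1 (inverse ` set as))"

definition infinity_domain :: "complex list \<Rightarrow> complex set" where
  "infinity_domain as = - (insert 1 (set as))"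

lemma domains:
  assumes "nonzero as"
  shows "open (zero_domain as)" "0 \<in> zero_domain as"
    "open (infinity_domain as)" "0 \<in> infinity_domain as"
    "ratio as bs holomorphic_on zero_domain as"
    "ratio_infinity as bs holomorphic_on infinity_domain as"
    "z \<in> zero_domain as \<Longrightarrow> z \<noteq> 1" "z \<in> infinity_domain as \<Longrightarrow> z \<noteq> 1"
proof -
  show "ratio as bs holomorphic_on zero_domain as"
  proof (rule ratio_holomorphic)
    show "z * a \<noteq> 1" if "z \<in> zero_domain as" "a \<in> set as" for z a
    proof
      assume "z * a = 1"
      then have "inverse a = z" by (metis inverse_unique mult.commute)
      with that show False by (auto simp: zero_domain_def)
    qed
  qed (auto simp: zero_domain_def)
  show "ratio_infinity as bs holomorphic_on infinity_domain as"
    by (rule ratio_infinity_holomorphic) (auto simp: infinity_domain_def)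
qed (use assms in \<open>auto simp: zero_domain_def infinity_domain_def
       intro!: open_Compl finite_imp_closed\<close>)

lemma isolated_ends_integrand:
  assumes "nonzero as"
  shows "isolated_ends (integrand as bs k e)"
  unfolding isolated_ends_def
proof
  note D = domains[OF assms]
  have "integrand as bs k e holomorphic_on zero_domain as - {0}"
    unfolding integrand_def[abs_def]
    using D(7) by (auto intro!: holomorphic_intros holomorphic_on_subset[OF D(5)])
  then show "\<exists>U. open U \<and> 0 \<in> U \<and> integrand as bs k e holomorphic_on U - {0}"
    using D by blast
  have "(\<lambda>w. w powi (- e - k - 1) * ((w - 1) powi k * ratio_infinity as bs w))
      holomorphic_on infinity_domain as - {0}"
    using D(8) by (auto intro!: holomorphic_intros holomorphic_on_subset[OF D(6)])
  then have "(\<lambda>w. integrand as bs k e (1 / w) / w ^ 2) holomorphic_on infinity_domain as - {0}"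
    by (rule holomorphic_transform) (use integrand_inverse in auto)
  then show "\<exists>U. open U \<and> 0 \<in> U \<and> (\<lambda>w. integrand as bs k e (1 / w) / w ^ 2) holomorphic_on U - {0}"
    using D by blast
qed

lemma residue_infinity_integrand:
  assumes "nonzero as" "k + e < 0"
  shows "residue_infinity (integrand as bs k e) = 0"
proof -
  note D = domains[OF assms(1)]
  have "residue (\<lambda>w. integrand as bs k e (1 / w) / w ^ 2) 0
    = residue (\<lambda>w. w powi (- e - k - 1) * ((w - 1) powi k * ratio_infinity as bs w)) 0"
    by (rule residue_cong) (use integrand_inverse in \<open>auto simp: eventually_at_filter\<close>)
  also have "\<dots> = 0"
    by (rule residue_holo[OF D(3,4)])
      (use assms(2) D(8) in \<open>auto intro!: holomorphic_intros D(6)\<close>)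
  finally show ?thesis by (simp add: residue_infinity_def)
qed

text \<open>The condition \<open>e > 0\<close> removes the pole at 0, and \<open>k + e < 0\<close>
  the one at infinity.\<close>

lemma moment_eq_0:
  assumes "nonzero as" "k + e < 0" "e > 0"
  shows "moment as bs k e = 0"
proof -
  note D = domains[OF assms(1)]
  have "residue (integrand as bs k e) 0 = 0"
    unfolding integrand_def[abs_def]
    by (rule residue_holo[OF D(1,2)])
      (use assms(3) D(7) in \<open>auto intro!: holomorphic_intros D(5)\<close>)
  then show ?thesis
    using residue_infinity_integrand[OF assms(1,2)] by (simp add: moment_def end_residue_def)
qed

lemma moment_eq_1:
  assumes "nonzero as" "k < 0"
  shows "moment as bs k 0 = 1"
proof -
  note D = domains[OF assms(1)]
  have "residue (integrand as bs k 0) 0 = residue (\<lambda>z. ((1 - z) powi k * ratio as bs z) / (z - 0)) 0"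
    unfolding integrand_def[abs_def] by (simp add: power_int_minus field_simps)
  also have "\<dots> = (1 - 0) powi k * ratio as bs 0"
    by (rule residue_simple[OF D(1,2)])
      (use D(7) in \<open>auto intro!: holomorphic_intros D(5)\<close>)
  also have "ratio as bs 0 = 1"
    by (simp add: ratio_def map_replicate_const)
  finally show ?thesis
    using residue_infinity_integrand[OF assms(1), of k 0] assms(2)
    by (simp add: moment_def end_residue_def)
qed

text \<open>With \<open>y = 1 - z\<close> this is \<open>y^k - y^(k+1) = y^k z\<close> under the
  residues.\<close>

lemma moment_step:
  assumes "nonzero as"
  shows "moment as bs k e - moment as bs (k + 1) e = moment as bs k (e + 1)"
proof -
  have "end_residue (integrand as bs k (e + 1))
      = end_residue (\<lambda>z. integrand as bs k e z + (- 1) * integrand as bs (k + 1) e z)"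
  proof (rule end_residue_cong[of "{0, 1}"])
    fix z :: complex assume z: "z \<notin> {0, 1}"
    then have "z powi (e + 1 - 1) = z powi (e - 1) * z" "(1 - z) powi (k + 1) = (1 - z) powi k * (1 - z)"
      by (simp_all add: power_int_add power_int_diff)
    then show "integrand as bs k (e + 1) z = integrand as bs k e z + (- 1) * integrand as bs (k + 1) e z"
      unfolding integrand_def by (simp only:) (simp add: algebra_simps)
  qed simp
  also have "\<dots> = end_residue (integrand as bs k e) + (- 1) * end_residue (integrand as bs (k + 1) e)"
    by (intro end_residue_lincomb isolated_ends_integrand assms)
  finally show ?thesis by (simp add: moment_def)
qed

text \<open>Multiplication by \<open>1 - z a\<close> cancels the letter \<open>a\<close> in the
  denominator of \<open>ratio\<close>; the longer alphabet also carries one more factor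
  \<open>1 - z\<close>, hence \<open>k + 1\<close> on the right.\<close>

lemma moment_Cons:
  assumes "nonzero (a # as)"
  shows "moment (a # as) bs k e - a * moment (a # as) bs k (e + 1) = moment as bs (k + 1) e"
proof -
  have "end_residue (integrand as bs (k + 1) e)
      = end_residue (\<lambda>z. integrand (a # as) bs k e z + (- a) * integrand (a # as) bs k (e + 1) z)"
  proof (rule end_residue_cong[of "{0, 1, inverse a}"])
    fix z assume z: "z \<notin> {0, 1, inverse a}"
    have za: "1 - z * a \<noteq> 0"
    proof
      assume "1 - z * a = 0"
      then have "a * z = 1" by (simp add: mult.commute)
      then have "inverse a = z" by (rule inverse_unique)
      with z show False by simp
    qed
    have "int (length (a # as)) - int (length bs) = int (length as) - int (length bs) + 1" by simp
    then have "(1 - z) powi (int (length (a # as)) - int (length bs))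
       = (1 - z) powi (int (length as) - int (length bs)) * (1 - z)"
      using z powi_add'[of "1 - z" "int (length as) - int (length bs)" 1]
      by (simp add: algebra_simps)
    then have r: "ratio (a # as) bs z * (1 - z * a) = ratio as bs z * (1 - z)"
      using za by (simp add: ratio_def)
    have p: "z powi (e + 1 - 1) = z powi (e - 1) * z" "(1 - z) powi (k + 1) = (1 - z) powi k * (1 - z)"
      using z by (simp_all add: power_int_add power_int_diff)
    have "integrand (a # as) bs k e z + (- a) * integrand (a # as) bs k (e + 1) z
        = z powi (e - 1) * (1 - z) powi k * (ratio (a # as) bs z * (1 - z * a))"
      unfolding integrand_def p by (simp add: algebra_simps)
    then show "integrand as bs (k + 1) e z
        = integrand (a # as) bs k e z + (- a) * integrand (a # as) bs k (e + 1) z"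
      unfolding integrand_def r p by (simp add: mult_ac)
  qed simp
  also have "\<dots> = end_residue (integrand (a # as) bs k e)
      + (- a) * end_residue (integrand (a # as) bs k (e + 1))"
    by (intro end_residue_lincomb isolated_ends_integrand assms)
  finally show ?thesis by (simp add: moment_def)
qed

lemma moment_mset:
  assumes "mset as = mset as'"
  shows "moment as bs = moment as' bs"
proof -
  have P: "(\<Prod>a\<leftarrow>xs. f a) = prod_mset (image_mset f (mset xs))" for f :: "complex \<Rightarrow> complex" and xs
    by (induction xs) auto
  have "ratio as bs z = ratio as' bs z" for z
    unfolding ratio_def P by (simp only: assms mset_eq_length[OF assms])
  then have "ratio as bs = ratio as' bs" by (rule ext)
  then show ?thesis unfolding moment_def[abs_def] integrand_def[abs_def] by (simp only:)
qed

text \<open>In the variable \<open>y = 1 - z\<close> one has \<open>1 - z a = a (y - x)\<close> with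
  \<open>x = 1 - 1/a\<close>, so this is the removal of a letter expressed without changing
  \<open>e\<close>.\<close>

lemma moment_shift_k:
  assumes "nonzero (a # as)"
  shows "moment (a # as) bs k e - (1 - 1 / a) * moment (a # as) bs (k - 1) e
    = 1 / a * moment as bs k e"
proof -
  define u v where "u = moment (a # as) bs (k - 1) e" and "v = moment (a # as) bs k e"
  have "u - a * (u - v) = moment as bs k e"
    using moment_Cons[OF assms, of bs "k - 1" e] moment_step[OF assms, of bs "k - 1" e]
    by (simp add: u_def v_def)
  moreover have "v - (1 - 1 / a) * u = 1 / a * (u - a * (u - v))"
    using assms by (simp add: algebra_simps)
  ultimately show ?thesis by (simp add: u_def v_def)
qed

text \<open>Without letters and for \<open>k >= 0\<close> the integrand is a Laurent polynomial,
  whose only poles are 0 and infinity, so the two residues cancel.\<close>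

lemma moment_Nil_eq_0: "k \<ge> 0 \<Longrightarrow> moment [] [] k e = 0"
proof (induction k arbitrary: e rule: int_ge_induct)
  case base
  have *: "residue (\<lambda>z. z powi m) 0 = (if m = -1 then 1 else 0)" for m :: int
  proof (cases "m \<ge> 0")
    case True
    then have "residue (\<lambda>z::complex. z powi m) 0 = 0"
      by (intro residue_holo[of UNIV]) (auto intro!: holomorphic_intros)
    then show ?thesis using True by simp
  next
    case False
    define n where "n = nat (- m - 1)"
    have n: "m = - int (Suc n)" using False by (simp add: n_def)
    have "residue (\<lambda>z::complex. z powi m) 0 = residue (\<lambda>z::complex. 1 / z ^ Suc n) 0"
      unfolding n power_int_minus power_int_of_nat by (simp add: inverse_eq_divide)
    also have "\<dots> = (deriv ^^ n) (\<lambda>_. 1) 0 / fact n"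
      by (rule residue_holomorphic_over_power'[of UNIV]) auto
    also have "\<dots> = (if n = 0 then 1 else 0)"
      by (simp add: higher_deriv_const)
    finally show ?thesis by (auto simp: n)
  qed
  have "residue (\<lambda>w::complex. (1 / w) powi (e - 1) / w ^ 2) 0 = residue (\<lambda>w. w powi (- 1 - e)) 0"
  proof (rule residue_cong)
    show "\<forall>\<^sub>F z in at 0. (1 / z :: complex) powi (e - 1) / z\<^sup>2 = z powi (- 1 - e)"
      unfolding eventually_at_filter
    proof (intro always_eventually allI impI)
      fix z :: complex assume "z \<noteq> 0"
      then show "(1 / z) powi (e - 1) / z\<^sup>2 = z powi (- 1 - e)"
        by (simp add: power_int_divide_distrib power_int_diff power2_eq_square field_simps power_int_minus)
    qed
  qed simp
  then show ?case
    by (simp add: moment_def end_residue_def residue_infinity_def integrand_def[abs_def] ratio_def *)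
next
  case (step i)
  then show ?case using moment_step[of "[]" "[]" i e] by simp
qed

section \<open>The determinant formula\<close>

text \<open>One \<open>c\<close> serves all \<open>X\<close>: these coefficients become the
  unitriangular factor of the Vandermonde matrix.\<close>

lemma newton_basis_expansion:
  fixes u :: "nat \<Rightarrow> 'a::comm_ring_1"
  shows "\<exists>c. (\<forall>k>j. c k = 0) \<and> c j = 1 \<and> (\<forall>X. X ^ j = (\<Sum>k\<le>j. c k * (\<Prod>l<k. X - u l)))"
proof (induction j)
  case 0
  show ?case by (rule exI[of _ "\<lambda>k. if k = 0 then 1 else 0"]) auto
next
  case (Suc j)
  then obtain c where c: "\<And>k. k > j \<Longrightarrow> c k = 0" "c j = 1"
    "\<And>X. X ^ j = (\<Sum>k\<le>j. c k * (\<Prod>l<k. X - u l))" by blast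
  define d where "d = (\<lambda>k. (if k = 0 then 0 else c (k - 1)) + u k * c k)"
  have "X ^ Suc j = (\<Sum>k\<le>Suc j. d k * (\<Prod>l<k. X - u l))" for X
  proof -
    have "X ^ Suc j = (\<Sum>k\<le>j. c k * (\<Prod>l<Suc k. X - u l)) + (\<Sum>k\<le>j. u k * c k * (\<Prod>l<k. X - u l))"
      unfolding power_Suc c(3) sum_distrib_left sum.distrib[symmetric]
      by (rule sum.cong) (auto simp: algebra_simps)
    also have "(\<Sum>k\<le>j. c k * (\<Prod>l<Suc k. X - u l))
        = (\<Sum>k\<le>Suc j. (if k = 0 then 0 else c (k - 1)) * (\<Prod>l<k. X - u l))"
      by (subst sum.atMost_Suc_shift) simp
    also have "(\<Sum>k\<le>j. u k * c k * (\<Prod>l<k. X - u l)) = (\<Sum>k\<le>Suc j. u k * c k * (\<Prod>l<k. X - u l))"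
      using c(1) by simp
    finally show ?thesis
      by (simp add: d_def sum.distrib distrib_right)
  qed
  moreover have "\<forall>k>Suc j. d k = 0" "d (Suc j) = 1"
    using c(1,2) by (auto simp: d_def)
  ultimately show ?case by blast
qed

lemma vandermonde_det:
  fixes u :: "nat \<Rightarrow> 'a::comm_ring_1"
  shows "Determinant.det (Matrix.mat n n (\<lambda>(i, j). u i ^ j)) = (\<Prod>j<n. \<Prod>i<j. u j - u i)"
proof -
  obtain c where c: "\<And>j k. k > j \<Longrightarrow> c j k = 0" "\<And>j. c j j = 1"
    "\<And>j X. X ^ j = (\<Sum>k\<le>j. c j k * (\<Prod>l<k. X - u l))"
    using newton_basis_expansion[of _ u] by metis
  \<comment> \<open>Lower triangular: for \<open>i < k\<close> the product contains the factor
    \<open>u i - u i\<close>.\<close>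
  define A where "A = Matrix.mat n n (\<lambda>(i, k). \<Prod>l<k. u i - u l)"
  define B where "B = Matrix.mat n n (\<lambda>(k, j). c j k)"
  have AB: "A \<in> carrier_mat n n" "B \<in> carrier_mat n n" by (simp_all add: A_def B_def)
  have "Matrix.mat n n (\<lambda>(i, j). u i ^ j) = A * B"
  proof (rule eq_matI)
    fix i j assume ij: "i < dim_row (A * B)" "j < dim_col (A * B)"
    then have *: "i < n" "j < n" using AB by auto
    have "u i ^ j = (\<Sum>k\<le>j. c j k * (\<Prod>l<k. u i - u l))" by (rule c(3))
    also have "\<dots> = (\<Sum>k<n. c j k * (\<Prod>l<k. u i - u l))"
      by (rule sum.mono_neutral_left) (use * c(1) in auto)
    finally show "Matrix.mat n n (\<lambda>(i, j). u i ^ j) $$ (i, j) = (A * B) $$ (i, j)"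
      using * by (simp add: A_def B_def scalar_prod_def atLeast0LessThan mult.commute)
  qed (use AB in auto)
  then have "Determinant.det (Matrix.mat n n (\<lambda>(i, j). u i ^ j)) = Determinant.det A * Determinant.det B"
    using det_mult[OF AB] by simp
  also have "Determinant.det B = prod_list (diag_mat B)"
    by (rule det_upper_triangular[OF _ AB(2)]) (use c(1) in \<open>auto simp: B_def\<close>)
  also have "prod_list (diag_mat B) = 1"
    by (simp add: diag_mat_def B_def c(2) prod.list_conv_set_nth)
  also have "Determinant.det A = prod_list (diag_mat A)"
    by (rule det_lower_triangular[OF _ AB(1)]) (auto simp: A_def intro!: prod_zero)
  also have "\<dots> = (\<Prod>j<n. \<Prod>i<j. u j - u i)"
    by (simp add: diag_mat_def A_def prod.list_conv_set_nth atLeast0LessThan)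
  finally show ?thesis by simp
qed

text \<open>Taking \<open>z j\<close> out of each of the \<open>j\<close> inner factors leaves
  differences of inverses, a Vandermonde determinant in \<open>1 / z\<close>. Its Leibniz expansion
  separates the variables, as the iterated residue requires.\<close>

lemma prod_one_minus_quotient:
  fixes z :: "nat \<Rightarrow> complex"
  assumes "\<And>i. i < n \<Longrightarrow> z i \<noteq> 0"
  shows "(\<Prod>j<n. \<Prod>i<j. 1 - z j / z i)
    = (\<Sum>p | p permutes {0..<n}. signof p * (\<Prod>i<n. z i powi (int i - int (p i))))"
proof -
  have "(\<Prod>j<n. \<Prod>i<j. 1 - z j / z i) = (\<Prod>j<n. z j ^ j * (\<Prod>i<j. 1 / z j - 1 / z i))"
  proof (rule prod.cong, simp)
    fix j assume j: "j \<in> {..<n}"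
    have "z j ^ j * (\<Prod>i<j. 1 / z j - 1 / z i) = (\<Prod>i<j. z j * (1 / z j - 1 / z i))"
      by (simp add: prod.distrib)
    also have "\<dots> = (\<Prod>i<j. 1 - z j / z i)"
      by (rule prod.cong) (use assms j in \<open>auto simp: right_diff_distrib\<close>)
    finally show "(\<Prod>i<j. 1 - z j / z i) = z j ^ j * (\<Prod>i<j. 1 / z j - 1 / z i)" ..
  qed
  also have "\<dots> = (\<Prod>j<n. z j ^ j) * Determinant.det (Matrix.mat n n (\<lambda>(i, j). (1 / z i) ^ j))"
    by (simp add: prod.distrib vandermonde_det)
  also have "Determinant.det (Matrix.mat n n (\<lambda>(i, j). (1 / z i) ^ j))
      = (\<Sum>p | p permutes {0..<n}. signof p * (\<Prod>i<n. (1 / z i) ^ p i))"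
    by (subst det_def'[where n = n])
       (auto intro!: sum.cong prod.cong simp: atLeast0LessThan permutes_in_image[of _ "{..<n}", simplified])
  also have "(\<Prod>j<n. z j ^ j) * \<dots>
      = (\<Sum>p | p permutes {0..<n}. signof p * (\<Prod>i<n. z i ^ i * (1 / z i) ^ p i))"
    by (simp add: sum_distrib_left prod.distrib mult_ac)
  also have "\<dots> = (\<Sum>p | p permutes {0..<n}. signof p * (\<Prod>i<n. z i powi (int i - int (p i))))"
    using assms
    by (intro sum.cong prod.cong arg_cong2[of _ _ _ _ "(*)"] refl) (simp add: power_int_diff power_divide)
  finally show ?thesis .
qed

text \<open>A Jacobi-Trudi type matrix. Row \<open>i\<close> involves only the entry
  \<open>I ! i\<close>, so linear relations between rows become relations between the
  \<open>G\<close> of sequences that differ in a few entries.\<close>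

definition moment_matrix :: "int list \<Rightarrow> complex list \<Rightarrow> complex list \<Rightarrow> complex mat" where
  "moment_matrix I as bs = Matrix.mat (length I) (length I)
     (\<lambda>(i, j). moment as bs (I ! i - int (Suc i)) (int i - int j))"

lemma moment_matrix_carrier [simp]: "moment_matrix I as bs \<in> carrier_mat (length I) (length I)"
  by (simp add: moment_matrix_def)

lemma grothendieck_leibniz:
  assumes "nonzero as"
  shows "grothendieck I as bs = (\<Sum>p | p permutes {0..<length I}. signof p
    * (\<Prod>i<length I. moment as bs (I ! i - int (Suc i)) (int i - int (p i))))"
proof -
  define n where "n = length I"
  have "grothendieck I as bs = iterated_residue n (\<lambda>zs. \<Sum>p | p permutes {0..<n}. signof p
      * (\<Prod>i<n. integrand as bs (I ! i - int (Suc i)) (int i - int (p i)) (zs ! i)))"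
    unfolding grothendieck_def n_def[symmetric]
  proof (rule iterated_residue_cong)
    fix zs :: "complex list" assume zs: "length zs = n" "nonzero zs"
    have nz: "zs ! i \<noteq> 0" if "i < n" for i using zs that by (metis nth_mem)
    have "(\<Prod>j<n. (1 - zs ! j) powi (I ! j - int (Suc j))) * kappa n as bs zs
      = (\<Prod>i<n. (1 - zs ! i) powi (I ! i - int (Suc i)) * ratio as bs (zs ! i) / zs ! i)
        * (\<Prod>j<n. \<Prod>i<j. 1 - zs ! j / zs ! i)"
    proof -
      have *: "1 / (z * (1 - z) powi (int (length bs) - int (length as)))
        = (1 - z) powi (int (length as) - int (length bs)) / z" for z :: complex
        using power_int_minus[of "1 - z" "int (length as) - int (length bs)"] by (simp add: divide_inverse)
      show ?thesis
        unfolding kappa_def * ratio_def mult.assoc[symmetric] prod.distrib[symmetric]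
        by (simp add: mult_ac)
    qed
    also have "(\<Prod>j<n. \<Prod>i<j. 1 - zs ! j / zs ! i)
        = (\<Sum>p | p permutes {0..<n}. signof p * (\<Prod>i<n. (zs ! i) powi (int i - int (p i))))"
      by (rule prod_one_minus_quotient) (rule nz)
    also have "(\<Prod>i<n. (1 - zs ! i) powi (I ! i - int (Suc i)) * ratio as bs (zs ! i) / zs ! i) * \<dots>
      = (\<Sum>p | p permutes {0..<n}. signof p
      * (\<Prod>i<n. integrand as bs (I ! i - int (Suc i)) (int i - int (p i)) (zs ! i)))"
      unfolding sum_distrib_left mult.left_commute[of _ "signof _"] prod.distrib[symmetric]
      by (intro sum.cong prod.cong arg_cong2[of _ _ _ _ "(*)"] refl)
         (use nz in \<open>simp add: integrand_def power_int_diff mult_ac\<close>)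
    finally show "(\<Prod>j<n. (1 - zs ! j) powi (I ! j - int (Suc j))) * kappa n as bs zs = \<dots>" .
  qed
  also have "\<dots> = (\<Sum>p | p permutes {0..<n}. signof p
    * (\<Prod>i<n. moment as bs (I ! i - int (Suc i)) (int i - int (p i))))"
    unfolding moment_def
    by (rule iterated_residue_sum_prod)
       (simp_all add: finite_permutations isolated_ends_integrand[OF assms])
  finally show ?thesis by (simp add: n_def)
qed

lemma permutes_atLeast0: "p permutes {0..<n::nat} \<Longrightarrow> i < n \<Longrightarrow> p i < n"
  by (metis atLeastLessThan_iff permutes_in_image zero_le)

lemma det_leibniz:
  "Determinant.det (Matrix.mat n n f)
    = (\<Sum>p | p permutes {0..<n}. signof p * (\<Prod>i<n. f (i, p i)))"
  by (subst det_def'[where n = n])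
     (auto intro!: sum.cong prod.cong simp: atLeast0LessThan permutes_atLeast0[unfolded atLeast0LessThan])

lemma grothendieck_det:
  assumes "nonzero as"
  shows "grothendieck I as bs = Determinant.det (moment_matrix I as bs)"
  unfolding moment_matrix_def det_leibniz grothendieck_leibniz[OF assms] by simp

lemma grothendieck_mset:
  "mset as = mset as' \<Longrightarrow> nonzero as \<Longrightarrow> grothendieck I as bs = grothendieck I as' bs"
  using moment_mset[of as as' bs] mset_eq_setD[of as as']
  by (simp add: grothendieck_leibniz)

section \<open>Straightening\<close>

definition two_rows_matrix ::
    "nat \<Rightarrow> (nat \<Rightarrow> nat \<Rightarrow> 'a) \<Rightarrow> nat \<Rightarrow> (nat \<Rightarrow> 'a) \<Rightarrow> (nat \<Rightarrow> 'a) \<Rightarrow> 'a mat" where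
  "two_rows_matrix n h i f g =
     Matrix.mat n n (\<lambda>(r, j). if r = i then f j else if r = Suc i then g j else h r j)"

lemma det_two_rows:
  fixes f g :: "nat \<Rightarrow> 'a::comm_ring_1"
  assumes "Suc i < n"
  shows "Determinant.det (two_rows_matrix n h i f g) = (\<Sum>p | p permutes {0..<n}.
    signof p * (f (p i) * (g (p (Suc i)) * (\<Prod>r\<in>{..<n} - {i} - {Suc i}. h r (p r)))))"
  unfolding two_rows_matrix_def det_leibniz
proof (intro sum.cong refl arg_cong2[of _ _ _ _ "(*)"])
  fix p
  let ?F = "\<lambda>r. if r = i then f (p r) else if r = Suc i then g (p r) else h r (p r)"
  have "(\<Prod>r<n. ?F r) = ?F i * (?F (Suc i) * (\<Prod>r\<in>{..<n} - {i} - {Suc i}. ?F r))"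
    using assms by (subst prod.remove[of _ i]; (subst prod.remove[of _ "Suc i"])?) auto
  also have "(\<Prod>r\<in>{..<n} - {i} - {Suc i}. ?F r) = (\<Prod>r\<in>{..<n} - {i} - {Suc i}. h r (p r))"
    by (rule prod.cong) auto
  finally show "(\<Prod>r<n. case (r, p r) of (r, j) \<Rightarrow> if r = i then f j else if r = Suc i then g j else h r j)
    = f (p i) * (g (p (Suc i)) * (\<Prod>r\<in>{..<n} - {i} - {Suc i}. h r (p r)))"
    by simp
qed

lemma det_two_rows_diff:
  fixes f g :: "nat \<Rightarrow> 'a::comm_ring_1"
  assumes "Suc i < n"
  shows "Determinant.det (two_rows_matrix n h i (\<lambda>j. f j - f' j) g)
    = Determinant.det (two_rows_matrix n h i f g) - Determinant.det (two_rows_matrix n h i f' g)"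
  unfolding det_two_rows[OF assms] by (simp add: sum_subtractf algebra_simps)

lemma det_two_rows_swap:
  fixes f g :: "nat \<Rightarrow> 'a::comm_ring_1"
  assumes "Suc i < n"
  shows "Determinant.det (two_rows_matrix n h i g f) = - Determinant.det (two_rows_matrix n h i f g)"
proof -
  have "two_rows_matrix n h i g f = swaprows i (Suc i) (two_rows_matrix n h i f g)"
    using assms by (auto simp: two_rows_matrix_def mat_swaprows_def intro!: eq_matI)
  moreover have "two_rows_matrix n h i f g \<in> carrier_mat n n" by (simp add: two_rows_matrix_def)
  ultimately show ?thesis using assms by (simp add: det_swaprows[of i n "Suc i"])
qed

abbreviation update2 :: "'a list \<Rightarrow> nat \<Rightarrow> 'a \<Rightarrow> 'a \<Rightarrow> 'a list" where
  "update2 I i p q \<equiv> I[i := p, Suc i := q]"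

text \<open>By \<open>moment_step\<close>, the difference between the entries \<open>p\<close> and
  \<open>p + 1\<close> in row \<open>i\<close> raises its exponents from \<open>i - j\<close> to
  \<open>i + 1 - j\<close>, those of row \<open>Suc i\<close>. The two rows are then of the same
  kind, and exchanging them replaces \<open>(p, q)\<close> by \<open>(q - 1, p + 1)\<close>, because
  the rows subtract \<open>i + 1\<close> and \<open>i + 2\<close>.\<close>

lemma grothendieck_adjacent:
  assumes "Suc i < length I" "nonzero as"
  shows "grothendieck (update2 I i p q) as bs - grothendieck (update2 I i (p + 1) q) as bs
    + grothendieck (update2 I i (q - 1) (p + 1)) as bs - grothendieck (update2 I i q (p + 1)) as bs = 0"
proof -
  define n where "n = length I"
  let ?h = "\<lambda>r j. moment as bs (I ! r - int (Suc r)) (int r - int j)"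
  let ?N = "two_rows_matrix n ?h i"
  have mat: "moment_matrix (update2 I i a b) as bs
      = ?N (\<lambda>j. moment as bs (a - int i - 1) (int i - int j)) (\<lambda>j. moment as bs (b - int i - 2) (int i + 1 - int j))"
    for a b
    using assms(1)
    by (auto simp: moment_matrix_def two_rows_matrix_def n_def nth_list_update algebra_simps intro!: eq_matI)
  have diff: "grothendieck (update2 I i a b) as bs - grothendieck (update2 I i (a + 1) b) as bs
      = Determinant.det (?N (\<lambda>j. moment as bs (a - int i - 1) (int i + 1 - int j))
          (\<lambda>j. moment as bs (b - int i - 2) (int i + 1 - int j)))" for a b
  proof -
    have "moment as bs (a - int i - 1) (int i + 1 - int j)
        = moment as bs (a - int i - 1) (int i - int j) - moment as bs (a + 1 - int i - 1) (int i - int j)" for j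
      using moment_step[OF assms(2), of bs "a - int i - 1" "int i - int j"] by (simp add: algebra_simps)
    then show ?thesis
      using assms(1) by (simp add: grothendieck_det[OF assms(2)] mat det_two_rows_diff n_def)
  qed
  have "grothendieck (update2 I i (q - 1) (p + 1)) as bs - grothendieck (update2 I i q (p + 1)) as bs
      = Determinant.det (?N (\<lambda>j. moment as bs (q - int i - 2) (int i + 1 - int j))
          (\<lambda>j. moment as bs (p - int i - 1) (int i + 1 - int j)))"
    using diff[of "q - 1" "p + 1"] by (simp add: algebra_simps)
  also have "\<dots> = - (grothendieck (update2 I i p q) as bs - grothendieck (update2 I i (p + 1) q) as bs)"
    unfolding diff by (rule det_two_rows_swap) (use assms(1) n_def in simp)
  finally show ?thesis by (simp only: add_diff_eq[symmetric]) simp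
qed

text \<open>For \<open>k <= 0\<close> the last row is a unit vector: its entries vanish left of the
  diagonal by \<open>moment_eq_0\<close>, and the diagonal entry is 1 by
  \<open>moment_eq_1\<close>.\<close>

lemma grothendieck_snoc:
  assumes "k \<le> 0" "nonzero as"
  shows "grothendieck (I @ [k]) as bs = grothendieck I as bs"
proof -
  define n where "n = length I"
  let ?A = "moment_matrix (I @ [k]) as bs"
  have A: "?A \<in> carrier_mat (Suc n) (Suc n)" using moment_matrix_carrier[of "I @ [k]"] by (simp add: n_def)
  have entry: "?A $$ (n, j) = (if j = n then 1 else 0)" if "j < Suc n" for j
    using that assms moment_eq_0[OF assms(2), of "k - int (Suc n)" "int n - int j" bs]
      moment_eq_1[OF assms(2), of "k - int (Suc n)" bs]
    by (auto simp: moment_matrix_def nth_append n_def)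
  have "Determinant.det ?A = (\<Sum>j<Suc n. ?A $$ (n, j) * cofactor ?A n j)"
    by (rule laplace_expansion_row[OF A]) simp
  also have "\<dots> = cofactor ?A n n"
    using entry by (simp del: cofactor_def)
  also have "\<dots> = Determinant.det (mat_delete ?A n n)"
    by (simp add: cofactor_def)
  also have "mat_delete ?A n n = moment_matrix I as bs"
    by (rule eq_matI) (auto simp: mat_delete_def moment_matrix_def n_def nth_append)
  finally show ?thesis by (simp add: grothendieck_det[OF assms(2)])
qed

text \<open>In a weakly decreasing sequence the nonpositive entries form a tail, which
  \<open>grothendieck_snoc\<close> removes entry by entry.\<close>

lemma sorted_grothendieck_eq_part:
  assumes "sorted_wrt (\<ge>) I"
  obtains l where "map int (parts l) = filter (\<lambda>x. x > 0) I"
    "\<And>as bs. nonzero as \<Longrightarrow> grothendieck I as bs = grothendieck_part l as bs"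
proof -
  let ?I = "filter (\<lambda>x. x > 0) I"
  have s: "sorted_wrt (\<ge>) ?I" using assms by (rule sorted_wrt_filter)
  have "sorted_wrt (\<ge>) (map nat ?I)"
    using s unfolding sorted_wrt_map by (rule sorted_wrt_mono_rel[rotated]) auto
  then have "parts (Abs_integer_partition (map nat ?I)) = map nat ?I"
    by (intro Abs_integer_partition_inverse) auto
  then have l: "map int (parts (Abs_integer_partition (map nat ?I))) = ?I"
    by (auto simp: o_def intro!: map_idI)
  moreover have "grothendieck I as bs = grothendieck ?I as bs" if "nonzero as" for as bs
    using assms
  proof (induction I rule: rev_induct)
    case (snoc k I)
    show ?case
    proof (cases "k \<le> 0")
      case True
      then show ?thesis using snoc that by (simp add: grothendieck_snoc sorted_wrt_append)
    next
      case False
      with snoc.prems have "\<forall>x\<in>set (I @ [k]). x > 0" by (auto simp: sorted_wrt_append)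
      then have "filter (\<lambda>x. x > 0) (I @ [k]) = I @ [k]" by (intro filter_True) auto
      then show ?thesis by simp
    qed
  qed simp
  ultimately show thesis
    using that[of "Abs_integer_partition (map nat ?I)"] by (simp add: grothendieck_part_def)
qed

section \<open>Integral expansions, with bounds on the partitions that occur\<close>

definition eval_Gam :: "Gam \<Rightarrow> complex list \<Rightarrow> complex list \<Rightarrow> complex" where
  "eval_Gam c as bs = (\<Sum>l\<in>keys c. of_int (lookup c l) * grothendieck_part l as bs)"

lemma eval_Gam_superset:
  assumes "finite S" "keys c \<subseteq> S"
  shows "eval_Gam c as bs = (\<Sum>l\<in>S. of_int (lookup c l) * grothendieck_part l as bs)"
  unfolding eval_Gam_def
  by (rule sum.mono_neutral_left) (use assms in \<open>auto simp: in_keys_iff\<close>)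

lemma eval_Gam_add: "eval_Gam (c + d) as bs = eval_Gam c as bs + eval_Gam d as bs"
proof -
  let ?S = "keys c \<union> keys d"
  have "keys (c + d) \<subseteq> ?S" by (rule keys_add)
  then show ?thesis
    by (simp add: eval_Gam_superset[of ?S] lookup_add distrib_right sum.distrib)
qed

lemma eval_Gam_uminus: "eval_Gam (- c) as bs = - eval_Gam c as bs"
  by (simp add: eval_Gam_def keys_minus sum_negf)

lemma eval_Gam_single: "eval_Gam (single l 1) as bs = grothendieck_part l as bs"
  by (simp add: eval_Gam_def)

text \<open>The bounds are recorded for later use: length and \<open>K\<close> confine an expansion
  to a finite box of partitions, and the size bound makes the coefficient sums of the Laurent series
  finite.\<close>

definition straightening :: "int \<Rightarrow> int list \<Rightarrow> Gam \<Rightarrow> bool" where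
  "straightening K I c \<longleftrightarrow>
     (\<forall>as bs. nonzero as \<longrightarrow> grothendieck I as bs = eval_Gam c as bs) \<and>
     (\<forall>l\<in>keys c. length (parts l) \<le> length I \<and> (\<forall>x\<in>set (parts l). int x \<le> K)
        \<and> ((\<forall>x\<in>set I. 0 \<le> x) \<longrightarrow> sum_list I \<le> int (sum_list (parts l))))"

lemma sum_list_filter_pos: "\<forall>x\<in>set I. 0 \<le> x \<Longrightarrow> sum_list (filter (\<lambda>x. x > 0) I) = sum_list (I :: int list)"
  by (induction I) auto

lemma straightening_sorted:
  assumes "sorted_wrt (\<ge>) I" "\<forall>x\<in>set I. x \<le> K"
  shows "\<exists>c. straightening K I c"
proof -
  obtain l where l: "map int (parts l) = filter (\<lambda>x. x > 0) I"
    "\<And>as bs. nonzero as \<Longrightarrow> grothendieck I as bs = grothendieck_part l as bs"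
    using sorted_grothendieck_eq_part[OF assms(1)] by blast
  have "length (parts l) \<le> length I"
    using arg_cong[OF l(1), of length] length_filter_le[of _ I] by simp
  moreover have "int x \<le> K" if "x \<in> set (parts l)" for x
  proof -
    have "int x \<in> set (map int (parts l))" using that by simp
    then show ?thesis using assms(2) unfolding l(1) by auto
  qed
  moreover have "sum_list I \<le> int (sum_list (parts l))" if "\<forall>x\<in>set I. 0 \<le> x"
  proof -
    have "int (sum_list xs) = sum_list (map int xs)" for xs
      by (induction xs) simp_all
    then have "int (sum_list (parts l)) = sum_list (map int (parts l))" .
    also have "\<dots> = sum_list I" unfolding l(1) by (rule sum_list_filter_pos[OF that])
    finally show ?thesis by simp
  qed
  ultimately have "straightening K I (single l 1)"
    using l(2) by (auto simp: straightening_def eval_Gam_single)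
  then show ?thesis ..
qed

text \<open>Termination measure. Earlier positions weigh more, so each sequence that replaces an
  ascent, having a larger total or the same total shifted to the left, has a smaller value; entries
  at most \<open>K\<close> keep it nonnegative.\<close>

definition deficiency :: "int \<Rightarrow> int list \<Rightarrow> int" where
  "deficiency K I = (\<Sum>j<length I. (K - I ! j) * int (length I - j))"

lemma deficiency_update2:
  assumes "Suc i < length I"
  shows "deficiency K (update2 I i a b) = deficiency K I - (a - I ! i) * int (length I - i)
    - (b - I ! Suc i) * int (length I - Suc i)"
proof -
  have "deficiency K J = (K - J ! i) * int (length J - i) + ((K - J ! Suc i) * int (length J - Suc i)
      + (\<Sum>j\<in>{..<length J} - {i} - {Suc i}. (K - J ! j) * int (length J - j)))"
    if "length J = length I" for J
    using assms that unfolding deficiency_def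
    by (subst sum.remove[of _ i]; (subst sum.remove[of _ "Suc i"])?) auto
  note * = this[of I, OF refl] this[of "update2 I i a b", simplified]
  have "(\<Sum>j\<in>{..<length I} - {i} - {Suc i}. (K - update2 I i a b ! j) * int (length I - j))
      = (\<Sum>j\<in>{..<length I} - {i} - {Suc i}. (K - I ! j) * int (length I - j))"
    by (rule sum.cong) auto
  then show ?thesis using assms unfolding * by (simp add: algebra_simps)
qed

lemma deficiency_nonneg: "\<forall>x\<in>set I. x \<le> K \<Longrightarrow> deficiency K I \<ge> 0"
  unfolding deficiency_def by (intro sum_nonneg mult_nonneg_nonneg) auto

lemma sum_list_update_int: "k < length I \<Longrightarrow> sum_list (I[k := x]) = sum_list I + x - (I ! k :: int)"
  by (induction I arbitrary: k) (auto split: nat.split)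

lemma sum_list_update2:
  assumes "Suc i < length I"
  shows "sum_list (update2 I i a b) = sum_list I + (a - I ! i) + (b - I ! Suc i :: int)"
  using assms by (simp add: sum_list_update_int)

lemma straightening_step:
  assumes "straightening K J c" "length J = length I"
    "(\<forall>x\<in>set I. 0 \<le> x) \<longrightarrow> (\<forall>x\<in>set J. 0 \<le> x)" "sum_list I \<le> sum_list J" "l \<in> keys c"
  shows "length (parts l) \<le> length I \<and> (\<forall>x\<in>set (parts l). int x \<le> K)
        \<and> ((\<forall>x\<in>set I. 0 \<le> x) \<longrightarrow> sum_list I \<le> int (sum_list (parts l)))"
  using assms unfolding straightening_def by force

lemma straightening_exists:
  assumes "\<forall>x\<in>set I. x \<le> K"
  shows "\<exists>c. straightening K I c"
  using assms
proof (induction "nat (deficiency K I)" arbitrary: I rule: less_induct)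
  case less
  show ?case
  proof (cases "sorted_wrt (\<ge>) I")
    case True
    then show ?thesis using less.prems by (rule straightening_sorted)
  next
    case False
    then obtain i where i: "Suc i < length I" "I ! i < I ! Suc i"
      by (auto simp: sorted_wrt_iff_nth_Suc_transp not_le)
    define p q where "p = I ! i" and "q = I ! Suc i"
    have pq: "p < q" using i by (simp add: p_def q_def)
    have I: "update2 I i p q = I" by (simp add: p_def q_def list_update_id list_update_swap)
    have mem: "p \<in> set I" "q \<in> set I" using i by (auto simp: p_def q_def)
    have set: "set (update2 I i a b) \<subseteq> insert b (insert a (set I))" for a b
      by (meson insert_mono order_trans set_update_subset_insert)
    \<comment> \<open>The conditions on \<open>a\<close>, \<open>b\<close> cover the three other
      terms of the relation at once. \<open>(p + 1, q)\<close> and \<open>(q, p + 1)\<close> have a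
      larger sum; \<open>(q - 1, p + 1)\<close> has the same sum, but a larger first entry if
      \<open>q > p + 1\<close>.\<close>
    have IH: "\<exists>c. straightening K (update2 I i a b) c
        \<and> (\<forall>l\<in>keys c. length (parts l) \<le> length I \<and> (\<forall>x\<in>set (parts l). int x \<le> K)
        \<and> ((\<forall>x\<in>set I. 0 \<le> x) \<longrightarrow> sum_list I \<le> int (sum_list (parts l))))"
      if "p \<le> a" "a \<le> q" "p \<le> b" "b \<le> q" "p + q \<le> a + b" "a + b > p + q \<or> a > p" for a b
    proof -
      have le: "\<forall>x\<in>set (update2 I i a b). x \<le> K"
        using set[of a b] less.prems mem that by fastforce
      have "0 < (a - p) * int (length I - i) + (b - q) * int (length I - Suc i)"
      proof -
        have m1: "(a - p) * int (length I - i) + (b - q) * int (length I - Suc i)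
          = (a - p) + (a + b - (p + q)) * int (length I - Suc i)"
          using i(1) by (simp add: algebra_simps of_nat_diff)
        have m2: "0 \<le> (a + b - (p + q)) * int (length I - Suc i)" using that by simp
        have m3: "0 < (a + b - (p + q)) * int (length I - Suc i)" if "a + b > p + q"
          using that i(1) by simp
        show ?thesis
        proof (cases "a + b > p + q")
          case True
          then show ?thesis using m1 m3[OF True] that(1) by linarith
        next
          case False
          then have "p < a" using that(6) by simp
          then show ?thesis using m1 m2 by linarith
        qed
      qed
      then have "deficiency K (update2 I i a b) < deficiency K I"
        unfolding deficiency_update2[OF i(1)] p_def[symmetric] q_def[symmetric] by linarith
      then have "nat (deficiency K (update2 I i a b)) < nat (deficiency K I)"
        using deficiency_nonneg[OF le] by simp
      then obtain c where c: "straightening K (update2 I i a b) c"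
        using less.hyps le by blast
      have "(\<forall>x\<in>set I. 0 \<le> x) \<longrightarrow> (\<forall>x\<in>set (update2 I i a b). 0 \<le> x)"
        using set[of a b] mem that by fastforce
      moreover have "sum_list I \<le> sum_list (update2 I i a b)"
        using that by (simp add: sum_list_update2[OF i(1)] p_def q_def)
      ultimately show ?thesis using c straightening_step[OF c, of I] by auto
    qed
    note rel = grothendieck_adjacent[OF i(1), of _ p q, unfolded I]
    \<comment> \<open>For \<open>q = p + 1\<close> the term \<open>(q - 1, p + 1)\<close> is the
      original sequence and the measure does not drop. The relation then says that twice
      \<open>G_{p,q}\<close> is twice \<open>G_{p+1,q}\<close>.\<close>
    show ?thesis
    proof (cases "q = p + 1")
      case True
      obtain c where c: "straightening K (update2 I i (p + 1) q) c"
        "\<forall>l\<in>keys c. length (parts l) \<le> length I \<and> (\<forall>x\<in>set (parts l). int x \<le> K)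
        \<and> ((\<forall>x\<in>set I. 0 \<le> x) \<longrightarrow> sum_list I \<le> int (sum_list (parts l)))"
        using IH[of "p + 1" q] pq by auto
      have "grothendieck I as bs = grothendieck (update2 I i (p + 1) q) as bs" if "nonzero as" for as bs
        using rel[OF that, of bs] I True by simp
      then have "straightening K I c" using c by (simp add: straightening_def)
      then show ?thesis ..
    next
      case False
      obtain c1 c2 c3 where c: "straightening K (update2 I i (p + 1) q) c1"
        "straightening K (update2 I i (q - 1) (p + 1)) c2" "straightening K (update2 I i q (p + 1)) c3"
        and c': "\<forall>l\<in>keys c1 \<union> keys c2 \<union> keys c3.
        length (parts l) \<le> length I \<and> (\<forall>x\<in>set (parts l). int x \<le> K)
        \<and> ((\<forall>x\<in>set I. 0 \<le> x) \<longrightarrow> sum_list I \<le> int (sum_list (parts l)))"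
        using IH[of "p + 1" q] IH[of "q - 1" "p + 1"] IH[of q "p + 1"] pq False by fastforce
      let ?c = "c1 + (- c2) + c3"
      have "keys ?c \<subseteq> keys c1 \<union> keys c2 \<union> keys c3"
        using keys_add[of "c1 + (- c2)" c3] keys_add[of c1 "- c2"] by (auto simp: keys_minus)
      moreover have "grothendieck I as bs = eval_Gam ?c as bs" if "nonzero as" for as bs
        using rel[OF that, of bs] c that unfolding straightening_def eval_Gam_add eval_Gam_uminus
        by (simp add: algebra_simps)
      ultimately have "straightening K I ?c"
        using c' unfolding straightening_def by blast
      then show ?thesis ..
    qed
  qed
qed

section \<open>Bialternants\<close>

abbreviation alphabet :: "complex list \<Rightarrow> complex list" where
  "alphabet X \<equiv> map (\<lambda>x. 1 / (1 - x)) X"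

lemma nonzero_alphabet: "1 \<notin> set X \<Longrightarrow> nonzero (alphabet X)"
  by auto

lemma moment_alphabet_shift:
  assumes "x \<noteq> 1" "nonzero as"
  shows "moment (1 / (1 - x) # as) [] k e
    = x * moment (1 / (1 - x) # as) [] (k - 1) e + (1 - x) * moment as [] k e"
  using moment_shift_k[of "1 / (1 - x)" as "[]" k e] assms by (simp add: algebra_simps)

text \<open>For \<open>k >= 0\<close> the moment of the empty alphabet vanishes, which gives the
  recursion in \<open>k\<close>; inserting it at \<open>k = 0\<close> into
  \<open>moment_step\<close> gives the dependence on \<open>e\<close>, normalised by
  \<open>moment_eq_1\<close> at \<open>e = 0\<close>.\<close>

lemma moment_single:
  assumes "x \<noteq> 1" "k \<ge> - 1"
  shows "moment [1 / (1 - x)] [] k e = x ^ nat (k + 1) * (1 - x) powi e"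
proof -
  let ?R = "moment [1 / (1 - x)] []"
  have nz: "nonzero [1 / (1 - x)]" using assms(1) by simp
  have rec: "?R k e = x * ?R (k - 1) e" if "k \<ge> 0" for k e
    using moment_alphabet_shift[of x "[]" k e] assms(1) that by (simp add: moment_Nil_eq_0)
  have step: "?R (- 1) (e + 1) = (1 - x) * ?R (- 1) e" for e
    using moment_step[OF nz, of "[]" "- 1" e] rec[of 0 e] by (simp add: algebra_simps)
  have base: "?R (- 1) e = (1 - x) powi e" for e
  proof (induction e rule: int_induct[of _ 0])
    case base
    then show ?case using moment_eq_1[OF nz, of "- 1" "[]"] by simp
  next
    case (step1 i)
    then show ?case using step[of i] assms(1) by (simp add: power_int_add)
  next
    case (step2 i)
    then have "(1 - x) * ?R (- 1) (i - 1) = (1 - x) powi i" using step[of "i - 1"] by simp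
    then show ?case using assms(1) by (simp add: power_int_diff field_simps)
  qed
  show ?thesis using assms(2)
  proof (induction k rule: int_ge_induct)
    case base
    then show ?case by (simp add: \<open>?R (- 1) e = (1 - x) powi e\<close>)
  next
    case (step k)
    then have "nat (k + 1 + 1) = Suc (nat (k + 1))" by simp
    then show ?case using step rec[of "k + 1" e] by simp
  qed
qed

abbreviation regular :: "complex list \<Rightarrow> bool" where
  "regular X \<equiv> distinct X \<and> 0 \<notin> set X \<and> 1 \<notin> set X"

text \<open>
  Partial fractions: the moments are the residues at the simple poles \<open>y = x\<close>, there being no
  pole at \<open>y = 0\<close> as long as \<open>k \<ge> - N\<close>.
\<close>

lemma moment_partial_fractions:
  assumes "regular X"
  shows "\<exists>\<rho>. \<forall>k\<ge>- int (length X). \<forall>e.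
    moment (alphabet X) [] k e = (\<Sum>u\<in>set X. \<rho> u * u powi k * (1 - u) powi e)"
  using assms
proof (induction "length X" arbitrary: X rule: less_induct)
  case less
  consider "X = []" | x where "X = [x]" | x y Z where "X = x # y # Z"
    by (metis list.exhaust)
  then show ?case
  proof cases
    case 1
    then show ?thesis by (simp add: moment_Nil_eq_0)
  next
    case 2
    have "moment (alphabet X) [] k e = x * x powi k * (1 - x) powi e" if "k \<ge> - 1" for k e
    proof -
      have "x ^ nat (k + 1) = x powi (k + 1)" using that by (simp add: power_int_def)
      then show ?thesis using 2 less.prems that by (simp add: moment_single power_int_add)
    qed
    then show ?thesis using 2 by (intro exI[of _ "\<lambda>_. x"]) simp
  next
    case 3
    obtain \<rho>1 \<rho>2 where
      r1: "\<And>k e. k \<ge> - int (length (x # Z)) \<Longrightarrow>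
        moment (alphabet (x # Z)) [] k e = (\<Sum>u\<in>set (x # Z). \<rho>1 u * u powi k * (1 - u) powi e)"
      and r2: "\<And>k e. k \<ge> - int (length (y # Z)) \<Longrightarrow>
        moment (alphabet (y # Z)) [] k e = (\<Sum>u\<in>set (y # Z). \<rho>2 u * u powi k * (1 - u) powi e)"
      using less.hyps[of "x # Z"] less.hyps[of "y # Z"] less.prems 3 by fastforce
    have ne: "y - x \<noteq> 0" "x \<noteq> 1" "y \<noteq> 1" "1 \<notin> set Z" using less.prems 3 by auto
    let ?R = "moment (alphabet (x # y # Z)) []"
    have swap: "?R = moment (alphabet (y # x # Z)) []"
      by (rule moment_mset) simp
    \<comment> \<open>Removing \<open>x\<close> and removing \<open>y\<close> both express the
      moment at \<open>k + 1\<close>; the difference of the two formulas is a divided difference.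
      The shorter alphabets appear with \<open>k + 1\<close>, so the bound \<open>k >= - N\<close>
      turns into the bound for \<open>N - 1\<close> letters.\<close>
    have key: "(y - x) * ?R k e = (1 - x) * moment (alphabet (y # Z)) [] (k + 1) e
        - (1 - y) * moment (alphabet (x # Z)) [] (k + 1) e" for k e
    proof -
      have nz: "nonzero (alphabet (y # Z))" "nonzero (alphabet (x # Z))"
        by (rule nonzero_alphabet, use ne in simp)+
      have "?R (k + 1) e = x * ?R k e + (1 - x) * moment (alphabet (y # Z)) [] (k + 1) e"
        using moment_alphabet_shift[OF ne(2) nz(1), of "k + 1" e] by simp
      moreover have "?R (k + 1) e = y * ?R k e + (1 - y) * moment (alphabet (x # Z)) [] (k + 1) e"
        using moment_alphabet_shift[OF ne(3) nz(2), of "k + 1" e] unfolding swap by simp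
      moreover have "(y - x) * r = a - b" if "r' = x * r + a" "r' = y * r + b" for r r' a b :: complex
        using that by (simp add: algebra_simps)
      ultimately show ?thesis by blast
    qed
    define \<rho> where "\<rho> u = ((1 - x) * (if u \<in> set (y # Z) then \<rho>2 u else 0)
      - (1 - y) * (if u \<in> set (x # Z) then \<rho>1 u else 0)) * u / (y - x)" for u
    have combine: "a * (f * U * t) - b * (g * U * t) = d * (r * v * t)"
      if "U = u * v" "d * r = (a * f - b * g) * u" for a b f g t d r u v U :: complex
    proof -
      have "d * (r * v * t) = (d * r) * (v * t)" by simp
      also have "\<dots> = a * (f * U * t) - b * (g * U * t)"
        unfolding that by (simp add: algebra_simps)
      finally show ?thesis ..
    qed
    have "moment (alphabet X) [] k e = (\<Sum>u\<in>set X. \<rho> u * u powi k * (1 - u) powi e)"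
      if "k \<ge> - int (length X)" for k e
    proof -
      have k: "k + 1 \<ge> - int (length (x # Z))" "k + 1 \<ge> - int (length (y # Z))" using that 3 by auto
      have s2: "moment (alphabet (y # Z)) [] (k + 1) e
          = (\<Sum>u\<in>set X. (if u \<in> set (y # Z) then \<rho>2 u else 0) * u powi (k + 1) * (1 - u) powi e)"
        unfolding r2[OF k(2)] by (rule sum.mono_neutral_cong_left) (use 3 in auto)
      have s1: "moment (alphabet (x # Z)) [] (k + 1) e
          = (\<Sum>u\<in>set X. (if u \<in> set (x # Z) then \<rho>1 u else 0) * u powi (k + 1) * (1 - u) powi e)"
        unfolding r1[OF k(1)] by (rule sum.mono_neutral_cong_left) (use 3 in auto)
      have "(y - x) * ?R k e = (\<Sum>u\<in>set X. (y - x) * (\<rho> u * u powi k * (1 - u) powi e))"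
        unfolding key s1 s2 sum_distrib_left sum_subtractf[symmetric]
      proof (rule sum.cong[OF refl])
        fix u assume "u \<in> set X"
        then have "u \<noteq> 0" using less.prems by auto
        then have "u powi (k + 1) = u * u powi k" by (simp add: power_int_add)
        moreover have "(y - x) * \<rho> u = ((1 - x) * (if u \<in> set (y # Z) then \<rho>2 u else 0)
            - (1 - y) * (if u \<in> set (x # Z) then \<rho>1 u else 0)) * u"
          by (simp only: \<rho>_def times_divide_eq_right nonzero_mult_div_cancel_left[OF ne(1)])
        ultimately show "(1 - x) * ((if u \<in> set (y # Z) then \<rho>2 u else 0) * u powi (k + 1) * (1 - u) powi e) -
            (1 - y) * ((if u \<in> set (x # Z) then \<rho>1 u else 0) * u powi (k + 1) * (1 - u) powi e) =
            (y - x) * (\<rho> u * u powi k * (1 - u) powi e)"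
          by (rule combine)
      qed
      then have "(y - x) * ?R k e = (y - x) * (\<Sum>u\<in>set X. \<rho> u * u powi k * (1 - u) powi e)"
        by (simp only: sum_distrib_left)
      then show ?thesis using ne(1) 3 by simp
    qed
    then show ?thesis by blast
  qed
qed

text \<open>Leibniz expansion of \<open>det (x_k^(B_i + n - i) (1 - x_k)^(i - 1))\<close>, with
  indices from 1: the numerator in the bialternant formula for Grothendieck polynomials. Because of
  \<open>nat\<close> it has this meaning for nonnegative entries.\<close>

definition bialternant :: "complex list \<Rightarrow> int list \<Rightarrow> complex" where
  "bialternant X B = (\<Sum>p | p permutes {0..<length X}. signof p
    * (\<Prod>i<length X. (X ! p i) ^ (nat (B ! i) + (length X - Suc i)) * (1 - X ! p i) ^ i))"

text \<open>The moment matrix factors as \<open>U * V\<close> with \<open>V\<close> independent of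
  \<open>B\<close>, and \<open>v\<close> is the determinant of \<open>V\<close>. It is pinned down
  later by the zero sequence, for which \<open>G\<close> equals 1.\<close>

lemma grothendieck_bialternant:
  assumes "regular X"
  shows "\<exists>v. \<forall>B. length B = length X \<longrightarrow> (\<forall>b\<in>set B. 0 \<le> b) \<longrightarrow>
    grothendieck B (alphabet X) [] = bialternant X B * v"
proof -
  define n where "n = length X"
  obtain \<rho> where \<rho>: "\<And>k e. k \<ge> - int n \<Longrightarrow>
    moment (alphabet X) [] k e = (\<Sum>u\<in>set X. \<rho> u * u powi k * (1 - u) powi e)"
    using moment_partial_fractions[OF assms] n_def by blast
  have X: "X ! k \<noteq> 0" "1 - X ! k \<noteq> 0" if "k < n" for k
    using assms nth_mem[of k X] that by (metis n_def, metis eq_iff_diff_eq_0 n_def)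
  define V where "V = Matrix.mat n n (\<lambda>(k, j). \<rho> (X ! k) * (X ! k) powi (- int n) * (1 - X ! k) powi (- int j))"
  have "grothendieck B (alphabet X) [] = bialternant X B * Determinant.det V"
    if B: "length B = n" "\<forall>b\<in>set B. 0 \<le> b" for B
  proof -
    \<comment> \<open>The power \<open>- n\<close> of each point is moved to \<open>V\<close>, so
      that the exponent \<open>B_i - (i + 1) + n\<close> left in \<open>U\<close> is a natural
      number.\<close>
    define U where "U = Matrix.mat n n
      (\<lambda>(i, k). (X ! k) ^ (nat (B ! i) + (n - Suc i)) * (1 - X ! k) ^ i)"
    have UV: "U \<in> carrier_mat n n" "V \<in> carrier_mat n n" by (simp_all add: U_def V_def)
    have "moment_matrix B (alphabet X) [] = U * V"
    proof (rule eq_matI)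
      fix i j assume "i < dim_row (U * V)" "j < dim_col (U * V)"
      then have ij: "i < n" "j < n" using UV by auto
      have Bi: "B ! i \<ge> 0" using B ij by simp
      have "moment (alphabet X) [] (B ! i - int (Suc i)) (int i - int j)
        = (\<Sum>u\<in>set X. \<rho> u * u powi (B ! i - int (Suc i)) * (1 - u) powi (int i - int j))"
        by (rule \<rho>) (use Bi ij in linarith)
      also have "\<dots> = (\<Sum>k<n. \<rho> (X ! k) * (X ! k) powi (B ! i - int (Suc i)) * (1 - X ! k) powi (int i - int j))"
        using assms by (simp add: n_def sum.distinct_set_conv_list sum_list_sum_nth atLeast0LessThan)
      also have "\<dots> = (\<Sum>k<n. U $$ (i, k) * V $$ (k, j))"
      proof (rule sum.cong[OF refl])
        fix k assume "k \<in> {..<n}"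
        then have k: "k < n" by simp
        have "B ! i - int (Suc i) = int (nat (B ! i) + (n - Suc i)) + - int n"
          using Bi ij by simp
        then have "(X ! k) powi (B ! i - int (Suc i))
            = (X ! k) ^ (nat (B ! i) + (n - Suc i)) * (X ! k) powi (- int n)"
          by (simp only: powi_add'[OF X(1)[OF k]] power_int_of_nat)
        moreover have "(1 - X ! k) powi (int i - int j) = (1 - X ! k) ^ i * (1 - X ! k) powi (- int j)"
          using powi_add'[OF X(2)[OF k], of "int i" "- int j"] by simp
        ultimately show "\<rho> (X ! k) * (X ! k) powi (B ! i - int (Suc i)) * (1 - X ! k) powi (int i - int j)
            = U $$ (i, k) * V $$ (k, j)"
          using k ij by (simp add: U_def V_def mult_ac)
      qed
      also have "\<dots> = (U * V) $$ (i, j)"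
        using ij by (simp add: U_def V_def scalar_prod_def atLeast0LessThan)
      finally show "moment_matrix B (alphabet X) [] $$ (i, j) = (U * V) $$ (i, j)"
        using ij B by (simp add: moment_matrix_def)
    qed (use UV B in \<open>auto simp: moment_matrix_def\<close>)
    moreover have "Determinant.det U = bialternant X B"
      unfolding U_def det_leibniz bialternant_def n_def by simp
    ultimately show ?thesis
      using det_mult[OF UV] assms nonzero_alphabet by (simp add: grothendieck_det)
  qed
  then show ?thesis by (auto simp: n_def)
qed

lemma grothendieck_replicate_0: "nonzero as \<Longrightarrow> grothendieck (replicate n 0) as bs = 1"
proof (induction n)
  case 0
  then show ?case by (simp add: grothendieck_leibniz)
next
  case (Suc n)
  then show ?case
    unfolding replicate_Suc replicate_append_same[symmetric] by (simp add: grothendieck_snoc)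
qed

definition padded :: "integer_partition \<Rightarrow> nat \<Rightarrow> nat" where
  "padded l i = (if i < length (parts l) then parts l ! i else 0)"

abbreviation padded_list :: "nat \<Rightarrow> integer_partition \<Rightarrow> int list" where
  "padded_list n l \<equiv> map (\<lambda>i. int (padded l i)) [0..<n]"

lemma grothendieck_part_padded:
  assumes "length (parts l) \<le> n" "nonzero as"
  shows "grothendieck_part l as bs = grothendieck (padded_list n l) as bs"
  using assms(1)
proof (induction n rule: dec_induct)
  case base
  have "padded_list (length (parts l)) l = map int (parts l)"
    by (rule nth_equalityI) (auto simp: padded_def)
  then show ?case by (simp add: grothendieck_part_def)
next
  case (step n)
  then have "padded_list (Suc n) l = padded_list n l @ [0]" by (simp add: padded_def)
  then show ?case using step assms(2) by (simp add: grothendieck_snoc del: upt_Suc)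
qed

lemma padded_inj:
  assumes "length (parts l) \<le> n" "length (parts m) \<le> n" "\<And>i. i < n \<Longrightarrow> padded l i = padded m i"
  shows "l = m"
proof -
  have pos: "parts l ! i > 0" if "i < length (parts l)" for l i
    using parts[of l] nth_mem[OF that] by (metis (no_types, lifting) mem_Collect_eq neq0_conv)
  have "length (parts l) \<le> length (parts m)"
    if "length (parts l) \<le> n" "\<And>i. i < n \<Longrightarrow> padded l i = padded m i" for l m
  proof (rule ccontr)
    assume "\<not> length (parts l) \<le> length (parts m)"
    then show False using pos[of "length (parts m)" l] that(1) that(2)[of "length (parts m)"]
      by (simp add: padded_def)
  qed
  then have "length (parts l) = length (parts m)" using assms by (simp add: le_antisym)
  then have "parts l = parts m"
  proof (rule nth_equalityI)
    fix i assume "i < length (parts l)"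
    then show "parts l ! i = parts m ! i"
      using assms(1) assms(3)[of i] \<open>length (parts l) = length (parts m)\<close> by (simp add: padded_def)
  qed
  then show ?thesis by (simp add: parts_inject)
qed

lemma padded_antimono: "i \<le> j \<Longrightarrow> padded l j \<le> padded l i"
  using parts[of l] by (cases "i = j") (auto simp: padded_def sorted_wrt_iff_nth_less)

lemma padded_sum: "length (parts l) \<le> n \<Longrightarrow> (\<Sum>i<n. padded l i) = sum_list (parts l)"
  unfolding sum_list_sum_nth atLeast0LessThan
  by (rule sum.mono_neutral_cong_right) (auto simp: padded_def)

section \<open>Leading terms and linear independence\<close>

lemma digits_bound:
  fixes f :: "nat \<Rightarrow> nat"
  assumes "\<And>i. i < k \<Longrightarrow> f i < b"
  shows "(\<Sum>i<k. f i * b ^ i) < b ^ k"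
  using assms
proof (induction k)
  case (Suc k)
  then have "(\<Sum>i<k. f i * b ^ i) + f k * b ^ k < b ^ k + f k * b ^ k" by simp
  also have "\<dots> = Suc (f k) * b ^ k" by simp
  also have "\<dots> \<le> b * b ^ k" using Suc.prems[of k] by (intro mult_right_mono) auto
  finally show ?case by simp
qed simp

text \<open>The places below \<open>k\<close> add less than \<open>b ^ k\<close> to the sum of
  \<open>f\<close>, hence less than one unit at place \<open>k\<close>.\<close>

lemma digits_less:
  fixes f g :: "nat \<Rightarrow> nat"
  assumes "k < n" "f k < g k" "\<And>j. k < j \<Longrightarrow> j < n \<Longrightarrow> f j = g j" "\<And>j. j < n \<Longrightarrow> f j < b"
  shows "(\<Sum>i<n. f i * b ^ i) < (\<Sum>i<n. g i * b ^ i)"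
  using assms
proof (induction n)
  case (Suc n)
  show ?case
  proof (cases "k = n")
    case True
    have "(\<Sum>i<n. f i * b ^ i) < b ^ n" using Suc.prems by (intro digits_bound) auto
    then have "(\<Sum>i<Suc n. f i * b ^ i) < Suc (f n) * b ^ n" by simp
    also have "\<dots> \<le> g n * b ^ n" using Suc.prems True by (intro mult_right_mono) auto
    finally show ?thesis by simp
  next
    case False
    then show ?thesis using Suc by auto
  qed
qed simp

lemma digits_inj:
  fixes f g :: "nat \<Rightarrow> nat"
  assumes "(\<Sum>i<n. f i * b ^ i) = (\<Sum>i<n. g i * b ^ i)"
    "\<And>j. j < n \<Longrightarrow> f j < b" "\<And>j. j < n \<Longrightarrow> g j < b" "i < n"
  shows "f i = g i"
proof (rule ccontr)
  assume ne: "f i \<noteq> g i"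
  define k where "k = Max {j. j < n \<and> f j \<noteq> g j}"
  have fin: "finite {j. j < n \<and> f j \<noteq> g j}" by simp
  have k: "k < n" "f k \<noteq> g k"
    using Max_in[OF fin] ne assms(4) unfolding k_def by blast+
  have top: "f j = g j" if "k < j" "j < n" for j
    using Max_ge[OF fin, of j] that unfolding k_def by fastforce
  show False
  proof (cases "f k < g k")
    case True
    then show False using digits_less[of k n f g b] k top assms by auto
  next
    case False
    then show False using digits_less[of k n g f b] k top assms by auto
  qed
qed

text \<open>A rearrangement inequality: pairing decreasing exponents with increasing weights gives
  the least sum. At the largest place \<open>k\<close> moved by the inverse permutation
  \<open>q\<close> all higher places are fixed, so \<open>q k < k\<close> and the digit at
  \<open>k\<close> grows.\<close>

lemma permuted_digits_less:
  fixes E :: "nat \<Rightarrow> nat"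
  assumes "p permutes {0..<n}" "p \<noteq> id" "\<And>i j. i < j \<Longrightarrow> j < n \<Longrightarrow> E j < E i" "\<And>i. i < n \<Longrightarrow> E i < b"
  shows "(\<Sum>i<n. E i * b ^ i) < (\<Sum>i<n. E i * b ^ p i)"
proof -
  define q where "q = Hilbert_Choice.inv p"
  have q: "q permutes {0..<n}" using permutes_inv[OF assms(1)] by (simp add: q_def)
  have pq: "p (q i) = i" for i using permutes_inverses[OF assms(1)] by (simp add: q_def)
  have "(\<Sum>i<n. E i * b ^ p i) = (\<Sum>i<n. E (q i) * b ^ p (q i))"
    using sum.permute[OF q, of "\<lambda>i. E i * b ^ p i"] by (simp add: atLeast0LessThan o_def)
  then have eq: "(\<Sum>i<n. E i * b ^ p i) = (\<Sum>i<n. E (q i) * b ^ i)" by (simp add: pq)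
  have "\<exists>j. q j \<noteq> j"
  proof (rule ccontr)
    assume "\<not> (\<exists>j. q j \<noteq> j)"
    then have "p i = i" for i using pq[of i] by simp
    then show False using assms(2) by auto
  qed
  then obtain j0 where j0: "q j0 \<noteq> j0" by blast
  then have j0n: "j0 < n" using permutes_not_in[OF q, of j0] by fastforce
  define k where "k = Max {j. j < n \<and> q j \<noteq> j}"
  have fin: "finite {j. j < n \<and> q j \<noteq> j}" by simp
  have k: "k < n" "q k \<noteq> k"
    using Max_in[OF fin] j0 j0n unfolding k_def by blast+
  have top: "q j = j" if "k < j" "j < n" for j
    using Max_ge[OF fin, of j] that unfolding k_def by fastforce
  have "q k < n" using permutes_atLeast0[OF q k(1)] .
  moreover have "\<not> k < q k"
  proof
    assume "k < q k"
    then have "q (q k) = q k" using top \<open>q k < n\<close> by simp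
    then have "q k = k" using permutes_inj[OF q] by (simp add: inj_eq)
    then show False using k by simp
  qed
  ultimately have "E k < E (q k)" using k assms(3) by (metis nat_neq_iff)
  then show ?thesis unfolding eq
    by (intro digits_less[of k]) (use k top assms(4) in auto)
qed

definition power_points :: "(nat \<Rightarrow> nat) \<Rightarrow> nat \<Rightarrow> complex \<Rightarrow> complex list" where
  "power_points w n \<epsilon> = map (\<lambda>k. \<epsilon> ^ w k) [0..<n]"

lemma power_points_simps [simp]:
  "length (power_points w n \<epsilon>) = n" "k < n \<Longrightarrow> power_points w n \<epsilon> ! k = \<epsilon> ^ w k"
  by (simp_all add: power_points_def)

lemma eventually_regular_power_points:
  assumes "\<And>k. w k > 0" "strict_mono w"
  shows "eventually (\<lambda>\<epsilon>. regular (power_points w n \<epsilon>)) (at 0)"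
proof -
  have "eventually (\<lambda>\<epsilon>::complex. \<epsilon> \<in> ball 0 1 - {0}) (at 0)"
    by (rule eventually_at_in_open) auto
  then show ?thesis
  proof eventually_elim
    case (elim \<epsilon>)
    then have e: "\<epsilon> \<noteq> 0" "norm \<epsilon> < 1" by auto
    have "norm \<epsilon> ^ w k < 1" for k using e assms(1)[of k] by (simp add: power_less_one_iff)
    then have "norm (\<epsilon> ^ w k) < norm (1::complex)" for k by (simp add: norm_power)
    then have "\<epsilon> ^ w k \<noteq> 1" for k by (metis less_irrefl)
    moreover have "\<epsilon> ^ w k \<noteq> \<epsilon> ^ w j" if "k < j" for k j
    proof -
      have "norm \<epsilon> ^ w j < norm \<epsilon> ^ w k"
        using e strict_monoD[OF assms(2) that] by (intro power_strict_decreasing) auto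
      then show ?thesis by (metis less_irrefl norm_power)
    qed
    then have "inj (\<lambda>k. \<epsilon> ^ w k)" by (metis injI linorder_neqE_nat)
    then have "distinct (power_points w n \<epsilon>)"
      by (auto simp: power_points_def distinct_map inj_on_def)
    ultimately show ?case using e by (auto simp: power_points_def)
  qed
qed

text \<open>Every permutation other than \<open>id\<close> carries a strictly higher power of
  \<open>\<epsilon>\<close>, so the diagonal term dominates, and its factors \<open>1 - x\<close>
  tend to 1.\<close>

lemma bialternant_limit:
  assumes w: "\<And>k. w k > 0"
    and strict: "\<And>p. p permutes {0..<n} \<Longrightarrow> p \<noteq> id \<Longrightarrow>
      (\<Sum>i<n. (nat (B ! i) + (n - Suc i)) * w i) < (\<Sum>i<n. (nat (B ! i) + (n - Suc i)) * w (p i))"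
  shows "((\<lambda>\<epsilon>. bialternant (power_points w n \<epsilon>) B / \<epsilon> ^ (\<Sum>i<n. (nat (B ! i) + (n - Suc i)) * w i))
    \<longlongrightarrow> 1) (at 0)"
proof -
  define S where "S p = (\<Sum>i<n. (nat (B ! i) + (n - Suc i)) * w (p i))" for p :: "nat \<Rightarrow> nat"
  define q where "q p \<epsilon> = (\<Prod>i<n. (1 - \<epsilon> ^ w (p i)) ^ i)" for p :: "nat \<Rightarrow> nat" and \<epsilon> :: complex
  define g where "g \<epsilon> = (\<Sum>p | p permutes {0..<n}. signof p * (\<epsilon> ^ (S p - S id) * q p \<epsilon>))" for \<epsilon> :: complex
  have fin: "finite {p. p permutes {0..<n}}" by (simp add: finite_permutations)
  have "(g \<longlongrightarrow> g 0) (at 0)"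
    unfolding g_def q_def by (intro tendsto_intros)
  also have "g 0 = (\<Sum>p | p permutes {0..<n}. if p = id then 1 else 0)"
    unfolding g_def
  proof (rule sum.cong[OF refl])
    fix p assume p: "p \<in> {p. p permutes {0..<n}}"
    show "signof p * (0 ^ (S p - S id) * q p 0) = (if p = id then 1 else (0::complex))"
    proof (cases "p = id")
      case True
      have z: "(0::complex) ^ w k = 0" for k using w[of k] by (rule zero_power)
      have "q id 0 = 1" by (simp only: q_def id_apply z) simp
      then show ?thesis using True by (simp add: sign_id)
    next
      case False
      then have "S id < S p" using strict[of p] p by (simp add: S_def)
      then show ?thesis using False by simp
    qed
  qed
  also have "\<dots> = 1" using fin by (simp add: permutes_id)
  finally have lim: "(g \<longlongrightarrow> 1) (at 0)" .
  have "bialternant (power_points w n \<epsilon>) B / \<epsilon> ^ S id = g \<epsilon>" if "\<epsilon> \<noteq> 0" for \<epsilon>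
  proof -
    have "bialternant (power_points w n \<epsilon>) B = (\<Sum>p | p permutes {0..<n}. signof p * (\<epsilon> ^ S p * q p \<epsilon>))"
      unfolding bialternant_def power_points_simps
    proof (intro sum.cong refl arg_cong2[of _ _ _ _ "(*)"])
      fix p assume "p \<in> {p. p permutes {0..<n}}"
      then have pn: "p i < n" if "i < n" for i using permutes_atLeast0 that by auto
      have "(\<Prod>i<n. power_points w n \<epsilon> ! p i ^ (nat (B ! i) + (n - Suc i)) * (1 - power_points w n \<epsilon> ! p i) ^ i)
        = (\<Prod>i<n. \<epsilon> ^ ((nat (B ! i) + (n - Suc i)) * w (p i)) * (1 - \<epsilon> ^ w (p i)) ^ i)"
        by (rule prod.cong) (use pn in \<open>simp_all add: power_mult[symmetric] mult.commute\<close>)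
      then show "(\<Prod>i<n. power_points w n \<epsilon> ! p i ^ (nat (B ! i) + (n - Suc i)) * (1 - power_points w n \<epsilon> ! p i) ^ i)
        = \<epsilon> ^ S p * q p \<epsilon>"
        by (simp add: prod.distrib S_def q_def power_sum)
    qed
    also have "\<dots> / \<epsilon> ^ S id = g \<epsilon>"
      unfolding g_def sum_divide_distrib
    proof (intro sum.cong refl)
      fix p assume "p \<in> {p. p permutes {0..<n}}"
      then have "S id \<le> S p" using strict[of p] by (cases "p = id") (auto simp: S_def)
      then have "\<epsilon> ^ S p = \<epsilon> ^ (S p - S id) * \<epsilon> ^ S id" by (simp flip: power_add)
      then show "signof p * (\<epsilon> ^ S p * q p \<epsilon>) / \<epsilon> ^ S id = signof p * (\<epsilon> ^ (S p - S id) * q p \<epsilon>)"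
        using that by simp
    qed
    finally show ?thesis .
  qed
  then have ev: "eventually (\<lambda>\<epsilon>. bialternant (power_points w n \<epsilon>) B / \<epsilon> ^ S id = g \<epsilon>) (at 0)"
    by (simp add: eventually_at_filter)
  show ?thesis using iffD2[OF tendsto_cong[OF ev] lim] by (simp only: S_def id_apply)
qed

definition weight :: "(nat \<Rightarrow> nat) \<Rightarrow> nat \<Rightarrow> integer_partition \<Rightarrow> nat" where
  "weight w n l = (\<Sum>i<n. padded l i * w i)"

text \<open>\<open>G_l\<close> is the quotient of the bialternants of \<open>l\<close> and of the
  zero sequence, since \<open>v\<close> cancels. The exponents \<open>n - Suc i\<close> are common
  to both and drop out, which leaves \<open>weight\<close>.\<close>

lemma grothendieck_limit:
  assumes len: "length (parts l) \<le> n" and b: "\<And>i. i < n \<Longrightarrow> padded l i + n < b" and W: "W > 0"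
    and w: "w = (\<lambda>k. W + b ^ k)"
  shows "((\<lambda>\<epsilon>. grothendieck_part l (alphabet (power_points w n \<epsilon>)) [] / \<epsilon> ^ weight w n l) \<longlongrightarrow> 1) (at 0)"
proof (cases "n = 0")
  case True
  then show ?thesis using len by (simp add: power_points_def weight_def grothendieck_part_def grothendieck_leibniz sign_id)
next
  case False
  then have b1: "b > 1" using b[of 0] by simp
  have w0: "w k > 0" for k using W by (simp add: w)
  have mono: "strict_mono w" using b1 by (auto simp: w strict_mono_def intro: power_strict_increasing)
  define E where "E B i = nat (B ! i) + (n - Suc i)" for B :: "int list" and i
  \<comment> \<open>The common part \<open>W\<close> of the weights adds the same amount for every
    permutation, so only the powers of \<open>b\<close> are compared.\<close>
  have less: "(\<Sum>i<n. E B i * w i) < (\<Sum>i<n. E B i * w (p i))"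
    if "p permutes {0..<n}" "p \<noteq> id" "B = padded_list n l \<or> B = replicate n 0" for p B
  proof -
    have E: "E (padded_list n l) i = padded l i + (n - Suc i)" "E (replicate n 0) i = n - Suc i"
      if "i < n" for i using that by (simp_all add: E_def)
    have anti: "E B j < E B i" if "i < j" "j < n" for i j
    proof -
      have "n - Suc j < n - Suc i" using that by simp
      then show ?thesis
        using padded_antimono[of i j l] that \<open>B = padded_list n l \<or> B = replicate n 0\<close> E[of i] E[of j] by auto
    qed
    have "E B i < b" if "i < n" for i
      using b[OF that] E[OF that] \<open>B = padded_list n l \<or> B = replicate n 0\<close> that by auto
    then have "(\<Sum>i<n. E B i * b ^ i) < (\<Sum>i<n. E B i * b ^ p i)"
      using permuted_digits_less[OF that(1,2), of "E B" b] anti by blast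
    then show ?thesis by (simp add: w distrib_left sum.distrib)
  qed
  define D where "D B \<epsilon> = bialternant (power_points w n \<epsilon>) B" for B \<epsilon>
  have lim: "((\<lambda>\<epsilon>. D B \<epsilon> / \<epsilon> ^ (\<Sum>i<n. E B i * w i)) \<longlongrightarrow> 1) (at 0)"
    if "B = padded_list n l \<or> B = replicate n 0" for B
    unfolding D_def E_def
    by (rule bialternant_limit[OF w0]) (use less[OF _ _ that] in \<open>simp add: E_def\<close>)
  have lim': "((\<lambda>\<epsilon>. (D (padded_list n l) \<epsilon> / \<epsilon> ^ (\<Sum>i<n. E (padded_list n l) i * w i))
      / (D (replicate n 0) \<epsilon> / \<epsilon> ^ (\<Sum>i<n. E (replicate n 0) i * w i))) \<longlongrightarrow> 1 / 1) (at 0)"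
    by (intro tendsto_divide lim) auto
  have ev: "eventually (\<lambda>\<epsilon>. grothendieck_part l (alphabet (power_points w n \<epsilon>)) [] / \<epsilon> ^ weight w n l
      = (D (padded_list n l) \<epsilon> / \<epsilon> ^ (\<Sum>i<n. E (padded_list n l) i * w i))
      / (D (replicate n 0) \<epsilon> / \<epsilon> ^ (\<Sum>i<n. E (replicate n 0) i * w i))) (at 0)"
  proof -
    have "eventually (\<lambda>\<epsilon>::complex. \<epsilon> \<noteq> 0) (at 0)" by (simp add: eventually_at_filter)
    with eventually_regular_power_points[OF w0 mono, of n] show ?thesis
    proof eventually_elim
      case (elim \<epsilon>)
      let ?X = "power_points w n \<epsilon>"
      obtain v where v: "\<And>B. length B = n \<Longrightarrow> \<forall>b\<in>set B. 0 \<le> b \<Longrightarrow> grothendieck B (alphabet ?X) [] = D B \<epsilon> * v"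
        using grothendieck_bialternant[OF elim(1)] by (auto simp: D_def)
      have nz: "nonzero (alphabet ?X)" using elim(1) by (intro nonzero_alphabet) simp
      have 1: "D (replicate n 0) \<epsilon> * v = 1"
        using v[of "replicate n 0"] grothendieck_replicate_0[OF nz] by simp
      have G: "grothendieck_part l (alphabet ?X) [] = D (padded_list n l) \<epsilon> * v"
        using v[of "padded_list n l"] grothendieck_part_padded[OF len nz] by simp
      have wt: "(\<Sum>i<n. E (padded_list n l) i * w i) = weight w n l + (\<Sum>i<n. E (replicate n 0) i * w i)"
        unfolding weight_def sum.distrib[symmetric]
      proof (rule sum.cong[OF refl])
        fix i assume "i \<in> {..<n}"
        then have "E (padded_list n l) i = padded l i + E (replicate n 0) i" by (simp add: E_def)
        then show "E (padded_list n l) i * w i = padded l i * w i + E (replicate n 0) i * w i"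
          by (simp only: distrib_right)
      qed
      have D0: "D (replicate n 0) \<epsilon> \<noteq> 0" using 1 by auto
      moreover have "v = 1 / D (replicate n 0) \<epsilon>"
        using 1 D0 by (simp add: eq_divide_eq mult.commute)
      ultimately show ?case unfolding G wt using elim(2) by (simp add: power_add field_simps)
    qed
  qed
  show ?thesis using iffD2[OF tendsto_cong[OF ev] lim'] by (simp only: div_by_1)
qed

text \<open>Independence in a form that tolerates truncation: an error of order \<open>W * M\<close>
  cannot hide a partition of size less than \<open>M\<close>.\<close>

definition separates :: "(nat \<Rightarrow> nat) \<Rightarrow> nat \<Rightarrow> nat \<Rightarrow> integer_partition set \<Rightarrow> bool" where
  "separates w W n S \<longleftrightarrow> (\<forall>c M l.
     (\<lambda>\<epsilon>. \<Sum>l\<in>S. c l * grothendieck_part l (alphabet (power_points w n \<epsilon>)) [])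
        \<in> O[at 0](\<lambda>\<epsilon>. \<epsilon> ^ (W * M)) \<longrightarrow> l \<in> S \<longrightarrow> sum_list (parts l) < M \<longrightarrow> c l = 0)"

lemma separatesD:
  assumes "separates w W n S" "l \<in> S" "sum_list (parts l) < M"
    "(\<lambda>\<epsilon>. \<Sum>l\<in>S. c l * grothendieck_part l (alphabet (power_points w n \<epsilon>)) [])
        \<in> O[at 0](\<lambda>\<epsilon>. \<epsilon> ^ (W * M))"
  shows "c l = 0"
  using assms unfolding separates_def by blast

text \<open>
  Along \<open>x\<^sub>k = \<epsilon>\<^bsup>w k\<^esup>\<close> with rapidly increasing perturbations \<open>b\<^sup>k\<close> of a large common weight \<open>W\<close>,
  the \<open>G\<^sub>\<lambda>\<close> have distinct orders of vanishing, and these are graded by \<open>|\<lambda>|\<close> up to a multiple of \<open>W\<close>.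
\<close>

lemma graded_independence:
  assumes fin: "finite S" and len: "\<And>l. l \<in> S \<Longrightarrow> length (parts l) \<le> n"
  shows "\<exists>w W. W > 0 \<and> (\<forall>k. W \<le> w k) \<and> strict_mono w \<and> separates w W n S"
proof -
  \<comment> \<open>\<open>b\<close> exceeds all exponents of the bialternants involved, and
    \<open>W = b ^ n\<close> exceeds every sum of perturbations. Thus the quotient of a weight by
    \<open>W\<close> is the size of the partition and the remainder encodes its parts.\<close>
  define b where "b = (\<Sum>l\<in>S. sum_list (parts l)) + n + 2"
  define W where "W = b ^ n"
  define w where "w = (\<lambda>k. W + b ^ k)"
  have W: "W > 0" by (simp add: W_def b_def)
  have b: "padded l i + n < b" if "l \<in> S" "i < n" for l i
  proof -
    have "padded l i \<le> (\<Sum>i<n. padded l i)" by (rule member_le_sum) (use that in auto)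
    also have "\<dots> = sum_list (parts l)" by (rule padded_sum[OF len[OF that(1)]])
    also have "\<dots> \<le> (\<Sum>l\<in>S. sum_list (parts l))" by (rule member_le_sum) (use that fin in auto)
    finally show ?thesis by (simp add: b_def)
  qed
  have mono: "strict_mono w"
    by (auto simp: w_def strict_mono_def b_def intro!: power_strict_increasing)
  have wt: "weight w n l = W * sum_list (parts l) + (\<Sum>i<n. padded l i * b ^ i)" if "l \<in> S" for l
    by (simp add: weight_def w_def distrib_left sum.distrib padded_sum[OF len[OF that], symmetric]
        sum_distrib_right mult.commute[of W])
  have small: "(\<Sum>i<n. padded l i * b ^ i) < W" if "l \<in> S" for l
    unfolding W_def by (rule digits_bound) (use b[OF that] in fastforce)
  have inj: "l = m" if "l \<in> S" "m \<in> S" "weight w n l = weight w n m" for l m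
  proof -
    have "weight w n l mod W = (\<Sum>i<n. padded l i * b ^ i)" if "l \<in> S" for l
      using wt[OF that] small[OF that] by simp
    then have eq: "(\<Sum>i<n. padded l i * b ^ i) = (\<Sum>i<n. padded m i * b ^ i)"
      using that by metis
    show ?thesis
      by (rule padded_inj[OF len[OF that(1)] len[OF that(2)]], rule digits_inj[OF eq])
         (use b that in fastforce)+
  qed
  have main: "c l = 0"
    if O: "(\<lambda>\<epsilon>. \<Sum>l\<in>S. c l * grothendieck_part l (alphabet (power_points w n \<epsilon>)) [])
        \<in> O[at 0](\<lambda>\<epsilon>. \<epsilon> ^ (W * M))" and l: "l \<in> S" "sum_list (parts l) < M" for c M l
  proof (rule ccontr)
    assume cl: "c l \<noteq> 0"
    let ?G = "\<lambda>l \<epsilon>. grothendieck_part l (alphabet (power_points w n \<epsilon>)) []"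
    define T where "T = {l \<in> S. c l \<noteq> 0}"
    have T: "finite T" "T \<noteq> {}" using fin l cl by (auto simp: T_def)
    \<comment> \<open>The weights on \<open>S\<close> are distinct, so division by the power
      belonging to \<open>l0\<close> leaves exactly the coefficient of \<open>l0\<close> in the
      limit.\<close>
    obtain l0 where l0: "l0 \<in> T" "\<And>m. m \<in> T \<Longrightarrow> weight w n l0 \<le> weight w n m"
      using T by (metis arg_min_if_finite(1) arg_min_least)
    let ?v = "weight w n l0"
    have "?v \<le> weight w n l" using l0(2) l cl by (simp add: T_def)
    also have "\<dots> < W * Suc (sum_list (parts l))" using wt[OF l(1)] small[OF l(1)] by simp
    also have "\<dots> \<le> W * M" using l(2) by (intro mult_left_mono) auto
    finally have v: "?v < W * M" .
    have e0: "eventually (\<lambda>\<epsilon>::complex. \<epsilon> \<noteq> 0) (at 0)" by (simp add: eventually_at_filter)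
    have "(\<lambda>\<epsilon>::complex. \<epsilon> ^ (W * M)) \<in> o[at 0](\<lambda>\<epsilon>. \<epsilon> ^ ?v)"
    proof (rule smalloI_tendsto)
      have "((\<lambda>\<epsilon>::complex. \<epsilon> ^ (W * M - ?v)) \<longlongrightarrow> 0 ^ (W * M - ?v)) (at 0)"
        by (intro tendsto_intros)
      moreover have "(0::complex) ^ (W * M - ?v) = 0" using v by (simp only: power_0_left) simp
      ultimately have "((\<lambda>\<epsilon>::complex. \<epsilon> ^ (W * M - ?v)) \<longlongrightarrow> 0) (at 0)" by (simp only:)
      moreover have ev: "eventually (\<lambda>\<epsilon>::complex. \<epsilon> ^ (W * M) / \<epsilon> ^ ?v = \<epsilon> ^ (W * M - ?v)) (at 0)"
        using e0 by eventually_elim (use v in \<open>simp add: power_diff\<close>)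
      ultimately show "((\<lambda>\<epsilon>::complex. \<epsilon> ^ (W * M) / \<epsilon> ^ ?v) \<longlongrightarrow> 0) (at 0)"
        unfolding tendsto_cong[OF ev] by blast
      show "eventually (\<lambda>\<epsilon>::complex. \<epsilon> ^ ?v \<noteq> 0) (at 0)" using e0 by eventually_elim simp
    qed
    then have "(\<lambda>\<epsilon>. \<Sum>l\<in>S. c l * ?G l \<epsilon>) \<in> o[at 0](\<lambda>\<epsilon>. \<epsilon> ^ ?v)"
      using O landau_o.big_small_trans by blast
    then have lim0: "((\<lambda>\<epsilon>. (\<Sum>l\<in>S. c l * ?G l \<epsilon>) / \<epsilon> ^ ?v) \<longlongrightarrow> 0) (at 0)"
      by (rule smalloD_tendsto)
    have "((\<lambda>\<epsilon>. \<Sum>l\<in>S. c l * (?G l \<epsilon> / \<epsilon> ^ ?v)) \<longlongrightarrow> (\<Sum>l\<in>S. if l = l0 then c l else 0)) (at 0)"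
    proof (rule tendsto_sum)
      fix m assume m: "m \<in> S"
      show "((\<lambda>\<epsilon>. c m * (?G m \<epsilon> / \<epsilon> ^ ?v)) \<longlongrightarrow> (if m = l0 then c m else 0)) (at 0)"
      proof (cases "c m = 0")
        case True
        then show ?thesis by (cases "m = l0") simp_all
      next
        case False
        with m have mT: "m \<in> T" by (simp add: T_def)
        have lim1: "((\<lambda>\<epsilon>. ?G m \<epsilon> / \<epsilon> ^ weight w n m) \<longlongrightarrow> 1) (at 0)"
          by (rule grothendieck_limit[OF len[OF m] b[OF m] W w_def])
        have lim2: "((\<lambda>\<epsilon>. c m * (?G m \<epsilon> / \<epsilon> ^ weight w n m * \<epsilon> ^ (weight w n m - ?v)))
            \<longlongrightarrow> c m * (1 * 0 ^ (weight w n m - ?v))) (at 0)"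
          by (intro tendsto_intros lim1)
        have "eventually (\<lambda>\<epsilon>. c m * (?G m \<epsilon> / \<epsilon> ^ weight w n m * \<epsilon> ^ (weight w n m - ?v))
            = c m * (?G m \<epsilon> / \<epsilon> ^ ?v)) (at 0)"
          using e0 by eventually_elim (use l0(2)[OF mT] in \<open>simp add: power_diff\<close>)
        with lim2 have "((\<lambda>\<epsilon>. c m * (?G m \<epsilon> / \<epsilon> ^ ?v)) \<longlongrightarrow> c m * (1 * 0 ^ (weight w n m - ?v))) (at 0)"
          by (rule Lim_transform_eventually)
        moreover have "c m * (1 * 0 ^ (weight w n m - ?v)) = (if m = l0 then c m else 0)"
          using l0(2)[OF mT] inj[OF m, of l0] l0(1) by (auto simp: T_def power_0_left)
        ultimately show ?thesis by (simp only:)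
      qed
    qed
    then have "((\<lambda>\<epsilon>. (\<Sum>l\<in>S. c l * ?G l \<epsilon>) / \<epsilon> ^ ?v) \<longlongrightarrow> c l0) (at 0)"
      using l0(1) fin by (simp add: sum_divide_distrib T_def)
    then have "c l0 = 0" using lim0 by (rule tendsto_unique[rotated]) simp
    then show False using l0(1) by (simp add: T_def)
  qed
  have wW: "W \<le> w k" for k by (simp add: w_def)
  have "separates w W n S" unfolding separates_def by (intro allI impI) (rule main)
  then show ?thesis using W wW mono by blast
qed

text \<open>The zero function has every order of vanishing, so separation applies with
  \<open>M\<close> one above the size of \<open>l\<close>.\<close>

lemma grothendieck_independent:
  assumes "finite S" "\<And>as. nonzero as \<Longrightarrow> (\<Sum>l\<in>S. c l * grothendieck_part l as []) = 0" "l \<in> S"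
  shows "c l = 0"
proof -
  define n where "n = Max (length ` parts ` S)"
  have len: "length (parts l) \<le> n" if "l \<in> S" for l
    unfolding n_def by (rule Max_ge) (use assms(1) that in auto)
  obtain w W where w: "W > 0" "\<And>k. W \<le> w k" "strict_mono w"
    "separates w W n S"
    using graded_independence[OF assms(1) len] by metis
  have w0: "w k > 0" for k using w(1) w(2)[of k] by simp
  have "eventually (\<lambda>\<epsilon>. (\<Sum>l\<in>S. c l * grothendieck_part l (alphabet (power_points w n \<epsilon>)) []) = 0) (at 0)"
    using eventually_regular_power_points[OF w0 w(3), of n]
    by eventually_elim (use assms(2) nonzero_alphabet in simp)
  then have "(\<lambda>\<epsilon>. \<Sum>l\<in>S. c l * grothendieck_part l (alphabet (power_points w n \<epsilon>)) [])
      \<in> O[at 0](\<lambda>\<epsilon>. \<epsilon> ^ (W * Suc (sum_list (parts l))))"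
    by (simp add: landau_o.big.in_cong)
  then show ?thesis by (rule separatesD[OF w(4) assms(3) lessI])
qed

section \<open>Expansions in a finite box of partitions\<close>

text \<open>Uniqueness behind the definite description in \<open>Gam_elem\<close>; elements are told
  apart by their values at \<open>bs = []\<close>, where independence was established.\<close>

lemma eval_Gam_inject:
  assumes "\<And>as. nonzero as \<Longrightarrow> eval_Gam c as [] = eval_Gam d as []"
  shows "c = d"
proof (rule poly_mapping_eqI)
  fix l
  let ?S = "insert l (keys c \<union> keys d)"
  have "of_int (lookup c l - lookup d l) = (0::complex)"
  proof (rule grothendieck_independent[of ?S "\<lambda>l. of_int (lookup c l - lookup d l)"])
    fix as :: "complex list" assume "nonzero as"
    then have "eval_Gam c as [] - eval_Gam d as [] = 0" using assms by simp
    moreover have "eval_Gam c as [] = (\<Sum>l\<in>?S. of_int (lookup c l) * grothendieck_part l as [])"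
      "eval_Gam d as [] = (\<Sum>l\<in>?S. of_int (lookup d l) * grothendieck_part l as [])"
      by (rule eval_Gam_superset; auto)+
    ultimately show "(\<Sum>l\<in>?S. of_int (lookup c l - lookup d l) * grothendieck_part l as []) = 0"
      by (simp only: of_int_diff left_diff_distrib sum_subtractf)
  qed auto
  then show "lookup c l = lookup d l" by simp
qed

lemma Gam_elem_eqI:
  assumes "\<And>as bs. nonzero as \<Longrightarrow> grothendieck I as bs = eval_Gam c as bs"
  shows "Gam_elem I = c"
  unfolding Gam_elem_def eval_Gam_def[symmetric]
proof (rule the_equality)
  show "\<forall>as bs. nonzero as \<longrightarrow> grothendieck I as bs = eval_Gam c as bs" using assms by blast
next
  fix d assume "\<forall>as bs. nonzero as \<longrightarrow> grothendieck I as bs = eval_Gam d as bs"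
  then have "eval_Gam d as [] = eval_Gam c as []" if "nonzero as" for as using assms[of as "[]"] that by simp
  then show "d = c" by (rule eval_Gam_inject)
qed

lemma straightening_Gam_elem:
  assumes "\<forall>x\<in>set I. x \<le> K"
  shows "straightening K I (Gam_elem I)"
proof -
  obtain c where c: "straightening K I c" using straightening_exists[OF assms] ..
  then have "Gam_elem I = c" by (intro Gam_elem_eqI) (simp add: straightening_def)
  then show ?thesis using c by simp
qed

text \<open>For fixed \<open>l\<close> this bounds the nonnegative sequences whose \<open>G\<close>
  involves \<open>G_l\<close>, the source of the finiteness statements for the Laurent
  series.\<close>

lemma lookup_Gam_elem_nonneg:
  assumes "\<forall>x\<in>set I. 0 \<le> x" "lookup (Gam_elem I) l \<noteq> 0"
  shows "length (parts l) \<le> length I" "sum_list I \<le> int (sum_list (parts l))"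
proof -
  have "\<forall>x\<in>set I. x \<le> Max (set I)" by simp
  from straightening_Gam_elem[OF this] assms show "length (parts l) \<le> length I" "sum_list I \<le> int (sum_list (parts l))"
    by (auto simp: straightening_def in_keys_iff)
qed

definition partition_box :: "nat \<Rightarrow> int \<Rightarrow> integer_partition set" where
  "partition_box n K = {l. length (parts l) \<le> n \<and> (\<forall>x\<in>set (parts l). int x \<le> K)}"

lemma finite_partition_box: "finite (partition_box n K)"
proof -
  have "parts ` partition_box n K \<subseteq> {xs. set xs \<subseteq> {..nat K} \<and> length xs \<le> n}"
    by (auto simp: partition_box_def)
  then have "finite (parts ` partition_box n K)"
    by (rule finite_subset) (rule finite_lists_length_le, simp)
  then show ?thesis by (rule finite_imageD) (simp add: inj_on_def parts_inject)
qed

lemma keys_Gam_elem_box: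
  assumes "length I \<le> n" "\<forall>x\<in>set I. x \<le> K"
  shows "keys (Gam_elem I) \<subseteq> partition_box n K"
  using straightening_Gam_elem[OF assms(2)] assms(1) by (fastforce simp: straightening_def partition_box_def)

lemma grothendieck_eq_sum_box:
  assumes "length I \<le> n" "\<forall>x\<in>set I. x \<le> K" "nonzero as"
  shows "grothendieck I as bs
    = (\<Sum>l\<in>partition_box n K. of_int (lookup (Gam_elem I) l) * grothendieck_part l as bs)"
  using straightening_Gam_elem[OF assms(2)] assms(3)
    eval_Gam_superset[OF finite_partition_box keys_Gam_elem_box[OF assms(1,2)]]
  by (simp add: straightening_def)

text \<open>\<open>combination E K F\<close>: on exponents in \<open>E\<close>, \<open>F\<close> acts as a Laurent polynomial in \<open>y\<close> of degree at most \<open>K\<close>.\<close>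

definition combination :: "int set \<Rightarrow> int \<Rightarrow> (complex list \<Rightarrow> int \<Rightarrow> complex) \<Rightarrow> bool" where
  "combination E K F \<longleftrightarrow> (\<exists>S c. finite S \<and> S \<subseteq> {..K} \<and>
     (\<forall>as. nonzero as \<longrightarrow> (\<forall>e\<in>E. F as e = (\<Sum>s\<in>S. c s * moment as [] s e))))"

lemma combination_moment: "k \<le> K \<Longrightarrow> combination E K (\<lambda>as e. moment as [] k e)"
  unfolding combination_def by (intro exI[of _ "{k}"] exI[of _ "\<lambda>_. 1"]) auto

lemma combination_zero: "combination E K (\<lambda>as e. 0)"
  unfolding combination_def by (intro exI[of _ "{}"]) auto

lemma combination_cmult:
  assumes "combination E K F"
  shows "combination E K (\<lambda>as e. r * F as e)"
proof -
  obtain S c where *: "finite S" "S \<subseteq> {..K}"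
    "\<And>as e. nonzero as \<Longrightarrow> e \<in> E \<Longrightarrow> F as e = (\<Sum>s\<in>S. c s * moment as [] s e)"
    using assms unfolding combination_def by metis
  show ?thesis unfolding combination_def
    by (intro exI[of _ S] exI[of _ "\<lambda>s. r * c s"]) (use * in \<open>simp add: sum_distrib_left mult_ac\<close>)
qed

lemma combination_add:
  assumes "combination E K F" "combination E K G"
  shows "combination E K (\<lambda>as e. F as e + G as e)"
proof -
  obtain S c where 1: "finite S" "S \<subseteq> {..K}"
    "\<And>as e. nonzero as \<Longrightarrow> e \<in> E \<Longrightarrow> F as e = (\<Sum>s\<in>S. c s * moment as [] s e)"
    using assms(1) unfolding combination_def by metis
  obtain T d where 2: "finite T" "T \<subseteq> {..K}"
    "\<And>as e. nonzero as \<Longrightarrow> e \<in> E \<Longrightarrow> G as e = (\<Sum>s\<in>T. d s * moment as [] s e)"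
    using assms(2) unfolding combination_def by metis
  let ?c = "\<lambda>s. (if s \<in> S then c s else 0) + (if s \<in> T then d s else 0)"
  have "F as e + G as e = (\<Sum>s\<in>S \<union> T. ?c s * moment as [] s e)" if "nonzero as" "e \<in> E" for as e
  proof -
    have "F as e = (\<Sum>s\<in>S \<union> T. (if s \<in> S then c s else 0) * moment as [] s e)"
      unfolding 1(3)[OF that] by (rule sum.mono_neutral_cong_left) (use 1 2 in auto)
    moreover have "G as e = (\<Sum>s\<in>S \<union> T. (if s \<in> T then d s else 0) * moment as [] s e)"
      unfolding 2(3)[OF that] by (rule sum.mono_neutral_cong_left) (use 1 2 in auto)
    ultimately show ?thesis by (simp only: distrib_right sum.distrib)
  qed
  then show ?thesis unfolding combination_def
    by (intro exI[of _ "S \<union> T"] exI[of _ ?c]) (use 1 2 in auto)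
qed

lemma combination_sum:
  assumes "finite A" "\<And>a. a \<in> A \<Longrightarrow> combination E K (F a)"
  shows "combination E K (\<lambda>as e. \<Sum>a\<in>A. F a as e)"
  using assms by (induction A) (auto simp: combination_zero combination_add)

lemma combination_cong:
  assumes "combination E K F" "\<And>as e. nonzero as \<Longrightarrow> e \<in> E \<Longrightarrow> F as e = G as e"
  shows "combination E K G"
proof -
  obtain S c where *: "finite S" "S \<subseteq> {..K}"
    "\<And>as e. nonzero as \<Longrightarrow> e \<in> E \<Longrightarrow> F as e = (\<Sum>s\<in>S. c s * moment as [] s e)"
    using assms(1) unfolding combination_def by metis
  show ?thesis unfolding combination_def
    by (intro exI[of _ S] exI[of _ c]) (use * in \<open>simp add: assms(2)[symmetric]\<close>)
qed

text \<open>Each factor \<open>z = 1 - y\<close> raises the degree in \<open>y\<close> by at most 1,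
  hence the allowance \<open>k + int r\<close>.\<close>

lemma combination_shift:
  "k + int r \<le> K \<Longrightarrow> combination E K (\<lambda>as e. moment as [] k (e + int r))"
proof (induction r arbitrary: k)
  case 0
  then show ?case by (simp add: combination_moment)
next
  case (Suc r)
  have "combination E K (\<lambda>as e. moment as [] k (e + int r) + (- 1) * moment as [] (k + 1) (e + int r))"
    using Suc.prems by (intro combination_add combination_cmult Suc.IH) auto
  then show ?case
    by (rule combination_cong) (use moment_step in \<open>simp add: add.assoc add.commute[of 1]\<close>)
qed

text \<open>Geometric expansion of \<open>1 / (y - x)\<close> in powers of \<open>x / y\<close>,
  stopped after \<open>M\<close> terms with its exact remainder.\<close>

lemma moment_Cons_series:
  assumes "a \<noteq> 0" "nonzero as"
  shows "moment (a # as) [] k e = (1 / a) * (\<Sum>m<M. (1 - 1 / a) ^ m * moment as [] (k - int m) e)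
    + (1 - 1 / a) ^ M * moment (a # as) [] (k - int M) e"
proof (induction M)
  case (Suc M)
  define x where "x = 1 - 1 / a"
  have nz: "nonzero (a # as)" using assms by simp
  have "moment (a # as) [] (k - int M) e
    = (1 - 1 / a) * moment (a # as) [] (k - int (Suc M)) e + 1 / a * moment as [] (k - int M) e"
  proof -
    have eq: "k - int M - 1 = k - int (Suc M)" by simp
    show ?thesis
      using moment_shift_k[OF nz, of "[]" "k - int M" e, unfolded eq] by (simp only: diff_eq_eq add.commute)
  qed
  then show ?case unfolding Suc x_def[symmetric] by (simp add: algebra_simps)
qed simp

text \<open>The expansion of \<open>1 / (1 - z a)\<close> in powers of \<open>z\<close> breaks off:
  after \<open>q\<close> steps the remaining moment has a pole neither at 0 nor at infinity.\<close>

lemma moment_Cons_negative: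
  assumes "a \<noteq> 0" "nonzero as" "e + int q > 0" "k + e + int q < 0"
  shows "moment (a # as) [] k e = (\<Sum>r<q. a ^ r * moment as [] (k + 1) (e + int r))"
proof -
  have nz: "nonzero (a # as)" using assms by simp
  have "moment (a # as) [] k e = (\<Sum>r<q. a ^ r * moment as [] (k + 1) (e + int r))
    + a ^ q * moment (a # as) [] k (e + int q)" for q
  proof (induction q)
    case (Suc q)
    have "moment (a # as) [] k (e + int q)
      = a * moment (a # as) [] k (e + int (Suc q)) + moment as [] (k + 1) (e + int q)"
      using moment_Cons[OF nz, of "[]" k "e + int q"] by (simp add: algebra_simps)
    then show ?case unfolding Suc by (simp add: algebra_simps)
  qed simp
  from this[of q] show ?thesis
    using moment_eq_0[OF nz, of k "e + int q" "[]"] assms by (simp add: add.assoc)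
qed

text \<open>A letter is removed by \<open>M\<close> terms in \<open>1 / y\<close>, the remainder
  then by finitely many powers of \<open>z\<close>. Restricting \<open>e\<close> to the exponents of
  the matrix lets one \<open>M\<close> serve for all of them; \<open>M\<close> is large enough to
  make the second expansion stop and to absorb the degree gained from \<open>z ^ r\<close>.\<close>

lemma combination_moment_Cons:
  assumes "a \<noteq> 0"
  shows "combination {- int n<..<int n} k (\<lambda>as e. moment (a # as) [] k e)"
proof -
  define M where "M = nat \<bar>k\<bar> + 2 * n + 2"
  let ?F = "\<lambda>as e. (1 / a) * (\<Sum>m<M. (1 - 1 / a) ^ m * moment as [] (k - int m) e)
    + (1 - 1 / a) ^ M * (\<Sum>r<n. a ^ r * moment as [] (k - int M + 1) (e + int r))"
  have "combination {- int n<..<int n} k ?F"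
    by (intro combination_add combination_cmult combination_sum combination_moment combination_shift)
       (auto simp: M_def)
  then show ?thesis
  proof (rule combination_cong)
    fix as e assume as: "nonzero as" and e: "e \<in> {- int n<..<int n}"
    have "0 < e + int n" "k - int M + e + int n < 0" using e by (auto simp: M_def)
    from moment_Cons_negative[OF assms as this]
    show "?F as e = moment (a # as) [] k e"
      using moment_Cons_series[OF assms as, of k e M] by (simp only:)
  qed
qed

text \<open>Multilinearity of the determinant in its rows: \<open>g\<close> chooses one summand in
  each row.\<close>

lemma leibniz_sum_grothendieck:
  assumes "nonzero as" "\<And>i. i < n \<Longrightarrow> finite (T i)"
  shows "(\<Sum>p | p permutes {0..<n}. signof p
      * (\<Prod>i<n. \<Sum>s\<in>T i. c i s * moment as bs (u i s - int (Suc i)) (int i - int (p i))))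
    = (\<Sum>g\<in>PiE {..<n} T. (\<Prod>i<n. c i (g i)) * grothendieck (map (\<lambda>i. u i (g i)) [0..<n]) as bs)"
proof -
  have "(\<Sum>p | p permutes {0..<n}. signof p
      * (\<Prod>i<n. \<Sum>s\<in>T i. c i s * moment as bs (u i s - int (Suc i)) (int i - int (p i))))
    = (\<Sum>p | p permutes {0..<n}. \<Sum>g\<in>PiE {..<n} T. signof p
    * (\<Prod>i<n. c i (g i) * moment as bs (u i (g i) - int (Suc i)) (int i - int (p i))))"
  proof (rule sum.cong[OF refl])
    fix p
    have "(\<Prod>i<n. \<Sum>s\<in>T i. c i s * moment as bs (u i s - int (Suc i)) (int i - int (p i)))
      = (\<Sum>g\<in>PiE {..<n} T. \<Prod>i<n. c i (g i) * moment as bs (u i (g i) - int (Suc i)) (int i - int (p i)))"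
      by (rule prod_sum_PiE) (use assms(2) in auto)
    then show "signof p * (\<Prod>i<n. \<Sum>s\<in>T i. c i s * moment as bs (u i s - int (Suc i)) (int i - int (p i)))
      = (\<Sum>g\<in>PiE {..<n} T. signof p
        * (\<Prod>i<n. c i (g i) * moment as bs (u i (g i) - int (Suc i)) (int i - int (p i))))"
      by (simp only: sum_distrib_left)
  qed
  also have "\<dots> = (\<Sum>g\<in>PiE {..<n} T. \<Sum>p | p permutes {0..<n}. signof p
    * (\<Prod>i<n. c i (g i) * moment as bs (u i (g i) - int (Suc i)) (int i - int (p i))))"
    by (rule sum.swap)
  also have "\<dots> = (\<Sum>g\<in>PiE {..<n} T. (\<Prod>i<n. c i (g i)) * grothendieck (map (\<lambda>i. u i (g i)) [0..<n]) as bs)"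
    by (simp add: grothendieck_leibniz[OF assms(1)] prod.distrib sum_distrib_left mult.left_commute)
  finally show ?thesis .
qed

lemma grothendieck_substitute:
  assumes "nonzero as" "nonzero as'" "\<And>i. i < length I \<Longrightarrow> finite (T i)"
    "\<And>i e. i < length I \<Longrightarrow> e \<in> {- int (length I)<..<int (length I)} \<Longrightarrow>
      moment as' [] (I ! i - int (Suc i)) e = (\<Sum>s\<in>T i. c i s * moment as [] (s - int (Suc i)) e)"
  shows "grothendieck I as' [] = (\<Sum>g\<in>PiE {..<length I} T.
    (\<Prod>i<length I. c i (g i)) * grothendieck (map g [0..<length I]) as [])"
proof -
  have "grothendieck I as' [] = (\<Sum>p | p permutes {0..<length I}. signof p
    * (\<Prod>i<length I. \<Sum>s\<in>T i. c i s * moment as [] (s - int (Suc i)) (int i - int (p i))))"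
    unfolding grothendieck_leibniz[OF assms(2)]
  proof (intro sum.cong prod.cong arg_cong2[of _ _ _ _ "(*)"] refl)
    fix p i assume "p \<in> {p. p permutes {0..<length I}}" "i \<in> {..<length I}"
    then have "i < length I" "p i < length I" using permutes_atLeast0 by auto
    then show "moment as' [] (I ! i - int (Suc i)) (int i - int (p i))
      = (\<Sum>s\<in>T i. c i s * moment as [] (s - int (Suc i)) (int i - int (p i)))"
      using assms(4)[of i "int i - int (p i)"] by simp
  qed
  also have "\<dots> = (\<Sum>g\<in>PiE {..<length I} T.
    (\<Prod>i<length I. c i (g i)) * grothendieck (map g [0..<length I]) as [])"
    using leibniz_sum_grothendieck[OF assms(1), of "length I" T c "[]" "\<lambda>i s. s"] assms(3) by simp
  finally show ?thesis .
qed

text \<open>The coefficients are complex because they absorb the letters that are split off from the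
  alphabet; the box does not change in this process.\<close>

definition spanned :: "nat \<Rightarrow> int \<Rightarrow> (complex list \<Rightarrow> complex) \<Rightarrow> bool" where
  "spanned n K h \<longleftrightarrow> (\<exists>c. \<forall>as. nonzero as \<longrightarrow> h as = (\<Sum>l\<in>partition_box n K. c l * grothendieck_part l as []))"

lemma spanned_grothendieck:
  assumes "length I \<le> n" "\<forall>x\<in>set I. x \<le> K"
  shows "spanned n K (\<lambda>as. grothendieck I as [])"
  unfolding spanned_def
  by (rule exI[of _ "\<lambda>l. of_int (lookup (Gam_elem I) l)"])
     (simp add: grothendieck_eq_sum_box[OF assms])

lemma spanned_sum:
  assumes "finite A" "\<And>a. a \<in> A \<Longrightarrow> spanned n K (h a)"
  shows "spanned n K (\<lambda>as. \<Sum>a\<in>A. r a * h a as)"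
proof -
  have "\<forall>a\<in>A. \<exists>c. \<forall>as. nonzero as \<longrightarrow> h a as = (\<Sum>l\<in>partition_box n K. c l * grothendieck_part l as [])"
    using assms(2) by (simp add: spanned_def)
  from bchoice[OF this] obtain c where
    c: "\<And>a as. a \<in> A \<Longrightarrow> nonzero as \<Longrightarrow> h a as = (\<Sum>l\<in>partition_box n K. c a l * grothendieck_part l as [])"
    by blast
  have "(\<Sum>a\<in>A. r a * h a as) = (\<Sum>l\<in>partition_box n K. (\<Sum>a\<in>A. r a * c a l) * grothendieck_part l as [])"
    if "nonzero as" for as
  proof -
    have "(\<Sum>a\<in>A. r a * h a as) = (\<Sum>a\<in>A. \<Sum>l\<in>partition_box n K. r a * c a l * grothendieck_part l as [])"
      using c that by (simp add: sum_distrib_left mult.assoc)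
    also have "\<dots> = (\<Sum>l\<in>partition_box n K. \<Sum>a\<in>A. r a * c a l * grothendieck_part l as [])" by (rule sum.swap)
    finally show ?thesis by (simp add: sum_distrib_right)
  qed
  then show ?thesis unfolding spanned_def by (intro exI[of _ "\<lambda>l. \<Sum>a\<in>A. r a * c a l"]) simp
qed

lemma spanned_cong:
  assumes "spanned n K h" "\<And>as. nonzero as \<Longrightarrow> h as = h' as"
  shows "spanned n K h'"
  using assms(1) unfolding spanned_def by (simp add: assms(2))

lemma spanned_grothendieck_Cons:
  assumes "length I \<le> n" "\<forall>x\<in>set I. x \<le> K" "a \<noteq> 0"
  shows "spanned n K (\<lambda>as. grothendieck I (a # as) [])"
proof -
  let ?E = "{- int (length I)<..<int (length I)}"
  define Q where "Q i T c \<longleftrightarrow> finite T \<and> T \<subseteq> {..I ! i} \<and> (\<forall>as. nonzero as \<longrightarrow> (\<forall>e\<in>?E.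
    moment (a # as) [] (I ! i - int (Suc i)) e = (\<Sum>s\<in>T. c s * moment as [] (s - int (Suc i)) e)))"
    for i T c
  have "\<exists>T c. Q i T c" for i
  proof -
    obtain S c where S: "finite S" "S \<subseteq> {..I ! i - int (Suc i)}"
      "\<And>as e. nonzero as \<Longrightarrow> e \<in> ?E \<Longrightarrow>
        moment (a # as) [] (I ! i - int (Suc i)) e = (\<Sum>s\<in>S. c s * moment as [] s e)"
      using combination_moment_Cons[OF assms(3), of "length I" "I ! i - int (Suc i)"]
      unfolding combination_def by metis
    have "(\<Sum>s\<in>(\<lambda>s. s + int (Suc i)) ` S. c (s - int (Suc i)) * moment as [] (s - int (Suc i)) e)
      = (\<Sum>s\<in>S. c s * moment as [] s e)" for as e
      by (subst sum.reindex) (auto simp: inj_on_def)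
    then show ?thesis
      unfolding Q_def using S by (intro exI[of _ "(\<lambda>s. s + int (Suc i)) ` S"] exI[of _ "\<lambda>s. c (s - int (Suc i))"]) fastforce
  qed
  then obtain T c where "\<And>i. Q i (T i) (c i)" by metis
  then have T: "\<And>i. finite (T i)" "\<And>i. T i \<subseteq> {..I ! i}"
    "\<And>i as e. nonzero as \<Longrightarrow> e \<in> ?E \<Longrightarrow>
      moment (a # as) [] (I ! i - int (Suc i)) e = (\<Sum>s\<in>T i. c i s * moment as [] (s - int (Suc i)) e)"
    unfolding Q_def by blast+
  have "spanned n K (\<lambda>as. \<Sum>g\<in>PiE {..<length I} T.
    (\<Prod>i<length I. c i (g i)) * grothendieck (map g [0..<length I]) as [])"
  proof (intro spanned_sum spanned_grothendieck finite_PiE)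
    fix g assume g: "g \<in> PiE {..<length I} T"
    show "\<forall>x\<in>set (map g [0..<length I]). x \<le> K"
    proof
      fix x assume "x \<in> set (map g [0..<length I])"
      then obtain i where i: "i < length I" "x = g i" by auto
      then have "x \<le> I ! i" using g T(2)[of i] by (auto simp: PiE_iff)
      then show "x \<le> K" using assms(2) nth_mem[OF i(1)] by fastforce
    qed
  qed (use T(1) assms(1) in auto)
  then show ?thesis
  proof (rule spanned_cong)
    fix as assume as: "nonzero as"
    then have "nonzero (a # as)" using assms(3) by simp
    from grothendieck_substitute[OF as this T(1) T(3)[OF as]]
    show "(\<Sum>g\<in>PiE {..<length I} T. (\<Prod>i<length I. c i (g i)) * grothendieck (map g [0..<length I]) as [])
      = grothendieck I (a # as) []" by simp
  qed
qed

lemma spanned_Cons: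
  assumes "spanned n K h" "a \<noteq> 0"
  shows "spanned n K (\<lambda>as. h (a # as))"
proof -
  obtain c where c: "\<And>as. nonzero as \<Longrightarrow> h as = (\<Sum>l\<in>partition_box n K. c l * grothendieck_part l as [])"
    using assms(1) unfolding spanned_def by blast
  have "spanned n K (\<lambda>as. \<Sum>l\<in>partition_box n K. c l * grothendieck_part l (a # as) [])"
    unfolding grothendieck_part_def
    by (intro spanned_sum finite_partition_box spanned_grothendieck_Cons assms(2)) (auto simp: partition_box_def)
  then show ?thesis by (rule spanned_cong) (use c assms(2) in simp)
qed

lemma spanned_append:
  assumes "spanned n K h" "nonzero ys"
  shows "spanned n K (\<lambda>as. h (ys @ as))"
  using assms(2)
proof (induction ys rule: rev_induct)
  case (snoc y ys)
  then have "spanned n K (\<lambda>as. h (ys @ as))" by simp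
  then show ?case using spanned_Cons[of n K "\<lambda>as. h (ys @ as)" y] snoc.prems by simp
qed (use assms(1) in simp)

section \<open>Bilinear expansions\<close>

definition independent_on :: "'x set \<Rightarrow> 'l set \<Rightarrow> ('l \<Rightarrow> 'x \<Rightarrow> complex) \<Rightarrow> bool" where
  "independent_on D L f \<longleftrightarrow>
     (\<forall>c. (\<forall>x\<in>D. (\<Sum>l\<in>L. c l * f l x) = 0) \<longrightarrow> (\<forall>l\<in>L. c l = 0))"

text \<open>Linearly independent functions have dual functionals that are finite combinations of
  point evaluations. In the induction the new function, reduced by means of the old functionals, is
  nonzero at some point \<open>x0\<close>, and the evaluation there is corrected and
  normalised.\<close>

lemma dual_evaluations:
  fixes f :: "'l \<Rightarrow> 'x \<Rightarrow> complex"
  assumes "finite L" "independent_on D L f"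
  shows "\<exists>P \<mu>. finite P \<and> P \<subseteq> D \<and>
    (\<forall>l\<in>L. \<forall>m\<in>L. (\<Sum>x\<in>P. \<mu> l x * f m x) = (if m = l then 1 else 0))"
  using assms
proof (induction L rule: finite_induct)
  case empty
  show ?case by (intro exI[of _ "{}"]) simp
next
  case (insert a L)
  have "independent_on D L f"
    unfolding independent_on_def
  proof (intro allI impI)
    fix c assume c: "\<forall>x\<in>D. (\<Sum>l\<in>L. c l * f l x) = 0"
    have "(\<Sum>l\<in>insert a L. (c(a := 0)) l * f l x) = (\<Sum>l\<in>L. c l * f l x)" for x
      using insert.hyps by (auto intro!: sum.cong)
    then have "\<forall>l\<in>insert a L. (c(a := 0)) l = 0"
      using insert.prems c unfolding independent_on_def by metis
    then show "\<forall>l\<in>L. c l = 0" using insert.hyps by (metis fun_upd_other insertCI)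
  qed
  then obtain P \<mu> where P: "finite P" "P \<subseteq> D"
    "\<And>l m. l \<in> L \<Longrightarrow> m \<in> L \<Longrightarrow> (\<Sum>x\<in>P. \<mu> l x * f m x) = (if m = l then 1 else 0)"
    using insert.IH by metis
  define ev where "ev l g = (\<Sum>x\<in>P. \<mu> l x * g x)" for l and g :: "'x \<Rightarrow> complex"
  define h where "h x = f a x - (\<Sum>l\<in>L. ev l (f a) * f l x)" for x
  have "\<exists>x0\<in>D. h x0 \<noteq> 0"
  proof (rule ccontr)
    assume *: "\<not> (\<exists>x0\<in>D. h x0 \<noteq> 0)"
    define c where "c l = (if l = a then 1 else - ev l (f a))" for l
    have "(\<Sum>l\<in>insert a L. c l * f l x) = h x" for x
    proof -
      have "(\<Sum>l\<in>L. c l * f l x) = (\<Sum>l\<in>L. - (ev l (f a) * f l x))"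
        by (rule sum.cong) (use insert.hyps in \<open>auto simp: c_def\<close>)
      then show ?thesis using insert.hyps by (simp add: h_def sum_negf) (simp add: c_def)
    qed
    then have "c a = 0" using insert.prems * unfolding independent_on_def by (metis insertI1)
    then show False by (simp add: c_def)
  qed
  then obtain x0 where x0: "x0 \<in> D" "h x0 \<noteq> 0" by blast
  define P' where "P' = insert x0 P"
  define \<nu> where "\<nu> l x = (if x \<in> P then \<mu> l x else 0)" for l x
  have P': "finite P'" "P' \<subseteq> D" "P \<subseteq> P'" "x0 \<in> P'" using P x0 by (auto simp: P'_def)
  have \<nu>: "(\<Sum>x\<in>P'. \<nu> l x * g x) = ev l g" for l g
    unfolding ev_def by (rule sum.mono_neutral_cong_right) (use P' in \<open>auto simp: \<nu>_def\<close>)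
  \<comment> \<open>The functional that reduces a function by the old ones, evaluates at
    \<open>x0\<close> and divides by \<open>h x0\<close>: it annihilates \<open>f l\<close> for
    \<open>l\<close> in \<open>L\<close> and takes the value 1 at \<open>f a\<close>.\<close>
  define \<alpha> where "\<alpha> x = ((if x = x0 then 1 else 0) - (\<Sum>l\<in>L. f l x0 * \<nu> l x)) / h x0" for x
  have \<alpha>: "(\<Sum>x\<in>P'. \<alpha> x * g x) = (g x0 - (\<Sum>l\<in>L. f l x0 * ev l g)) / h x0" for g
  proof -
    have "(\<Sum>x\<in>P'. \<alpha> x * g x) = (\<Sum>x\<in>P'. (if x = x0 then g x else 0) - (\<Sum>l\<in>L. f l x0 * (\<nu> l x * g x))) / h x0"
      unfolding \<alpha>_def sum_divide_distrib
      by (intro sum.cong refl) (simp add: algebra_simps sum_distrib_left)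
    also have "(\<Sum>x\<in>P'. (if x = x0 then g x else 0) - (\<Sum>l\<in>L. f l x0 * (\<nu> l x * g x)))
        = g x0 - (\<Sum>x\<in>P'. \<Sum>l\<in>L. f l x0 * (\<nu> l x * g x))"
      using P' by (simp add: sum_subtractf)
    also have "(\<Sum>x\<in>P'. \<Sum>l\<in>L. f l x0 * (\<nu> l x * g x)) = (\<Sum>l\<in>L. \<Sum>x\<in>P'. f l x0 * (\<nu> l x * g x))"
      by (rule sum.swap)
    also have "\<dots> = (\<Sum>l\<in>L. f l x0 * ev l g)"
      by (simp only: sum_distrib_left[symmetric] \<nu>)
    finally show ?thesis .
  qed
  have evL: "ev l (f m) = (if m = l then 1 else 0)" if "l \<in> L" "m \<in> L" for l m
    using P(3)[OF that] by (simp add: ev_def)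
  have \<alpha>L: "(\<Sum>x\<in>P'. \<alpha> x * f m x) = 0" if "m \<in> L" for m
  proof -
    have "(\<Sum>l\<in>L. f l x0 * ev l (f m)) = (\<Sum>l\<in>L. if l = m then f l x0 else 0)"
      by (rule sum.cong) (use evL that in auto)
    then show ?thesis unfolding \<alpha> using that insert.hyps by simp
  qed
  have \<alpha>a: "(\<Sum>x\<in>P'. \<alpha> x * f a x) = 1"
    unfolding \<alpha> using x0(2) by (simp add: h_def mult.commute)
  define \<mu>' where "\<mu>' l x = (if l = a then \<alpha> x else \<nu> l x - ev l (f a) * \<alpha> x)" for l x
  have "(\<Sum>x\<in>P'. \<mu>' l x * f m x) = (if m = l then 1 else 0)" if "l \<in> insert a L" "m \<in> insert a L" for l m
  proof (cases "l = a")
    case True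
    then show ?thesis using that \<alpha>a \<alpha>L insert.hyps by (auto simp: \<mu>'_def)
  next
    case False
    have "(\<Sum>x\<in>P'. \<mu>' l x * f m x) = ev l (f m) - ev l (f a) * (\<Sum>x\<in>P'. \<alpha> x * f m x)"
      using False by (simp add: \<mu>'_def left_diff_distrib sum_subtractf \<nu> sum_distrib_left mult.assoc)
    then show ?thesis using that False \<alpha>a \<alpha>L evL by auto
  qed
  then show ?case using P' by blast
qed

lemma independent_grothendieck:
  assumes "finite S"
  shows "independent_on {as. nonzero as} S (\<lambda>l as. grothendieck_part l as [])"
  unfolding independent_on_def using grothendieck_independent[OF assms] by blast

text \<open>The coefficient of \<open>G_l(xs)\<close> is a combination of the functions
  \<open>ys -> G_I(x, ys)\<close> for finitely many fixed \<open>x\<close>, hence lies in the same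
  finite span. The functionals are part of the conclusion because they are applied again to the
  asymptotic expansion.\<close>

lemma grothendieck_bilinear:
  assumes "length I \<le> n" "\<forall>x\<in>set I. x \<le> K"
  obtains P \<mu> D where "finite P" "\<And>x. x \<in> P \<Longrightarrow> nonzero x"
    "\<And>l m. l \<in> partition_box n K \<Longrightarrow> m \<in> partition_box n K \<Longrightarrow>
      (\<Sum>x\<in>P. \<mu> l x * grothendieck_part m x []) = (if m = l then 1 else 0)"
    "\<And>l ys. l \<in> partition_box n K \<Longrightarrow> nonzero ys \<Longrightarrow>
      (\<Sum>x\<in>P. \<mu> l x * grothendieck I (x @ ys) []) = (\<Sum>m\<in>partition_box n K. D l m * grothendieck_part m ys [])"
    "\<And>xs ys. nonzero xs \<Longrightarrow> nonzero ys \<Longrightarrow>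
      grothendieck I (xs @ ys) [] = (\<Sum>l\<in>partition_box n K. \<Sum>m\<in>partition_box n K.
        D l m * grothendieck_part l xs [] * grothendieck_part m ys [])"
proof -
  obtain P \<mu> where P: "finite P" "P \<subseteq> {as. nonzero as}"
    "\<And>l m. l \<in> partition_box n K \<Longrightarrow> m \<in> partition_box n K \<Longrightarrow>
      (\<Sum>x\<in>P. \<mu> l x * grothendieck_part m x []) = (if m = l then 1 else 0)"
    using dual_evaluations[OF finite_partition_box independent_grothendieck[OF finite_partition_box]] by metis
  define \<phi> where "\<phi> l ys = (\<Sum>x\<in>P. \<mu> l x * grothendieck I (x @ ys) [])" for l ys
  note span = spanned_grothendieck[OF assms]
  have "spanned n K (\<phi> l)" for l
    unfolding \<phi>_def
    by (intro spanned_sum P(1) spanned_append[OF span]) (use P(2) in auto)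
  then have "\<forall>l. \<exists>D. \<forall>ys. nonzero ys \<longrightarrow> \<phi> l ys = (\<Sum>m\<in>partition_box n K. D m * grothendieck_part m ys [])"
    by (simp add: spanned_def)
  from choice[OF this] obtain D where
    D: "\<And>l ys. nonzero ys \<Longrightarrow> \<phi> l ys = (\<Sum>m\<in>partition_box n K. D l m * grothendieck_part m ys [])" by blast
  have exp: "grothendieck I (xs @ ys) [] = (\<Sum>l\<in>partition_box n K. \<phi> l ys * grothendieck_part l xs [])"
    if nz: "nonzero xs" "nonzero ys" for xs ys
  proof -
    obtain c where c: "\<And>as. nonzero as \<Longrightarrow>
      grothendieck I (ys @ as) [] = (\<Sum>l\<in>partition_box n K. c l * grothendieck_part l as [])"
      using spanned_append[OF span nz(2)] unfolding spanned_def by blast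
    have sw: "grothendieck I (as @ ys) [] = grothendieck I (ys @ as) []" if "nonzero as" for as
      by (rule grothendieck_mset) (use that nz in auto)
    have "\<phi> l ys = c l" if "l \<in> partition_box n K" for l
    proof -
      have "\<phi> l ys = (\<Sum>x\<in>P. \<mu> l x * (\<Sum>m\<in>partition_box n K. c m * grothendieck_part m x []))"
        unfolding \<phi>_def by (intro sum.cong arg_cong2[of _ _ _ _ "(*)"] refl) (use sw c P(2) in auto)
      also have "\<dots> = (\<Sum>x\<in>P. \<Sum>m\<in>partition_box n K. c m * (\<mu> l x * grothendieck_part m x []))"
        by (simp add: sum_distrib_left mult_ac)
      also have "\<dots> = (\<Sum>m\<in>partition_box n K. \<Sum>x\<in>P. c m * (\<mu> l x * grothendieck_part m x []))"
        by (rule sum.swap)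
      also have "\<dots> = (\<Sum>m\<in>partition_box n K. if m = l then c m else 0)"
        by (rule sum.cong) (use P(3)[OF that] in \<open>simp_all add: sum_distrib_left[symmetric]\<close>)
      finally show ?thesis using that finite_partition_box by simp
    qed
    then show ?thesis using sw[OF nz(1)] c[OF nz(1)] by simp
  qed
  have final: "grothendieck I (xs @ ys) [] = (\<Sum>l\<in>partition_box n K. \<Sum>m\<in>partition_box n K.
        D l m * grothendieck_part l xs [] * grothendieck_part m ys [])"
    if "nonzero xs" "nonzero ys" for xs ys
    unfolding exp[OF that] D[OF that(2)] by (simp add: sum_distrib_left sum_distrib_right mult_ac)
  show thesis
    by (rule that[of P \<mu> D]) (use P D final in \<open>auto simp: \<phi>_def\<close>)
qed

section \<open>Asymptotics in the second alphabet\<close>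

text \<open>A letter \<open>a = 1 / (1 - x)\<close> contributes
  \<open>(1 - z) / (1 - z a) = (1 - x) / (1 - x / y)\<close> to \<open>ratio\<close>; the formal
  variable stands for \<open>1 / y\<close>.\<close>

definition gseries :: "complex list \<Rightarrow> complex fps" where
  "gseries X = (\<Prod>x\<leftarrow>X. fps_const (1 - x) * geometric x)"

lemma gseries_Nil_nth: "fps_nth (gseries []) m = (if m = 0 then 1 else 0)"
  by (simp add: gseries_def)

lemma gseries_Cons_nth:
  "fps_nth (gseries (x # X)) m = (1 - x) * (\<Sum>d\<le>m. x ^ d * fps_nth (gseries X) (m - d))"
proof -
  have "gseries (x # X) = fps_const (1 - x) * (geometric x * gseries X)"
    by (simp add: gseries_def mult.assoc)
  then show ?thesis
    by (simp only: fps_mult_left_const_nth) (simp add: fps_mult_nth geometric_def atLeast0AtMost)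
qed

abbreviation monomial_points :: "nat list \<Rightarrow> complex \<Rightarrow> complex list" where
  "monomial_points vs \<epsilon> \<equiv> map (\<lambda>v. \<epsilon> ^ v) vs"

lemma bigo_1_mult:
  fixes f g h :: "complex \<Rightarrow> complex"
  assumes "f \<in> O[F](\<lambda>_. 1)" "g \<in> O[F](h)"
  shows "(\<lambda>x. f x * g x) \<in> O[F](h)"
  using landau_o.big.mult[OF assms] by simp

lemma bigo_1_power:
  fixes f :: "complex \<Rightarrow> complex"
  assumes "f \<in> O[F](\<lambda>_. 1)"
  shows "(\<lambda>x. f x ^ m) \<in> O[F](\<lambda>_. 1)"
  by (induction m) (auto intro: bigo_1_mult assms)

lemma bigo_1_tendsto:
  fixes f :: "complex \<Rightarrow> complex"
  assumes "(f \<longlongrightarrow> c) F"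
  shows "f \<in> O[F](\<lambda>_. 1)"
  by (rule bigoI_tendsto[of _ _ c]) (use assms in auto)

lemma power_bigo:
  assumes "a \<le> b"
  shows "(\<lambda>\<epsilon>::complex. \<epsilon> ^ b) \<in> O[at 0](\<lambda>\<epsilon>. \<epsilon> ^ a)"
proof -
  have "((\<lambda>\<epsilon>::complex. \<epsilon> ^ (b - a)) \<longlongrightarrow> 0 ^ (b - a)) (at 0)" by (intro tendsto_intros)
  then have "(\<lambda>\<epsilon>::complex. \<epsilon> ^ (b - a) * \<epsilon> ^ a) \<in> O[at 0](\<lambda>\<epsilon>. \<epsilon> ^ a)"
    by (intro bigo_1_mult bigo_1_tendsto) auto
  then show ?thesis using assms by (simp flip: power_add)
qed

lemma tendsto_power_0:
  assumes "v > 0"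
  shows "((\<lambda>\<epsilon>::complex. \<epsilon> ^ v) \<longlongrightarrow> 0) (at 0)"
proof -
  have "((\<lambda>\<epsilon>::complex. \<epsilon> ^ v) \<longlongrightarrow> 0 ^ v) (at 0)" by (intro tendsto_intros)
  then show ?thesis unfolding zero_power[OF assms] .
qed

lemma eventually_power_ne_1: "v > 0 \<Longrightarrow> eventually (\<lambda>\<epsilon>::complex. \<epsilon> ^ v \<noteq> 1) (at 0)"
  by (rule tendsto_imp_eventually_ne[OF tendsto_power_0]) auto

lemma eventually_nonzero_alphabet:
  assumes "\<forall>v\<in>set vs. v > 0"
  shows "eventually (\<lambda>\<epsilon>. nonzero (alphabet (monomial_points vs \<epsilon>))) (at 0)"
  using assms
proof (induction vs)
  case (Cons v vs)
  have "eventually (\<lambda>\<epsilon>. nonzero (alphabet (monomial_points vs \<epsilon>))) (at 0)" using Cons by simp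
  moreover have "eventually (\<lambda>\<epsilon>::complex. \<epsilon> ^ v \<noteq> 1) (at 0)" using Cons.prems by (simp add: eventually_power_ne_1)
  ultimately show ?case by eventually_elim auto
qed simp

text \<open>Controls the remainder of the truncated geometric series. The two finite expansions
  express the moment through a shorter alphabet with bounded coefficients, so no residue has to be
  estimated.\<close>

lemma moment_bounded:
  assumes "\<forall>v\<in>set vs. v > 0" "nonzero as"
  shows "(\<lambda>\<epsilon>. moment (alphabet (monomial_points vs \<epsilon>) @ as) [] k e) \<in> O[at 0](\<lambda>_. 1)"
  using assms(1)
proof (induction vs arbitrary: k e)
  case (Cons v vs)
  let ?A = "\<lambda>\<epsilon>. alphabet (monomial_points vs \<epsilon>) @ as"
  \<comment> \<open>Chosen so that the moment left over after \<open>M\<close> steps down in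
    \<open>k\<close> and \<open>q\<close> steps up in \<open>e\<close> vanishes.\<close>
  define q where "q = nat (1 - e)"
  define M where "M = nat (k + e + int q) + 1"
  have qM: "e + int q > 0" "k - int M + e + int q < 0" by (auto simp: q_def M_def)
  have v: "v > 0" and vs: "\<forall>v\<in>set vs. 0 < v" using Cons.prems by simp_all
  have IH: "(\<lambda>\<epsilon>. moment (?A \<epsilon>) [] k e) \<in> O[at 0](\<lambda>_. 1)" for k e using Cons by simp
  define G where "G \<epsilon> = (1 - \<epsilon> ^ v) * (\<Sum>m<M. (\<epsilon> ^ v) ^ m * moment (?A \<epsilon>) [] (k - int m) e)
    + (\<epsilon> ^ v) ^ M * (\<Sum>r<q. (1 / (1 - \<epsilon> ^ v)) ^ r * moment (?A \<epsilon>) [] (k - int M + 1) (e + int r))"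
    for \<epsilon> :: complex
  have ev: "eventually (\<lambda>\<epsilon>. moment (alphabet (monomial_points (v # vs) \<epsilon>) @ as) [] k e = G \<epsilon>) (at 0)"
    using eventually_nonzero_alphabet[OF vs] eventually_power_ne_1[OF v]
  proof eventually_elim
    case (elim \<epsilon>)
    then have nz: "nonzero (?A \<epsilon>)" "1 / (1 - \<epsilon> ^ v) \<noteq> 0" using assms(2) by auto
    show ?case
      using moment_Cons_series[OF nz(2,1), of k e M] moment_Cons_negative[OF nz(2,1) qM]
      by (simp add: G_def)
  qed
  have bounded: "G \<in> O[at 0](\<lambda>_. 1)"
  proof -
    have x: "(\<lambda>\<epsilon>::complex. \<epsilon> ^ v) \<in> O[at 0](\<lambda>_. 1)"
      by (rule bigo_1_tendsto[OF tendsto_power_0[OF v]])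
    have "((\<lambda>\<epsilon>::complex. 1 - \<epsilon> ^ v) \<longlongrightarrow> 1 - 0) (at 0)" "((\<lambda>\<epsilon>::complex. 1 / (1 - \<epsilon> ^ v)) \<longlongrightarrow> 1 / (1 - 0)) (at 0)"
      by (intro tendsto_intros tendsto_power_0[OF v]; simp)+
    then have a: "(\<lambda>\<epsilon>::complex. 1 - \<epsilon> ^ v) \<in> O[at 0](\<lambda>_. 1)" "(\<lambda>\<epsilon>::complex. 1 / (1 - \<epsilon> ^ v)) \<in> O[at 0](\<lambda>_. 1)"
      by (blast intro: bigo_1_tendsto)+
    show ?thesis unfolding G_def
      by (intro sum_in_bigo(1) big_sum_in_bigo bigo_1_mult bigo_1_power x a IH)
  qed
  show ?case by (rule iffD2[OF landau_o.big.in_cong[OF ev] bounded])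
qed simp

lemma gseries_bigo:
  assumes "\<forall>v\<in>set vs. W \<le> v" "W > 0"
  shows "(\<lambda>\<epsilon>. fps_nth (gseries (monomial_points vs \<epsilon>)) m) \<in> O[at 0](\<lambda>\<epsilon>. \<epsilon> ^ (W * m))"
  using assms(1)
proof (induction vs arbitrary: m)
  case Nil
  then show ?case by (auto simp: gseries_Nil_nth)
next
  case (Cons v vs)
  have v: "v > 0" using Cons.prems assms(2) by simp
  have "((\<lambda>\<epsilon>::complex. 1 - \<epsilon> ^ v) \<longlongrightarrow> 1 - 0) (at 0)"
    by (intro tendsto_intros tendsto_power_0[OF v])
  then have "(\<lambda>\<epsilon>::complex. 1 - \<epsilon> ^ v) \<in> O[at 0](\<lambda>_. 1)" by (rule bigo_1_tendsto)
  moreover have "(\<lambda>\<epsilon>. \<Sum>d\<le>m. (\<epsilon> ^ v) ^ d * fps_nth (gseries (monomial_points vs \<epsilon>)) (m - d)) \<in> O[at 0](\<lambda>\<epsilon>. \<epsilon> ^ (W * m))"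
  proof (rule big_sum_in_bigo)
    fix d assume d: "d \<in> {..m}"
    have "(\<lambda>\<epsilon>::complex. (\<epsilon> ^ v) ^ d) \<in> O[at 0](\<lambda>\<epsilon>. \<epsilon> ^ (W * d))"
      unfolding power_mult[symmetric] by (rule power_bigo) (use Cons.prems in simp)
    moreover have "(\<lambda>\<epsilon>. fps_nth (gseries (monomial_points vs \<epsilon>)) (m - d)) \<in> O[at 0](\<lambda>\<epsilon>. \<epsilon> ^ (W * (m - d)))"
      using Cons by simp
    ultimately have "(\<lambda>\<epsilon>. (\<epsilon> ^ v) ^ d * fps_nth (gseries (monomial_points vs \<epsilon>)) (m - d))
        \<in> O[at 0](\<lambda>\<epsilon>. \<epsilon> ^ (W * d) * \<epsilon> ^ (W * (m - d)))"
      by (rule landau_o.big.mult)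
    moreover have "W * d + W * (m - d) = W * m" using d by (simp flip: distrib_left)
    ultimately show "(\<lambda>\<epsilon>. (\<epsilon> ^ v) ^ d * fps_nth (gseries (monomial_points vs \<epsilon>)) (m - d))
        \<in> O[at 0](\<lambda>\<epsilon>. \<epsilon> ^ (W * m))" by (simp flip: power_add)
  qed
  ultimately show ?case
    using bigo_1_mult by (simp add: gseries_Cons_nth)
qed

text \<open>Induction over the letters. Term \<open>m\<close> of the series of a new letter is
  already of order \<open>W * m\<close>, so the shorter alphabet is expanded only to
  \<open>M - m\<close> terms; regrouping by total degree yields the coefficients of
  \<open>gseries\<close>.\<close>

lemma moment_asymptotic:
  assumes "\<forall>v\<in>set vs. W \<le> v" "W > 0" "nonzero as"
  shows "(\<lambda>\<epsilon>. moment (alphabet (monomial_points vs \<epsilon>) @ as) [] k e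
      - (\<Sum>m<M. fps_nth (gseries (monomial_points vs \<epsilon>)) m * moment as [] (k - int m) e))
    \<in> O[at 0](\<lambda>\<epsilon>. \<epsilon> ^ (W * M))"
  using assms(1)
proof (induction vs arbitrary: k M)
  case Nil
  show ?case
  proof (cases M)
    case 0
    then show ?thesis by simp
  next
    case (Suc M')
    then have "(\<Sum>m<M. fps_nth (gseries []) m * moment as [] (k - int m) e) = moment as [] k e"
      by (simp add: gseries_Nil_nth sum.lessThan_Suc_shift del: sum.lessThan_Suc)
    then show ?thesis by simp
  qed
next
  case (Cons v vs)
  let ?A = "\<lambda>\<epsilon>. alphabet (monomial_points vs \<epsilon>) @ as"
  let ?A' = "\<lambda>\<epsilon>. alphabet (monomial_points (v # vs) \<epsilon>) @ as"
  let ?g = "\<lambda>\<epsilon>. fps_nth (gseries (monomial_points vs \<epsilon>))"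
  have v: "v > 0" and vs: "\<forall>v\<in>set vs. 0 < v" "\<forall>v\<in>set (v # vs). 0 < v"
    using Cons.prems assms(2) by auto
  define E where "E m \<epsilon> = moment (?A \<epsilon>) [] (k - int m) e
      - (\<Sum>j<M - m. ?g \<epsilon> j * moment as [] (k - int m - int j) e)" for m \<epsilon>
  define R where "R \<epsilon> = (1 - \<epsilon> ^ v) * (\<Sum>m<M. (\<epsilon> ^ v) ^ m * E m \<epsilon>)
      + (\<epsilon> ^ v) ^ M * moment (?A' \<epsilon>) [] (k - int M) e" for \<epsilon> :: complex
  have powv: "(\<lambda>\<epsilon>::complex. (\<epsilon> ^ v) ^ d) \<in> O[at 0](\<lambda>\<epsilon>. \<epsilon> ^ (W * d))" for d
    unfolding power_mult[symmetric] by (rule power_bigo) (use Cons.prems in simp)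
  have ev: "eventually (\<lambda>\<epsilon>. moment (?A' \<epsilon>) [] k e
      - (\<Sum>m<M. fps_nth (gseries (monomial_points (v # vs) \<epsilon>)) m * moment as [] (k - int m) e) = R \<epsilon>) (at 0)"
    using eventually_nonzero_alphabet[OF vs(1)] eventually_power_ne_1[OF v]
  proof eventually_elim
    case (elim \<epsilon>)
    define x where "x = \<epsilon> ^ v"
    have nz: "nonzero (?A \<epsilon>)" "1 / (1 - x) \<noteq> 0" using elim assms(3) by (auto simp: x_def)
    have tri: "(\<Sum>m<M. x ^ m * (\<Sum>j<M - m. ?g \<epsilon> j * moment as [] (k - int m - int j) e))
      = (\<Sum>s<M. (\<Sum>d\<le>s. x ^ d * ?g \<epsilon> (s - d)) * moment as [] (k - int s) e)"
    proof -
      have "(\<Sum>m<M. x ^ m * (\<Sum>j<M - m. ?g \<epsilon> j * moment as [] (k - int m - int j) e))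
        = (\<Sum>(m, j)\<in>Sigma {..<M} (\<lambda>m. {..<M - m}). x ^ m * ?g \<epsilon> j * moment as [] (k - int m - int j) e)"
        by (simp add: sum.Sigma[symmetric] sum_distrib_left mult.assoc)
      also have "Sigma {..<M} (\<lambda>m. {..<M - m}) = {(m, j). m + j < M}" by auto
      also have "(\<Sum>(m, j)\<in>{(m, j). m + j < M}. x ^ m * ?g \<epsilon> j * moment as [] (k - int m - int j) e)
        = (\<Sum>s<M. \<Sum>d\<le>s. x ^ d * ?g \<epsilon> (s - d) * moment as [] (k - int d - int (s - d)) e)"
        by (rule sum.triangle_reindex)
      also have "\<dots> = (\<Sum>s<M. (\<Sum>d\<le>s. x ^ d * ?g \<epsilon> (s - d)) * moment as [] (k - int s) e)"
        unfolding sum_distrib_right by (intro sum.cong refl) (simp add: of_nat_diff)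
      finally show ?thesis .
    qed
    have 1: "moment (?A' \<epsilon>) [] k e = (1 - x) * (\<Sum>m<M. x ^ m * moment (?A \<epsilon>) [] (k - int m) e)
        + x ^ M * moment (?A' \<epsilon>) [] (k - int M) e"
      using moment_Cons_series[OF nz(2,1), of k e M] by (simp add: x_def)
    have 2: "(\<Sum>m<M. fps_nth (gseries (monomial_points (v # vs) \<epsilon>)) m * moment as [] (k - int m) e)
        = (1 - x) * (\<Sum>m<M. x ^ m * (\<Sum>j<M - m. ?g \<epsilon> j * moment as [] (k - int m - int j) e))"
      unfolding tri sum_distrib_left[of "1 - x"]
      by (rule sum.cong[OF refl]) (simp add: gseries_Cons_nth x_def mult.assoc)
    have 3: "(\<Sum>m<M. x ^ m * E m \<epsilon>) = (\<Sum>m<M. x ^ m * moment (?A \<epsilon>) [] (k - int m) e)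
        - (\<Sum>m<M. x ^ m * (\<Sum>j<M - m. ?g \<epsilon> j * moment as [] (k - int m - int j) e))"
      by (simp add: E_def right_diff_distrib sum_subtractf)
    show ?case unfolding R_def x_def[symmetric] 1 2 3 by (simp only: right_diff_distrib) simp
  qed
  have bounded: "R \<in> O[at 0](\<lambda>\<epsilon>. \<epsilon> ^ (W * M))"
  proof -
    have "((\<lambda>\<epsilon>::complex. 1 - \<epsilon> ^ v) \<longlongrightarrow> 1 - 0) (at 0)"
      by (intro tendsto_intros tendsto_power_0[OF v])
    then have 1: "(\<lambda>\<epsilon>::complex. 1 - \<epsilon> ^ v) \<in> O[at 0](\<lambda>_. 1)" by (rule bigo_1_tendsto)
    have 2: "(\<lambda>\<epsilon>. (\<epsilon> ^ v) ^ m * E m \<epsilon>) \<in> O[at 0](\<lambda>\<epsilon>. \<epsilon> ^ (W * M))" if "m < M" for m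
    proof -
      have "E m \<in> O[at 0](\<lambda>\<epsilon>. \<epsilon> ^ (W * (M - m)))"
        unfolding E_def using Cons by simp
      with powv have "(\<lambda>\<epsilon>. (\<epsilon> ^ v) ^ m * E m \<epsilon>) \<in> O[at 0](\<lambda>\<epsilon>. \<epsilon> ^ (W * m) * \<epsilon> ^ (W * (M - m)))"
        by (rule landau_o.big.mult)
      moreover have "W * m + W * (M - m) = W * M" using that by (simp flip: distrib_left)
      ultimately show ?thesis by (simp flip: power_add)
    qed
    have 3: "(\<lambda>\<epsilon>. (\<epsilon> ^ v) ^ M * moment (?A' \<epsilon>) [] (k - int M) e) \<in> O[at 0](\<lambda>\<epsilon>. \<epsilon> ^ (W * M))"
      using landau_o.big.mult[OF powv moment_bounded[OF vs(2) assms(3)]] by simp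
    show ?thesis unfolding R_def
      by (intro sum_in_bigo(1) bigo_1_mult[OF 1] big_sum_in_bigo 3) (use 2 in auto)
  qed
  show ?case by (rule iffD2[OF landau_o.big.in_cong[OF ev] bounded])
qed

text \<open>The factors are exchanged one at a time; boundedness of the partial products is carried
  along for the induction.\<close>

lemma prod_diff_bigo:
  fixes a b :: "'i \<Rightarrow> complex \<Rightarrow> complex"
  assumes "finite S" "\<And>i. i \<in> S \<Longrightarrow> a i \<in> O[F](\<lambda>_. 1)" "\<And>i. i \<in> S \<Longrightarrow> b i \<in> O[F](\<lambda>_. 1)"
    "\<And>i. i \<in> S \<Longrightarrow> (\<lambda>x. a i x - b i x) \<in> O[F](h)"
  shows "(\<lambda>x. (\<Prod>i\<in>S. a i x) - (\<Prod>i\<in>S. b i x)) \<in> O[F](h)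
    \<and> (\<lambda>x. \<Prod>i\<in>S. a i x) \<in> O[F](\<lambda>_. 1)"
  using assms
proof (induction S)
  case (insert j S)
  have IH: "(\<lambda>x. (\<Prod>i\<in>S. a i x) - (\<Prod>i\<in>S. b i x)) \<in> O[F](h)" "(\<lambda>x. \<Prod>i\<in>S. a i x) \<in> O[F](\<lambda>_. 1)"
    using insert by auto
  have "(\<lambda>x. (\<Prod>i\<in>S. a i x) * (a j x - b j x) + b j x * ((\<Prod>i\<in>S. a i x) - (\<Prod>i\<in>S. b i x))) \<in> O[F](h)"
    by (intro sum_in_bigo(1) bigo_1_mult IH) (use insert.prems in auto)
  then have "(\<lambda>x. (\<Prod>i\<in>insert j S. a i x) - (\<Prod>i\<in>insert j S. b i x)) \<in> O[F](h)"
    using insert.hyps by (simp add: algebra_simps)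
  moreover have "(\<lambda>x. a j x * (\<Prod>i\<in>S. a i x)) \<in> O[F](\<lambda>_. 1)"
    by (intro bigo_1_mult IH) (use insert.prems in auto)
  ultimately show ?case using insert.hyps by simp
qed simp

text \<open>
  The truncation of \<open>G\<^sub>I(x, x') = \<Sum>\<^sub>C G\<^bsub>I - C\<^esub>(x) \<Prod>\<^sub>j g\<^bsub>C j\<^esub>(x')\<close>, where \<open>\<Sum>\<^sub>m g\<^sub>m y\<^bsup>- m\<^esup>\<close> is
  the generating factor of the second alphabet.
\<close>

lemma grothendieck_asymptotic:
  assumes "\<forall>v\<in>set vs. W \<le> v" "W > 0" "nonzero as"
  shows "(\<lambda>\<epsilon>. grothendieck I (alphabet (monomial_points vs \<epsilon>) @ as) []
      - (\<Sum>C\<in>PiE {..<length I} (\<lambda>_. {..<M}). (\<Prod>i<length I. fps_nth (gseries (monomial_points vs \<epsilon>)) (C i))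
          * grothendieck (map (\<lambda>i. I ! i - int (C i)) [0..<length I]) as []))
    \<in> O[at 0](\<lambda>\<epsilon>. \<epsilon> ^ (W * M))"
proof -
  define n where "n = length I"
  let ?A = "\<lambda>\<epsilon>. alphabet (monomial_points vs \<epsilon>) @ as"
  define a where "a p i \<epsilon> = moment (?A \<epsilon>) [] (I ! i - int (Suc i)) (int i - int (p i))"
    for p :: "nat \<Rightarrow> nat" and i \<epsilon>
  define b where "b p i \<epsilon> = (\<Sum>m<M. fps_nth (gseries (monomial_points vs \<epsilon>)) m
      * moment as [] (I ! i - int m - int (Suc i)) (int i - int (p i)))" for p :: "nat \<Rightarrow> nat" and i \<epsilon>
  have vs: "\<forall>v\<in>set vs. v > 0" using assms by auto
  have A: "a p i \<in> O[at 0](\<lambda>_. 1)" for p i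
    unfolding a_def by (rule moment_bounded[OF vs assms(3)])
  have B: "b p i \<in> O[at 0](\<lambda>_. 1)" for p i
  proof -
    have "(\<lambda>\<epsilon>. fps_nth (gseries (monomial_points vs \<epsilon>)) m * moment as [] k e) \<in> O[at 0](\<lambda>_. 1)" for m k e
    proof -
      have "(\<lambda>\<epsilon>::complex. \<epsilon> ^ (W * m)) \<in> O[at 0](\<lambda>\<epsilon>. \<epsilon> ^ 0)" by (rule power_bigo) simp
      then have "(\<lambda>\<epsilon>. fps_nth (gseries (monomial_points vs \<epsilon>)) m) \<in> O[at 0](\<lambda>_. 1)"
        using landau_o.big_trans[OF gseries_bigo[OF assms(1,2), of m]] by simp
      then show ?thesis by (rule bigo_1_mult) simp
    qed
    then show ?thesis unfolding b_def by (intro big_sum_in_bigo)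
  qed
  have AB: "(\<lambda>\<epsilon>. a p i \<epsilon> - b p i \<epsilon>) \<in> O[at 0](\<lambda>\<epsilon>. \<epsilon> ^ (W * M))" for p i
    using moment_asymptotic[OF assms, of "I ! i - int (Suc i)" "int i - int (p i)" M]
    by (simp add: a_def b_def algebra_simps)
  have bounded: "(\<lambda>\<epsilon>. \<Sum>p | p permutes {0..<n}. signof p * ((\<Prod>i<n. a p i \<epsilon>) - (\<Prod>i<n. b p i \<epsilon>))) \<in> O[at 0](\<lambda>\<epsilon>. \<epsilon> ^ (W * M))"
    by (intro big_sum_in_bigo bigo_1_mult conjunct1[OF prod_diff_bigo] A B AB) auto
  have ev: "eventually (\<lambda>\<epsilon>. grothendieck I (?A \<epsilon>) []
      - (\<Sum>C\<in>PiE {..<n} (\<lambda>_. {..<M}). (\<Prod>i<n. fps_nth (gseries (monomial_points vs \<epsilon>)) (C i))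
          * grothendieck (map (\<lambda>i. I ! i - int (C i)) [0..<n]) as [])
      = (\<Sum>p | p permutes {0..<n}. signof p * ((\<Prod>i<n. a p i \<epsilon>) - (\<Prod>i<n. b p i \<epsilon>)))) (at 0)"
    using eventually_nonzero_alphabet[OF vs]
  proof eventually_elim
    case (elim \<epsilon>)
    then have nz: "nonzero (?A \<epsilon>)" using assms(3) by simp
    show ?case
      unfolding grothendieck_leibniz[OF nz] right_diff_distrib sum_subtractf n_def[symmetric] a_def[symmetric] b_def
      using leibniz_sum_grothendieck[OF assms(3), of n "\<lambda>_. {..<M}"
          "\<lambda>_ m. fps_nth (gseries (monomial_points vs \<epsilon>)) m" "[]" "\<lambda>i m. I ! i - int m"]
      by simp
  qed
  show ?thesis
    unfolding n_def[symmetric] by (rule iffD2[OF landau_o.big.in_cong[OF ev] bounded])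
qed

section \<open>The Laurent series and the Cauchy identity\<close>

lemma lookup_mult_superset:
  fixes p q :: "'a::ab_group_add \<Rightarrow>\<^sub>0 'b::comm_ring_1"
  assumes "finite S" "keys q \<subseteq> S"
  shows "lookup (p * q) k
    = (\<Sum>m\<in>S. lookup p (k - m) * lookup q m)"
proof -
  have expand: "r = (\<Sum>m\<in>T. single m (lookup r m))"
    if "finite T" "keys r \<subseteq> T" for r :: "'a \<Rightarrow>\<^sub>0 'b" and T
  proof (rule poly_mapping_eqI)
    fix i
    have "lookup (\<Sum>m\<in>T. single m (lookup r m)) i
      = (\<Sum>m\<in>T. if m = i then lookup r m else 0)"
      by (simp add: lookup_sum lookup_single when_def)
    also have "\<dots> = lookup r i"
      using that by (auto simp: in_keys_iff)
    finally show "lookup r i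
      = lookup (\<Sum>m\<in>T. single m (lookup r m)) i" ..
  qed
  let ?K = "keys p"
  have "p * q = (\<Sum>l\<in>?K. single l (lookup p l))
      * (\<Sum>m\<in>S. single m (lookup q m))"
    using expand[of ?K p] expand[OF assms] by simp
  also have "\<dots> = (\<Sum>m\<in>S. \<Sum>l\<in>?K. single (l + m) (lookup p l * lookup q m))"
    by (simp add: sum_product mult_single) (rule sum.swap)
  finally have "lookup (p * q) k
    = (\<Sum>m\<in>S. \<Sum>l\<in>?K. if l + m = k then lookup p l * lookup q m else 0)"
    by (simp add: lookup_sum lookup_single when_def)
  also have "\<dots> = (\<Sum>m\<in>S. lookup p (k - m) * lookup q m)"
  proof (rule sum.cong[OF refl])
    fix m
    have "(\<Sum>l\<in>?K. if l + m = k then lookup p l * lookup q m else 0)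
      = (\<Sum>l\<in>?K. if l = k - m then lookup p l * lookup q m else 0)"
      by (rule sum.cong) (auto simp: eq_diff_eq)
    also have "\<dots> = lookup p (k - m) * lookup q m"
      by (auto simp: in_keys_iff)
    finally show "(\<Sum>l\<in>?K. if l + m = k then lookup p l * lookup q m else 0)
      = lookup p (k - m) * lookup q m" .
  qed
  finally show ?thesis .
qed

lemma lookup_mult_single:
  fixes p :: "'a::ab_group_add \<Rightarrow>\<^sub>0 'b::comm_ring_1"
  shows "lookup (p * single m 1) k = lookup p (k - m)"
  using lookup_mult_superset[of "{m}" "single m 1" p k] by simp

type_synonym exponents = "nat \<Rightarrow>\<^sub>0 int"

text \<open>Together with \<open>codegree\<close>, this describes the monomials in the inverses of
  the first \<open>n\<close> variables \<open>t\<close> and their degrees, taken relative to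
  \<open>t^I\<close>.\<close>

definition nonpositive :: "nat \<Rightarrow> exponents \<Rightarrow> bool" where
  "nonpositive n \<kappa> \<longleftrightarrow> (\<forall>j. if j < n then lookup \<kappa> j \<le> 0 else lookup \<kappa> j = 0)"

definition codegree :: "nat \<Rightarrow> exponents \<Rightarrow> nat" where
  "codegree n \<kappa> = (\<Sum>j<n. nat (- lookup \<kappa> j))"

lemma nonpositive_0: "nonpositive 0 \<kappa> \<longleftrightarrow> \<kappa> = 0"
  by (auto simp: nonpositive_def intro: poly_mapping_eqI)

lemma t_inverse_power: "t_inverse j ^ k = single (single j (- int k)) 1"
proof (induction k)
  case (Suc k)
  have "single j (- 1) + single j (- int k) = single j (- int (Suc k))"
    unfolding single_add[symmetric] by simp
  then show ?case using Suc by (simp add: t_inverse_def mult_single)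
qed simp

text \<open>The coefficient of \<open>s^b\<close> is the complete homogeneous symmetric polynomial
  of degree \<open>b\<close> in the inverse variables: each monomial of that degree occurs
  once.\<close>

lemma lookup_prod_geometric:
  "lookup (fps_nth (\<Prod>j<n. geometric (t_inverse j)) b) \<kappa>
    = (if nonpositive n \<kappa> \<and> codegree n \<kappa> = b then 1 else 0)"
proof (induction n arbitrary: b \<kappa>)
  case 0
  show ?case by (auto simp: lookup_one when_def nonpositive_0 codegree_def)
next
  case (Suc n)
  have eq: "nonpositive n (\<kappa> - single n (- int (b - i)))
      \<and> codegree n (\<kappa> - single n (- int (b - i))) = i
    \<longleftrightarrow> nonpositive (Suc n) \<kappa> \<and> codegree (Suc n) \<kappa> = b \<and> i = codegree n \<kappa>" if i: "i \<le> b" for i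
  proof -
    let ?\<kappa> = "\<kappa> - single n (- int (b - i))"
    have lk: "lookup ?\<kappa> j = (if j = n then lookup \<kappa> j + int (b - i) else lookup \<kappa> j)"
      for j by (simp add: lookup_minus lookup_single when_def)
    have tot: "codegree n ?\<kappa> = codegree n \<kappa>" by (simp add: codegree_def lk)
    have tS: "codegree (Suc n) \<kappa> = codegree n \<kappa> + nat (- lookup \<kappa> n)" by (simp add: codegree_def)
    have np: "nonpositive n ?\<kappa> \<longleftrightarrow> nonpositive (Suc n) \<kappa> \<and> nat (- lookup \<kappa> n) = b - i"
    proof
      assume *: "nonpositive n ?\<kappa>"
      have "lookup \<kappa> n = - int (b - i)"
        using *[unfolded nonpositive_def, rule_format, of n] by (simp add: lk)
      moreover have "if j < Suc n then lookup \<kappa> j \<le> 0 else lookup \<kappa> j = 0" for j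
        using *[unfolded nonpositive_def, rule_format, of j] calculation by (auto simp: lk split: if_splits)
      ultimately show "nonpositive (Suc n) \<kappa> \<and> nat (- lookup \<kappa> n) = b - i"
        by (simp add: nonpositive_def)
    next
      assume *: "nonpositive (Suc n) \<kappa> \<and> nat (- lookup \<kappa> n) = b - i"
      then have "lookup \<kappa> n \<le> 0" unfolding nonpositive_def by (metis lessI)
      then have "lookup \<kappa> n + int (b - i) = 0" using * by linarith
      moreover have "j < Suc n \<longleftrightarrow> j < n \<or> j = n" for j by auto
      ultimately show "nonpositive n ?\<kappa>"
        using * unfolding nonpositive_def lk by (metis less_irrefl)
    qed
    show ?thesis unfolding tot np tS using i by auto
  qed
  have "lookup (fps_nth (\<Prod>j<Suc n. geometric (t_inverse j)) b) \<kappa>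
    = (\<Sum>i\<le>b. lookup (fps_nth (\<Prod>j<n. geometric (t_inverse j)) i)
        (\<kappa> - single n (- int (b - i))))"
    by (simp add: fps_mult_nth atLeast0AtMost lookup_sum t_inverse_power geometric_def lookup_mult_single)
  also have "\<dots> = (\<Sum>i\<le>b. if nonpositive (Suc n) \<kappa> \<and> codegree (Suc n) \<kappa> = b \<and> i = codegree n \<kappa> then 1 else 0)"
    unfolding Suc by (rule sum.cong[OF refl], rule if_cong) (use eq in auto)
  also have "\<dots> = (if nonpositive (Suc n) \<kappa> \<and> codegree (Suc n) \<kappa> = b then 1 else 0)"
    by (auto simp: codegree_def)
  finally show ?case .
qed

text \<open>The exponent \<open>p\<close> is separated from \<open>n\<close> to allow an induction
  on it; \<open>p = n\<close> is the factor belonging to one variable \<open>s\<close>.\<close>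

abbreviation factor_series :: "nat \<Rightarrow> nat \<Rightarrow> laurent_poly fps" where
  "factor_series n p \<equiv> (1 - fps_X) ^ p * (\<Prod>j<n. geometric (t_inverse j))"

text \<open>For a fixed monomial in \<open>t\<close> the coefficients form a polynomial in
  \<open>s\<close>, namely \<open>(1 - s)^p s^codegree\<close>. Hence numbers can be substituted for
  \<open>s\<close> by finite sums.\<close>

lemma lookup_factor_series:
  "of_int (lookup (fps_nth (factor_series n p) b) \<kappa>)
    = (if nonpositive n \<kappa> then coeff ([:1, - 1:] ^ p * monom (1::complex) (codegree n \<kappa>)) b else 0)"
proof (induction p arbitrary: b)
  case 0
  show ?case by (auto simp: lookup_prod_geometric)
next
  case (Suc p)
  have "fps_nth (factor_series n (Suc p)) b
    = fps_nth (factor_series n p) b - (if b = 0 then 0 else fps_nth (factor_series n p) (b - 1))"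
  proof -
    have "factor_series n (Suc p) = factor_series n p - fps_X * factor_series n p"
      by (simp add: left_diff_distrib mult.assoc)
    then show ?thesis by (simp only: fps_sub_nth fps_X_mult_nth)
  qed
  moreover have "coeff ([:1, - 1:] ^ Suc p * Q) b
    = coeff ([:1, - 1:] ^ p * Q) b - (if b = 0 then 0 else coeff ([:1, - 1:] ^ p * Q) (b - 1))"
    for Q :: "complex poly"
  proof -
    have "[:1, - 1:] ^ Suc p * Q = [:1, - 1:] ^ p * Q + pCons 0 (- ([:1, - 1:] ^ p * Q))"
      by (simp add: mult_pCons_left mult.assoc distrib_right)
    then show ?thesis by (simp add: coeff_pCons split: nat.split)
  qed
  ultimately show ?case
    using Suc[of b] Suc[of "b - 1"] by (auto simp: lookup_minus)
qed

lemma keys_factor_series: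
  assumes "\<kappa> \<in> keys (fps_nth (factor_series n p) b)"
  shows "nonpositive n \<kappa> \<and> codegree n \<kappa> \<le> b"
proof -
  have "of_int (lookup (fps_nth (factor_series n p) b) \<kappa>) \<noteq> (0::complex)"
    using assms by (simp add: in_keys_iff)
  then have "nonpositive n \<kappa>" "coeff ([:1, - 1:] ^ p * monom (1::complex) (codegree n \<kappa>)) b \<noteq> 0"
    unfolding lookup_factor_series by (auto split: if_splits)
  moreover have "coeff (Q * monom 1 t) b = 0" if "b < t" for Q :: "complex poly" and t
    using that by (simp add: mult.commute[of Q] coeff_monom_mult)
  ultimately show ?thesis by (meson not_le)
qed

lemma sum_factor_series:
  fixes x :: complex
  assumes "nonpositive n \<kappa>" "p + codegree n \<kappa> < L"
  shows "(\<Sum>b<L. x ^ b * of_int (lookup (fps_nth (factor_series n p) b) \<kappa>))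
    = (1 - x) ^ p * x ^ codegree n \<kappa>"
proof -
  let ?Q = "[:1, - 1:] ^ p * monom (1::complex) (codegree n \<kappa>)"
  have "degree ?Q \<le> degree ([:1, - 1:] ^ p :: complex poly) + degree (monom (1::complex) (codegree n \<kappa>))"
    by (rule degree_mult_le)
  also have "\<dots> \<le> p + codegree n \<kappa>"
    using degree_power_le[of "[:1, - 1:] :: complex poly" p] degree_monom_le[of "1::complex" "codegree n \<kappa>"] by simp
  finally have deg: "degree ?Q < L" using assms(2) by simp
  have "(\<Sum>b<L. x ^ b * of_int (lookup (fps_nth (factor_series n p) b) \<kappa>))
    = (\<Sum>b<L. coeff ?Q b * x ^ b)"
    using assms(1) by (simp add: lookup_factor_series mult.commute)
  also have "\<dots> = (\<Sum>b\<le>degree ?Q. coeff ?Q b * x ^ b)"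
    by (rule sum.mono_neutral_right) (use deg in \<open>auto simp: coeff_eq_0\<close>)
  also have "\<dots> = poly ?Q x" by (simp add: poly_altdef)
  also have "\<dots> = (1 - x) ^ p * x ^ codegree n \<kappa>" by (simp add: poly_monom)
  finally show ?thesis .
qed

definition negative_exponents :: "nat \<Rightarrow> (nat \<Rightarrow> nat) \<Rightarrow> exponents" where
  "negative_exponents n d = (\<Sum>j<n. single j (- int (d j)))"

lemma lookup_negative_exponents:
  "lookup (negative_exponents n d) j = (if j < n then - int (d j) else 0)"
  by (auto simp: negative_exponents_def lookup_sum lookup_single when_def)

lemma nonpositive_negative_exponents: "nonpositive n (negative_exponents n d)"
  by (simp add: nonpositive_def lookup_negative_exponents)

lemma codegree_negative_exponents: "codegree n (negative_exponents n d) = (\<Sum>j<n. d j)"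
  by (simp add: codegree_def lookup_negative_exponents)

lemma sum_PiE_Suc:
  "(\<Sum>B\<in>PiE {..<Suc k} T. f B) = (\<Sum>b\<in>T k. \<Sum>B\<in>PiE {..<k} T. f (B(k := b)))"
proof -
  have "(\<Sum>B\<in>PiE {..<Suc k} T. f B) = (\<Sum>(b, B)\<in>T k \<times> PiE {..<k} T. f (B(k := b)))"
    unfolding lessThan_Suc PiE_insert_eq
    by (subst sum.reindex[OF inj_combinator]) (auto simp: case_prod_unfold)
  then show ?thesis by (simp add: sum.cartesian_product)
qed

text \<open>
  The Cauchy identity in the form needed: since \<open>\<Prod>\<^sub>i (1 - x\<^sub>i)\<^sup>n / \<Prod>\<^sub>j (1 - x\<^sub>i/t\<^sub>j)\<close> factors over
  \<open>j\<close> as well, its coefficients in \<open>t\<close> are products of the \<open>g\<^sub>m(x)\<close>.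
\<close>

lemma sum_prod_factor_series:
  fixes x :: "nat \<Rightarrow> complex"
  assumes "nonpositive n \<kappa> \<Longrightarrow> n + codegree n \<kappa> < L"
  shows "(\<Sum>B\<in>PiE {..<k} (\<lambda>_. {..<L}). (\<Prod>i<k. x i ^ B i)
      * of_int (lookup (\<Prod>i<k. fps_nth (factor_series n n) (B i)) \<kappa>))
    = (if nonpositive n \<kappa> then \<Prod>j<n. fps_nth (\<Prod>i<k. fps_const (1 - x i) * geometric (x i))
        (nat (- lookup \<kappa> j)) else 0)"
  using assms
proof (induction k arbitrary: \<kappa>)
  case 0
  show ?case
  proof (cases "\<kappa> = 0")
    case True
    then show ?thesis by (simp add: nonpositive_def)
  next
    case False
    then obtain j where j: "lookup \<kappa> j \<noteq> 0" by (metis lookup_zero poly_mapping_eqI)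
    have "(\<Prod>j<n. fps_nth (1 :: complex fps) (nat (- lookup \<kappa> j))) = 0" if "nonpositive n \<kappa>"
    proof (rule prod_zero)
      have "j < n" "lookup \<kappa> j < 0"
        using that[unfolded nonpositive_def, rule_format, of j] j by (auto split: if_splits)
      then show "\<exists>j\<in>{..<n}. fps_nth (1 :: complex fps) (nat (- lookup \<kappa> j)) = 0"
        by (intro bexI[of _ j]) auto
    qed simp
    then show ?thesis using False by (simp add: lookup_one when_def)
  qed
next
  case (Suc k)
  let ?P = "\<lambda>b. fps_nth (factor_series n n) b"
  let ?g = "\<lambda>k. fps_nth (\<Prod>i<k. fps_const (1 - x i) * geometric (x i))"
  define Z where "Z k \<kappa> = (\<Sum>B\<in>PiE {..<k} (\<lambda>_. {..<L}). (\<Prod>i<k. x i ^ B i)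
      * of_int (lookup (\<Prod>i<k. ?P (B i)) \<kappa>))" for k \<kappa>
  define c where "c j = nat (- lookup \<kappa> j)" for j
  \<comment> \<open>\<open>T\<close> consists of the exponents \<open>\<mu>\<close> that the last
    factor can take from \<open>\<kappa>\<close>; \<open>S\<close> is a finite set containing
    \<open>T\<close> and all keys of the coefficients involved.\<close>
  define T where "T = {\<mu>. nonpositive n \<mu> \<and> nonpositive n (\<kappa> - \<mu>)}"
  define S where "S = (\<Union>b<L. keys (?P b)) \<union> negative_exponents n ` PiE {..<n} (\<lambda>j. {..c j})"
  have T: "T = (if nonpositive n \<kappa> then negative_exponents n ` PiE {..<n} (\<lambda>j. {..c j}) else {})"
  proof -
    have *: "nonpositive n \<kappa> \<and> \<mu> \<in> negative_exponents n ` PiE {..<n} (\<lambda>j. {..c j})" if "\<mu> \<in> T" for \<mu>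
    proof -
      define d where "d = restrict (\<lambda>j. nat (- lookup \<mu> j)) {..<n}"
      have m: "if j < n then lookup \<mu> j \<le> 0 \<and> lookup \<kappa> j \<le> lookup \<mu> j
        else lookup \<mu> j = 0 \<and> lookup \<kappa> j = 0" for j
      proof -
        have "if j < n then lookup \<mu> j \<le> 0 else lookup \<mu> j = 0"
          "if j < n then lookup (\<kappa> - \<mu>) j \<le> 0 else lookup (\<kappa> - \<mu>) j = 0"
          using that unfolding T_def nonpositive_def by blast+
        then show ?thesis by (auto simp: lookup_minus split: if_splits)
      qed
      have "if j < n then lookup \<kappa> j \<le> 0 else lookup \<kappa> j = 0" for j
        using m[of j] by (auto split: if_splits)
      then have "nonpositive n \<kappa>" unfolding nonpositive_def by blast
      moreover have "\<mu> = negative_exponents n d"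
      proof (rule poly_mapping_eqI)
        fix j show "lookup \<mu> j = lookup (negative_exponents n d) j"
          using m[of j] by (auto simp: lookup_negative_exponents d_def split: if_splits)
      qed
      moreover have "d \<in> PiE {..<n} (\<lambda>j. {..c j})"
      proof (rule PiE_I)
        fix j assume "j \<in> {..<n}"
        then show "d j \<in> {..c j}" using m[of j] by (simp add: d_def c_def nat_le_iff)
      qed (simp add: d_def)
      ultimately show ?thesis by blast
    qed
    moreover have "negative_exponents n d \<in> T" if "nonpositive n \<kappa>" "d \<in> PiE {..<n} (\<lambda>j. {..c j})" for d
    proof -
      have "if j < n then lookup (\<kappa> - negative_exponents n d) j \<le> 0
        else lookup (\<kappa> - negative_exponents n d) j = 0" for j
      proof (cases "j < n")
        case True
        then have "lookup \<kappa> j \<le> 0" using that(1) unfolding nonpositive_def by metis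
        moreover have "d j \<le> c j" using True that(2) by (auto simp: PiE_iff)
        ultimately show ?thesis using True by (simp add: lookup_minus lookup_negative_exponents c_def)
      next
        case False
        then have "lookup \<kappa> j = 0" using that(1) unfolding nonpositive_def by metis
        then show ?thesis using False by (simp add: lookup_minus lookup_negative_exponents)
      qed
      then show ?thesis by (simp add: T_def nonpositive_negative_exponents) (simp add: nonpositive_def)
    qed
    ultimately show ?thesis by auto
  qed
  have S: "finite S" "\<And>b. b < L \<Longrightarrow> keys (?P b) \<subseteq> S" "T \<subseteq> S"
    unfolding S_def T by (auto intro!: finite_PiE)
  have codegree_T: "codegree n \<mu> + codegree n (\<kappa> - \<mu>) = codegree n \<kappa>" if "\<mu> \<in> T" for \<mu>
    unfolding codegree_def sum.distrib[symmetric]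
  proof (rule sum.cong[OF refl])
    fix j assume "j \<in> {..<n}"
    then have "lookup \<mu> j \<le> 0" "lookup (\<kappa> - \<mu>) j \<le> 0"
      using that unfolding T_def nonpositive_def by (metis (mono_tags, lifting) lessThan_iff mem_Collect_eq)+
    then show "nat (- lookup \<mu> j) + nat (- lookup (\<kappa> - \<mu>) j) = nat (- lookup \<kappa> j)"
      by (simp add: lookup_minus nat_add_distrib[symmetric])
  qed
  have inj: "inj_on (negative_exponents n) (PiE {..<n} (\<lambda>j. {..c j}))"
  proof (rule inj_onI)
    fix d d' assume d: "d \<in> PiE {..<n} (\<lambda>j. {..c j})" "d' \<in> PiE {..<n} (\<lambda>j. {..c j})"
      and eq: "negative_exponents n d = negative_exponents n d'"
    show "d = d'"
    proof (rule PiE_ext[OF d])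
      fix j assume "j \<in> {..<n}"
      then show "d j = d' j"
        using arg_cong[OF eq, of "\<lambda>\<mu>. lookup \<mu> j"] by (simp add: lookup_negative_exponents)
    qed
  qed
  have nonpos_T: "nonpositive n \<kappa>" if "\<mu> \<in> T" for \<mu> using that T by (auto split: if_splits)
  have ZT: "Z k (\<kappa> - \<mu>) = (\<Prod>j<n. ?g k (nat (- lookup (\<kappa> - \<mu>) j)))" if "\<mu> \<in> T" for \<mu>
  proof -
    have "n + codegree n (\<kappa> - \<mu>) < L" using codegree_T[OF that] Suc.prems[OF nonpos_T[OF that]] by simp
    then show ?thesis using Suc.IH[of "\<kappa> - \<mu>"] that by (simp add: Z_def T_def)
  qed
  have Z0: "Z k (\<kappa> - \<mu>) = 0" if "\<not> nonpositive n (\<kappa> - \<mu>)" for \<mu>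
    using Suc.IH[of "\<kappa> - \<mu>"] that by (simp add: Z_def)
  have "Z (Suc k) \<kappa> = (\<Sum>b<L. \<Sum>B\<in>PiE {..<k} (\<lambda>_. {..<L}). (\<Prod>i<k. x i ^ B i) * x k ^ b
      * of_int (lookup ((\<Prod>i<k. ?P (B i)) * ?P b) \<kappa>))"
    unfolding Z_def sum_PiE_Suc by (simp cong: prod.cong_simp)
  also have "\<dots> = (\<Sum>b<L. \<Sum>B\<in>PiE {..<k} (\<lambda>_. {..<L}). \<Sum>\<mu>\<in>S. (\<Prod>i<k. x i ^ B i) * x k ^ b
      * (of_int (lookup (\<Prod>i<k. ?P (B i)) (\<kappa> - \<mu>)) * of_int (lookup (?P b) \<mu>)))"
    by (intro sum.cong refl) (simp add: lookup_mult_superset[OF S(1,2)] sum_distrib_left)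
  also have "\<dots> = (\<Sum>b<L. \<Sum>\<mu>\<in>S. \<Sum>B\<in>PiE {..<k} (\<lambda>_. {..<L}). (\<Prod>i<k. x i ^ B i) * x k ^ b
      * (of_int (lookup (\<Prod>i<k. ?P (B i)) (\<kappa> - \<mu>)) * of_int (lookup (?P b) \<mu>)))"
    by (intro sum.cong refl sum.swap)
  also have "\<dots> = (\<Sum>\<mu>\<in>S. \<Sum>b<L. \<Sum>B\<in>PiE {..<k} (\<lambda>_. {..<L}). (\<Prod>i<k. x i ^ B i) * x k ^ b
      * (of_int (lookup (\<Prod>i<k. ?P (B i)) (\<kappa> - \<mu>)) * of_int (lookup (?P b) \<mu>)))"
    by (rule sum.swap)
  also have "\<dots> = (\<Sum>\<mu>\<in>S. Z k (\<kappa> - \<mu>) * (\<Sum>b<L. x k ^ b * of_int (lookup (?P b) \<mu>)))"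
    by (simp add: Z_def sum_product sum.swap[of _ "{..<L}"] mult_ac)
  also have "\<dots> = (\<Sum>\<mu>\<in>T. Z k (\<kappa> - \<mu>) * (\<Sum>b<L. x k ^ b * of_int (lookup (?P b) \<mu>)))"
  proof (rule sum.mono_neutral_right[OF S(1,3)], rule ballI)
    fix \<mu> assume "\<mu> \<in> S - T"
    then consider "\<not> nonpositive n \<mu>" | "\<not> nonpositive n (\<kappa> - \<mu>)" by (auto simp: T_def)
    then show "Z k (\<kappa> - \<mu>) * (\<Sum>b<L. x k ^ b * of_int (lookup (?P b) \<mu>)) = 0"
    proof cases
      case 1
      then have "lookup (?P b) \<mu> = 0" for b
        using keys_factor_series[of \<mu> n n b] by (auto simp: in_keys_iff)
      then show ?thesis by simp
    qed (simp add: Z0)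
  qed
  also have "\<dots> = (\<Sum>\<mu>\<in>T. (\<Prod>j<n. ?g k (nat (- lookup (\<kappa> - \<mu>) j))) * ((1 - x k) ^ n * x k ^ codegree n \<mu>))"
  proof (rule sum.cong[OF refl])
    fix \<mu> assume m: "\<mu> \<in> T"
    have "n + codegree n \<mu> < L" using codegree_T[OF m] Suc.prems[OF nonpos_T[OF m]] by simp
    then show "Z k (\<kappa> - \<mu>) * (\<Sum>b<L. x k ^ b * of_int (lookup (?P b) \<mu>))
      = (\<Prod>j<n. ?g k (nat (- lookup (\<kappa> - \<mu>) j))) * ((1 - x k) ^ n * x k ^ codegree n \<mu>)"
      using sum_factor_series[of n \<mu> n L "x k"] m by (simp add: ZT T_def)
  qed
  also have "\<dots> = (if nonpositive n \<kappa> then \<Prod>j<n. ?g (Suc k) (nat (- lookup \<kappa> j)) else 0)"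
  proof (cases "nonpositive n \<kappa>")
    case True
    \<comment> \<open>A splitting of \<open>\<kappa>\<close> is a choice of
      \<open>d j <= c j\<close> for each \<open>j\<close>, and the \<open>n\<close> factors
      \<open>1 - x k\<close> are dealt out one to each \<open>j\<close>. This is where the power
      \<open>n\<close> of \<open>1 - s\<close> matches the number of variables
      \<open>t\<close>.\<close>
    have "(\<Sum>\<mu>\<in>T. (\<Prod>j<n. ?g k (nat (- lookup (\<kappa> - \<mu>) j))) * ((1 - x k) ^ n * x k ^ codegree n \<mu>))
      = (\<Sum>d\<in>PiE {..<n} (\<lambda>j. {..c j}). \<Prod>j<n. (1 - x k) * (x k ^ d j * ?g k (c j - d j)))"
      using True unfolding T
    proof (simp add: sum.reindex[OF inj], intro sum.cong refl)
      fix d assume d: "d \<in> PiE {..<n} (\<lambda>j. {..c j})"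
      have "(\<Prod>j<n. ?g k (nat (- lookup (\<kappa> - negative_exponents n d) j))) = (\<Prod>j<n. ?g k (c j - d j))"
      proof (rule prod.cong[OF refl])
        fix j assume "j \<in> {..<n}"
        then have "nat (- lookup (\<kappa> - negative_exponents n d) j) = c j - d j"
          by (simp add: lookup_minus lookup_negative_exponents c_def nat_diff_distrib')
        then show "?g k (nat (- lookup (\<kappa> - negative_exponents n d) j)) = ?g k (c j - d j)" by simp
      qed
      then show "(\<Prod>j<n. ?g k (nat (- lookup (\<kappa> - negative_exponents n d) j)))
          * ((1 - x k) ^ n * x k ^ codegree n (negative_exponents n d))
        = (\<Prod>j<n. (1 - x k) * (x k ^ d j * ?g k (c j - d j)))"
        by (simp add: prod.distrib codegree_negative_exponents power_sum)
    qed
    also have "\<dots> = (\<Prod>j<n. \<Sum>d\<le>c j. (1 - x k) * (x k ^ d * ?g k (c j - d)))"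
      by (rule prod_sum_PiE[symmetric]) auto
    also have "\<dots> = (\<Prod>j<n. ?g (Suc k) (c j))"
    proof (rule prod.cong[OF refl])
      fix j
      have "(\<Prod>i<Suc k. fps_const (1 - x i) * geometric (x i))
        = fps_const (1 - x k) * (geometric (x k) * (\<Prod>i<k. fps_const (1 - x i) * geometric (x i)))"
        by (simp add: mult_ac)
      then have "?g (Suc k) (c j) = (1 - x k) * fps_nth (geometric (x k) * (\<Prod>i<k. fps_const (1 - x i) * geometric (x i))) (c j)"
        by (simp only: fps_mult_left_const_nth)
      then show "(\<Sum>d\<le>c j. (1 - x k) * (x k ^ d * ?g k (c j - d))) = ?g (Suc k) (c j)"
        by (simp only: fps_mult_nth atLeast0AtMost sum_distrib_left) (simp add: geometric_def)
    qed
    finally show ?thesis using True by (simp add: c_def)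
  next
    case False
    then show ?thesis by (simp add: T)
  qed
  finally show ?case by (simp add: Z_def)
qed

lemma codegree_add:
  assumes "nonpositive n \<kappa>" "nonpositive n \<mu>"
  shows "nonpositive n (\<kappa> + \<mu>)" "codegree n (\<kappa> + \<mu>) = codegree n \<kappa> + codegree n \<mu>"
proof -
  have *: "if j < n then lookup \<kappa> j \<le> 0 else lookup \<kappa> j = 0"
    "if j < n then lookup \<mu> j \<le> 0 else lookup \<mu> j = 0" for j
    using assms unfolding nonpositive_def by blast+
  have "if j < n then lookup (\<kappa> + \<mu>) j \<le> 0 else lookup (\<kappa> + \<mu>) j = 0" for j
    using *[of j] by (auto simp: lookup_add split: if_splits)
  then show "nonpositive n (\<kappa> + \<mu>)" unfolding nonpositive_def by blast
  show "codegree n (\<kappa> + \<mu>) = codegree n \<kappa> + codegree n \<mu>"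
    unfolding codegree_def sum.distrib[symmetric]
  proof (rule sum.cong[OF refl])
    fix j assume "j \<in> {..<n}"
    then show "nat (- lookup (\<kappa> + \<mu>) j) = nat (- lookup \<kappa> j) + nat (- lookup \<mu> j)"
      using *[of j] by (simp add: lookup_add nat_add_distrib[symmetric])
  qed
qed

lemma keys_prod_factor_series:
  fixes k n :: nat
  assumes "\<kappa> \<in> keys (\<Prod>i<k. fps_nth (factor_series n n) (B i))"
  shows "nonpositive n \<kappa> \<and> codegree n \<kappa> \<le> (\<Sum>i<k. B i)"
  using assms
proof (induction k arbitrary: \<kappa>)
  case 0
  then have "\<kappa> = 0" by (auto simp: in_keys_iff lookup_one when_def split: if_splits)
  then show ?case by (simp add: nonpositive_def codegree_def)
next
  case (Suc k)
  then obtain a b where ab: "\<kappa> = a + b" "a \<in> keys (\<Prod>i<k. fps_nth (factor_series n n) (B i))"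
    "b \<in> keys (fps_nth (factor_series n n) (B k))"
    using keys_mult[of "\<Prod>i<k. fps_nth (factor_series n n) (B i)" "fps_nth (factor_series n n) (B k)"]
    by auto
  then show ?case
    using Suc.IH[OF ab(2)] keys_factor_series[OF ab(3)] codegree_add[of n a b] by simp
qed

abbreviation nat_list :: "nat \<Rightarrow> (nat \<Rightarrow> nat) \<Rightarrow> int list" where
  "nat_list n B \<equiv> map (\<lambda>i. int (B i)) [0..<n]"

abbreviation lowered :: "int list \<Rightarrow> (nat \<Rightarrow> nat) \<Rightarrow> int list" where
  "lowered I C \<equiv> map (\<lambda>i. I ! i - int (C i)) [0..<length I]"

definition coproduct_series :: "int list \<Rightarrow> laurent_series" where
  "coproduct_series I = separated_series (length I) (t_monomial I) (\<lambda>i. factor_series (length I) (length I))"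

lemma coproduct_series_eq:
  "coproduct_series I A B = (if \<forall>b\<in>set B. 0 \<le> b
    then lookup (\<Prod>i<length I. fps_nth (factor_series (length I) (length I)) (nat (B ! i)))
      (Poly_Mapping.nth A - Poly_Mapping.nth I) else 0)"
  unfolding coproduct_series_def separated_series_def t_monomial_def
  by (simp add: mult.commute[of "single _ _"] lookup_mult_single)

lemma coproduct_series_lowered:
  "coproduct_series I (lowered I C) (nat_list (length I) B)
    = lookup (\<Prod>i<length I. fps_nth (factor_series (length I) (length I)) (B i))
        (negative_exponents (length I) C)"
proof -
  have "Poly_Mapping.nth (lowered I C) - Poly_Mapping.nth I = negative_exponents (length I) C"
    by (rule poly_mapping_eqI)
       (auto simp: lookup_minus lookup_negative_exponents nth_default_def)
  then show ?thesis by (auto simp: coproduct_series_eq intro!: arg_cong2[of _ _ _ _ lookup] prod.cong)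
qed

text \<open>Multiplying \<open>t^I\<close> by inverse variables lowers exponents, so
  \<open>A = I - C\<close>; the codegree bound for the \<open>n\<close> factors compares the totals
  of \<open>C\<close> and \<open>B'\<close>. Extensionality makes the two functions unique, for
  later summation over grids.\<close>

lemma coproduct_series_support:
  assumes "coproduct_series I A B \<noteq> 0" "length A = length I" "length B = length I"
  obtains C B' where "A = lowered I C" "B = nat_list (length I) B'"
    "C \<in> extensional {..<length I}" "B' \<in> extensional {..<length I}"
    "(\<Sum>i<length I. C i) \<le> (\<Sum>i<length I. B' i)"
proof -
  let ?n = "length I"
  let ?\<kappa> = "Poly_Mapping.nth A - Poly_Mapping.nth I"
  define B' where "B' = restrict (\<lambda>i. nat (B ! i)) {..<?n}"
  define C where "C = restrict (\<lambda>i. nat (- lookup ?\<kappa> i)) {..<?n}"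
  have B0: "\<forall>b\<in>set B. 0 \<le> b" using assms(1) by (auto simp: coproduct_series_eq split: if_splits)
  then have "?\<kappa> \<in> keys (\<Prod>i<?n. fps_nth (factor_series ?n ?n) (nat (B ! i)))"
    using assms(1) by (simp add: coproduct_series_eq in_keys_iff)
  from keys_prod_factor_series[OF this]
  have \<kappa>: "nonpositive ?n ?\<kappa>" "codegree ?n ?\<kappa> \<le> (\<Sum>i<?n. nat (B ! i))" by auto
  have "A = lowered I C"
  proof (rule nth_equalityI)
    fix i assume "i < length A"
    then have i: "i < ?n" using assms(2) by simp
    then have "lookup ?\<kappa> i \<le> 0" using \<kappa>(1) unfolding nonpositive_def by metis
    moreover have "lookup ?\<kappa> i = A ! i - I ! i"
      using i assms(2) by (simp add: lookup_minus nth_default_nth)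
    ultimately show "A ! i = lowered I C ! i" using i by (simp add: C_def)
  qed (simp add: assms(2))
  moreover have "B = nat_list ?n B'"
    by (rule nth_equalityI) (use B0 assms(3) in \<open>auto simp: B'_def\<close>)
  moreover have "(\<Sum>i<?n. C i) \<le> (\<Sum>i<?n. B' i)"
    using \<kappa>(2) by (simp add: C_def B'_def codegree_def)
  ultimately show thesis by (intro that[of C B']) (auto simp: C_def B'_def)
qed

section \<open>Finite sums for the coefficients of the image\<close>

lemma lookup_tensor:
  "lookup (tensor x y) (l, m) = lookup x l * lookup y m"
proof -
  have "lookup (frag_extend (\<lambda>m. frag_of (k, m)) y) (l, m)
      = (if k = l then lookup y m else 0)" for k
  proof -
    have "lookup (frag_extend (\<lambda>m. frag_of (k, m)) y) (l, m)
      = (\<Sum>i\<in>keys y. if i = m then (if k = l then lookup y i else 0) else 0)"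
      unfolding frag_extend_def lookup_sum by (rule sum.cong) auto
    then show ?thesis by (simp add: in_keys_iff)
  qed
  then have "lookup (tensor x y) (l, m)
    = (\<Sum>i\<in>keys x. if i = l then lookup x i * lookup y m else 0)"
    unfolding tensor_def frag_extend_def[of _ x] lookup_sum by (intro sum.cong) auto
  then show ?thesis by (simp add: in_keys_iff)
qed

definition term_coeff :: "int list \<Rightarrow> integer_partition \<Rightarrow> integer_partition \<Rightarrow> int list \<times> int list \<Rightarrow> int" where
  "term_coeff I l m = (\<lambda>(A, B). coproduct_series I A B
     * lookup (tensor (Gam_elem A) (Gam_elem B)) (l, m))"

definition term_support :: "int list \<Rightarrow> integer_partition \<Rightarrow> integer_partition \<Rightarrow> (int list \<times> int list) set" where
  "term_support I l m = {(A, B). length A = length I \<and> length B = length I \<and> term_coeff I l m (A, B) \<noteq> 0}"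

definition image_coeff :: "int list \<Rightarrow> integer_partition \<Rightarrow> integer_partition \<Rightarrow> int" where
  "image_coeff I l m = (\<Sum>p\<in>term_support I l m. term_coeff I l m p)"

abbreviation grid :: "int list \<Rightarrow> nat \<Rightarrow> (nat \<Rightarrow> nat) set" where
  "grid I M \<equiv> PiE {..<length I} (\<lambda>_. {..<M})"

text \<open>The total of \<open>C\<close> is at most that of \<open>B\<close>, and the total of
  \<open>B\<close> at most the size of \<open>m\<close>, the latter by straightening of nonnegative
  sequences.\<close>

lemma term_support_grid:
  assumes "sum_list (parts m) < M" "sum_list (parts m) < L"
  shows "term_support I l m \<subseteq> (\<lambda>(C, B). (lowered I C, nat_list (length I) B)) ` (grid I M \<times> grid I L)"
proof (rule subsetI)
  fix p assume p: "p \<in> term_support I l m"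
  obtain A B where AB: "p = (A, B)" by (cases p)
  then have len: "length A = length I" "length B = length I" and
    nz: "coproduct_series I A B \<noteq> 0" "lookup (Gam_elem B) m \<noteq> 0"
    using p by (auto simp: term_support_def term_coeff_def lookup_tensor)
  obtain C B' where C: "A = lowered I C" "B = nat_list (length I) B'"
    "C \<in> extensional {..<length I}" "B' \<in> extensional {..<length I}"
    "(\<Sum>i<length I. C i) \<le> (\<Sum>i<length I. B' i)"
    by (rule coproduct_series_support[OF nz(1) len])
  have "sum_list B \<le> int (sum_list (parts m))"
    by (rule lookup_Gam_elem_nonneg[OF _ nz(2)]) (auto simp: C(2))
  moreover have "sum_list B = int (\<Sum>i<length I. B' i)"
    by (simp add: C(2) sum_list_sum_nth atLeast0LessThan)
  ultimately have sB: "(\<Sum>i<length I. B' i) \<le> sum_list (parts m)" by (simp only: of_nat_le_iff)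
  have "B' i < L" if "i < length I" for i
    using member_le_sum[of i "{..<length I}" B'] that sB assms by simp
  moreover have "C i < M" if "i < length I" for i
    using member_le_sum[of i "{..<length I}" C] that sB C(5) assms by simp
  ultimately have "(C, B') \<in> grid I M \<times> grid I L" using C(3,4) by (auto simp: PiE_iff)
  then show "p \<in> (\<lambda>(C, B). (lowered I C, nat_list (length I) B)) ` (grid I M \<times> grid I L)"
    unfolding AB C(1,2) by (rule rev_image_eqI) simp
qed

lemma finite_grid: "finite (grid I M)"
  by (rule finite_PiE) auto

lemma finite_term_support: "finite (term_support I l m)"
  by (rule finite_subset[OF term_support_grid[OF lessI lessI]]) (simp add: finite_grid)

text \<open>The two cutoffs are kept separate since the Cauchy identity will require an
  \<open>L\<close> that grows with \<open>M\<close>.\<close>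

lemma image_coeff_grid:
  assumes "sum_list (parts m) < M" "sum_list (parts m) < L"
  shows "image_coeff I l m = (\<Sum>C\<in>grid I M. \<Sum>B\<in>grid I L.
    coproduct_series I (lowered I C) (nat_list (length I) B)
      * lookup (Gam_elem (lowered I C)) l * lookup (Gam_elem (nat_list (length I) B)) m)"
proof -
  let ?f = "\<lambda>(C, B). (lowered I C, nat_list (length I) B)"
  have inj: "inj_on ?f (grid I M \<times> grid I L)"
  proof (rule inj_onI)
    fix p q assume p: "p \<in> grid I M \<times> grid I L" "q \<in> grid I M \<times> grid I L" "?f p = ?f q"
    obtain C B C' B' where CB: "p = (C, B)" "q = (C', B')" by (cases p, cases q)
    have eq: "lowered I C = lowered I C'" "nat_list (length I) B = nat_list (length I) B'"
      using p(3) CB by auto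
    have "C i = C' i" "B i = B' i" if "i < length I" for i
      using arg_cong[OF eq(1), of "\<lambda>xs. xs ! i"] arg_cong[OF eq(2), of "\<lambda>xs. xs ! i"] that by auto
    then have "C = C'" "B = B'"
      using p(1,2) PiE_ext[of C "{..<length I}" "\<lambda>_. {..<M}" C'] PiE_ext[of B "{..<length I}" "\<lambda>_. {..<L}" B']
      unfolding CB mem_Times_iff fst_conv snd_conv lessThan_iff by blast+
    then show "p = q" using CB by simp
  qed
  have "image_coeff I l m = (\<Sum>p\<in>?f ` (grid I M \<times> grid I L). term_coeff I l m p)"
    unfolding image_coeff_def
  proof (rule sum.mono_neutral_left[OF _ term_support_grid[OF assms]])
    show "finite (?f ` (grid I M \<times> grid I L))" by (intro finite_imageI finite_cartesian_product finite_grid)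
    show "\<forall>p\<in>?f ` (grid I M \<times> grid I L) - term_support I l m. term_coeff I l m p = 0"
    proof
      fix p assume p: "p \<in> ?f ` (grid I M \<times> grid I L) - term_support I l m"
      then obtain q where q: "p = ?f q" by blast
      have "p = (lowered I (fst q), nat_list (length I) (snd q))" unfolding q by (simp add: case_prod_unfold)
      then show "term_coeff I l m p = 0" using p unfolding term_support_def by simp
    qed
  qed
  also have "\<dots> = (\<Sum>(C, B)\<in>grid I M \<times> grid I L. term_coeff I l m (lowered I C, nat_list (length I) B))"
    by (subst sum.reindex[OF inj]) (simp add: case_prod_unfold)
  also have "\<dots> = (\<Sum>C\<in>grid I M. \<Sum>B\<in>grid I L. term_coeff I l m (lowered I C, nat_list (length I) B))"
    by (simp add: sum.cartesian_product)
  finally show ?thesis by (simp add: term_coeff_def lookup_tensor mult.assoc)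
qed

lemma gseries_permute:
  assumes "p permutes {0..<length X}"
  shows "(\<Prod>i<length X. fps_const (1 - X ! p i) * geometric (X ! p i)) = gseries X"
proof -
  have "(\<Prod>i<length X. fps_const (1 - X ! p i) * geometric (X ! p i))
    = (\<Prod>i<length X. fps_const (1 - X ! i) * geometric (X ! i))"
    using prod.permute[OF assms, of "\<lambda>i. fps_const (1 - X ! i) * geometric (X ! i)"]
    by (simp add: o_def atLeast0LessThan)
  then show ?thesis by (simp add: gseries_def prod.list_conv_set_nth atLeast0LessThan)
qed

text \<open>For each permutation in the bialternant the sum over \<open>B\<close> gives, by
  \<open>sum_prod_factor_series\<close>, the same symmetric product, which therefore comes out of
  the alternating sum. What remains is the zero sequence, with value 1.\<close>

lemma grothendieck_cauchy:
  assumes X: "regular X" "length X = length I" and L: "length I + (\<Sum>j<length I. C j) < L"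
  shows "(\<Sum>B\<in>grid I L. of_int (coproduct_series I (lowered I C) (nat_list (length I) B))
      * grothendieck (nat_list (length I) B) (alphabet X) [])
    = (\<Prod>j<length I. fps_nth (gseries X) (C j))"
proof -
  define n where "n = length I"
  define F where "F B = complex_of_int (lookup (\<Prod>i<n. fps_nth (factor_series n n) (B i)) (negative_exponents n C))" for B
  define q where "q p = (\<Prod>i<n. (X ! p i) ^ (n - Suc i) * (1 - X ! p i) ^ i)" for p :: "nat \<Rightarrow> nat"
  obtain v where "\<forall>B. length B = length X \<longrightarrow> (\<forall>b\<in>set B. 0 \<le> b) \<longrightarrow>
      grothendieck B (alphabet X) [] = bialternant X B * v"
    using grothendieck_bialternant[OF X(1)] ..
  then have v: "grothendieck B (alphabet X) [] = bialternant X B * v"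
    if "length B = n" "\<forall>b\<in>set B. 0 \<le> b" for B
    using that X(2) by (simp add: n_def)
  have b: "bialternant X (nat_list n B) = (\<Sum>p | p permutes {0..<n}. signof p * ((\<Prod>i<n. (X ! p i) ^ B i) * q p))" for B
    unfolding bialternant_def X(2) n_def[symmetric]
  proof (intro sum.cong refl arg_cong2[of _ _ _ _ "(*)"])
    fix p :: "nat \<Rightarrow> nat"
    show "(\<Prod>i<n. (X ! p i) ^ (nat (nat_list n B ! i) + (n - Suc i)) * (1 - X ! p i) ^ i)
      = (\<Prod>i<n. (X ! p i) ^ B i) * q p"
      unfolding q_def prod.distrib[symmetric]
    proof (rule prod.cong[OF refl])
      fix i assume "i \<in> {..<n}"
      then have e: "nat (nat_list n B ! i) = B i" by simp
      show "(X ! p i) ^ (nat (nat_list n B ! i) + (n - Suc i)) * (1 - X ! p i) ^ i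
        = (X ! p i) ^ B i * ((X ! p i) ^ (n - Suc i) * (1 - X ! p i) ^ i)"
        by (simp only: e power_add mult.assoc)
    qed
  qed
  have Z: "(\<Sum>B\<in>PiE {..<n} (\<lambda>_. {..<L}). (\<Prod>i<n. (X ! p i) ^ B i) * F B) = (\<Prod>j<n. fps_nth (gseries X) (C j))"
    if "p permutes {0..<n}" for p
  proof -
    have "(\<Sum>B\<in>PiE {..<n} (\<lambda>_. {..<L}). (\<Prod>i<n. (X ! p i) ^ B i) * F B)
      = (\<Prod>j<n. fps_nth (\<Prod>i<n. fps_const (1 - X ! p i) * geometric (X ! p i)) (C j))"
      using sum_prod_factor_series[where n = n and \<kappa> = "negative_exponents n C" and L = L and k = n and x = "\<lambda>i. X ! p i"] L
      by (simp add: F_def nonpositive_negative_exponents codegree_negative_exponents n_def lookup_negative_exponents)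
    then show ?thesis using gseries_permute[of p X] that X(2) by (simp add: n_def)
  qed
  have one: "bialternant X (nat_list n (\<lambda>_. 0)) * v = 1"
  proof -
    have "nat_list n (\<lambda>_. 0) = replicate n 0" by (simp add: map_replicate_const)
    then show ?thesis
      using v[of "replicate n 0"] grothendieck_replicate_0[OF nonzero_alphabet, of X n "[]"] X(1) by simp
  qed
  have "(\<Sum>B\<in>PiE {..<n} (\<lambda>_. {..<L}). F B * grothendieck (nat_list n B) (alphabet X) [])
    = (\<Sum>B\<in>PiE {..<n} (\<lambda>_. {..<L}). \<Sum>p | p permutes {0..<n}. signof p * q p * v * ((\<Prod>i<n. (X ! p i) ^ B i) * F B))"
  proof (rule sum.cong[OF refl])
    fix B
    have "grothendieck (nat_list n B) (alphabet X) [] = bialternant X (nat_list n B) * v"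
      by (rule v) auto
    then show "F B * grothendieck (nat_list n B) (alphabet X) []
      = (\<Sum>p | p permutes {0..<n}. signof p * q p * v * ((\<Prod>i<n. (X ! p i) ^ B i) * F B))"
      by (simp add: b sum_distrib_left sum_distrib_right mult_ac)
  qed
  also have "\<dots> = (\<Sum>p | p permutes {0..<n}. \<Sum>B\<in>PiE {..<n} (\<lambda>_. {..<L}). signof p * q p * v * ((\<Prod>i<n. (X ! p i) ^ B i) * F B))"
    by (rule sum.swap)
  also have "\<dots> = (\<Sum>p | p permutes {0..<n}. signof p * q p * v * (\<Prod>j<n. fps_nth (gseries X) (C j)))"
    by (rule sum.cong[OF refl]) (simp add: sum_distrib_left[symmetric] Z)
  also have "\<dots> = bialternant X (nat_list n (\<lambda>_. 0)) * v * (\<Prod>j<n. fps_nth (gseries X) (C j))"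
    unfolding b by (simp add: sum_distrib_left sum_distrib_right mult_ac)
  also have "\<dots> = (\<Prod>j<n. fps_nth (gseries X) (C j))" by (simp only: one mult_1)
  finally show ?thesis
    unfolding F_def n_def coproduct_series_lowered .
qed

section \<open>The coproduct\<close>

text \<open>The functional of \<open>l\<close> is applied to both the exact expansion and the
  truncated one. The result shows at once that \<open>D\<close> is integral on the box and that the
  image coefficients vanish outside it, hence that the image has finite support.\<close>

lemma coproduct_coefficient:
  assumes K: "\<forall>x\<in>set I. x \<le> K" and
    P: "finite P" "\<And>x. x \<in> P \<Longrightarrow> nonzero x"
    "\<And>l m. l \<in> partition_box (length I) K \<Longrightarrow> m \<in> partition_box (length I) K \<Longrightarrow>
      (\<Sum>x\<in>P. \<mu> l x * grothendieck_part m x []) = (if m = l then 1 else 0)" and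
    D: "\<And>l ys. l \<in> partition_box (length I) K \<Longrightarrow> nonzero ys \<Longrightarrow>
      (\<Sum>x\<in>P. \<mu> l x * grothendieck I (x @ ys) [])
        = (\<Sum>m\<in>partition_box (length I) K. D l m * grothendieck_part m ys [])"
  shows "of_int (image_coeff I l m)
    = (if l \<in> partition_box (length I) K \<and> m \<in> partition_box (length I) K then D l m else 0)"
proof -
  define n where "n = length I"
  define e where "e A l = complex_of_int (lookup (Gam_elem A) l)" for A l
  define F where "F C B = complex_of_int (coproduct_series I (lowered I C) (nat_list n B))" for C B
  define M where "M = Suc (sum_list (parts m))"
  \<comment> \<open>On the grid the total of \<open>C\<close> is at most \<open>n * M\<close>, so
    \<open>L\<close> meets the strict bound of the Cauchy identity because \<open>M\<close> is
    positive.\<close>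
  define L where "L = n + n * M + M"
  have less: "sum_list (parts m) < M" "sum_list (parts m) < L" by (simp_all add: M_def L_def)
  have coeff: "of_int (image_coeff I l m) = (\<Sum>C\<in>grid I M. \<Sum>B\<in>grid I L. F C B * e (lowered I C) l * e (nat_list n B) m)"
    unfolding image_coeff_grid[OF less] F_def e_def n_def by simp
  have low: "\<forall>x\<in>set (lowered I C). x \<le> K" for C
  proof
    fix x assume "x \<in> set (lowered I C)"
    then obtain i where "i < length I" "x = I ! i - int (C i)" by auto
    then show "x \<le> K" using K nth_mem[of i I] by fastforce
  qed
  have e_low: "e (lowered I C) l = 0" if "l \<notin> partition_box n K" for C l
    using keys_Gam_elem_box[of "lowered I C" n K] low that by (auto simp: e_def n_def in_keys_iff)
  have e_nat: "e (nat_list n B) m = 0" if "length (parts m) > n" for B m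
    using lookup_Gam_elem_nonneg(1)[of "nat_list n B" m] that by (force simp: e_def)
  \<comment> \<open>Separation with \<open>n\<close> letters covers partitions with at most
    \<open>n\<close> parts; longer \<open>m\<close> are settled by the length bound of
    straightening.\<close>
  consider "l \<notin> partition_box n K" | "length (parts m) > n" | "l \<in> partition_box n K" "length (parts m) \<le> n" by linarith
  then show ?thesis
  proof cases
    case 1
    then have "e (lowered I C) l = 0" for C by (rule e_low)
    then show ?thesis unfolding coeff using 1 by (simp add: n_def)
  next
    case 2
    then have "m \<notin> partition_box n K" by (simp add: partition_box_def)
    moreover have "e (nat_list n B) m = 0" for B using 2 by (rule e_nat)
    ultimately show ?thesis unfolding coeff by (simp add: n_def)
  next
    case 3
    \<comment> \<open>\<open>m\<close> is inserted because it may lie outside both boxes, and its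
      image coefficient must be shown to vanish in that case.\<close>
    define S where "S = insert m (partition_box n K \<union> partition_box n (int L))"
    have S: "finite S" "partition_box n K \<subseteq> S" "partition_box n (int L) \<subseteq> S" "m \<in> S"
      by (auto simp: S_def finite_partition_box)
    have len: "length (parts m') \<le> n" if "m' \<in> S" for m'
      using that 3 by (auto simp: S_def partition_box_def)
    obtain w W where w: "W > 0" "\<And>k. W \<le> w k" "strict_mono w" "separates w W n S"
      using graded_independence[OF S(1) len] by metis
    have w0: "w k > 0" for k using w(1) w(2)[of k] by simp
    define vs where "vs = map w [0..<n]"
    have vs: "\<forall>v\<in>set vs. W \<le> v" using w(2) by (auto simp: vs_def)
    have points: "power_points w n \<epsilon> = monomial_points vs \<epsilon>" for \<epsilon>
      by (simp add: power_points_def vs_def)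
    \<comment> \<open>Exact coefficient minus truncated coefficient. At \<open>m' = m\<close> the
      truncated sum is already all of \<open>image_coeff\<close>, by \<open>coeff\<close>.\<close>
    define \<kappa> where "\<kappa> m' = (if m' \<in> partition_box n K then D l m' else 0)
      - (\<Sum>C\<in>grid I M. \<Sum>B\<in>grid I L. F C B * e (lowered I C) l * e (nat_list n B) m')" for m'
    \<comment> \<open>The functional of \<open>l\<close> applied to the truncation error, so of
      order \<open>W * M\<close>; expanding both parts in the second alphabet gives the combination
      with coefficients \<open>\<kappa>\<close>.\<close>
    define R where "R \<epsilon> = (\<Sum>x\<in>P. \<mu> l x * (grothendieck I (alphabet (monomial_points vs \<epsilon>) @ x) []
      - (\<Sum>C\<in>grid I M. (\<Prod>i<length I. fps_nth (gseries (monomial_points vs \<epsilon>)) (C i))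
          * grothendieck (lowered I C) x [])))" for \<epsilon>
    have "R \<in> O[at 0](\<lambda>\<epsilon>. \<epsilon> ^ (W * M))"
      unfolding R_def
    proof (intro big_sum_in_bigo bigo_1_mult)
      fix x assume "x \<in> P"
      then show "(\<lambda>\<epsilon>. grothendieck I (alphabet (monomial_points vs \<epsilon>) @ x) []
        - (\<Sum>C\<in>grid I M. (\<Prod>i<length I. fps_nth (gseries (monomial_points vs \<epsilon>)) (C i))
          * grothendieck (lowered I C) x [])) \<in> O[at 0](\<lambda>\<epsilon>. \<epsilon> ^ (W * M))"
        by (intro grothendieck_asymptotic vs w(1) P(2))
    qed simp
    moreover have ev: "eventually (\<lambda>\<epsilon>. (\<Sum>m'\<in>S. \<kappa> m' * grothendieck_part m' (alphabet (power_points w n \<epsilon>)) []) = R \<epsilon>) (at 0)"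
      using eventually_regular_power_points[OF w0 w(3), of n]
    proof eventually_elim
      case (elim \<epsilon>)
      define X where "X = monomial_points vs \<epsilon>"
      have "X = power_points w n \<epsilon>" by (simp only: X_def points)
      then have X: "regular X" "length X = length I" using elim by (simp_all add: n_def)
      have nz: "nonzero (alphabet X)" using X by (intro nonzero_alphabet) simp
      let ?G = "\<lambda>m'. grothendieck_part m' (alphabet X) []"
      have 1: "(\<Sum>x\<in>P. \<mu> l x * grothendieck I (alphabet X @ x) [])
          = (\<Sum>m'\<in>S. (if m' \<in> partition_box n K then D l m' else 0) * ?G m')"
      proof -
        have "(\<Sum>x\<in>P. \<mu> l x * grothendieck I (alphabet X @ x) []) = (\<Sum>x\<in>P. \<mu> l x * grothendieck I (x @ alphabet X) [])"
        proof (intro sum.cong refl arg_cong2[of _ _ _ _ "(*)"])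
          fix x assume "x \<in> P"
          then show "grothendieck I (alphabet X @ x) [] = grothendieck I (x @ alphabet X) []"
            by (intro grothendieck_mset) (use nz P(2) in auto)
        qed
        also have "\<dots> = (\<Sum>m'\<in>partition_box n K. D l m' * ?G m')"
          using D[OF _ nz, of l] 3(1) by (simp add: n_def)
        also have "\<dots> = (\<Sum>m'\<in>S. (if m' \<in> partition_box n K then D l m' else 0) * ?G m')"
          by (rule sum.mono_neutral_cong_left) (use S in auto)
        finally show ?thesis .
      qed
      have 2: "(\<Sum>x\<in>P. \<mu> l x * grothendieck (lowered I C) x []) = e (lowered I C) l" for C
      proof -
        have "(\<Sum>x\<in>P. \<mu> l x * grothendieck (lowered I C) x [])
          = (\<Sum>x\<in>P. \<Sum>l'\<in>partition_box n K. e (lowered I C) l' * (\<mu> l x * grothendieck_part l' x []))"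
        proof (rule sum.cong[OF refl])
          fix x assume "x \<in> P"
          then have "grothendieck (lowered I C) x [] = (\<Sum>l'\<in>partition_box n K. e (lowered I C) l' * grothendieck_part l' x [])"
            unfolding e_def by (intro grothendieck_eq_sum_box low P(2)) (simp add: n_def)
          then show "\<mu> l x * grothendieck (lowered I C) x []
            = (\<Sum>l'\<in>partition_box n K. e (lowered I C) l' * (\<mu> l x * grothendieck_part l' x []))"
            by (simp add: sum_distrib_left mult.left_commute)
        qed
        also have "\<dots> = (\<Sum>l'\<in>partition_box n K. \<Sum>x\<in>P. e (lowered I C) l' * (\<mu> l x * grothendieck_part l' x []))"
          by (rule sum.swap)
        also have "\<dots> = (\<Sum>l'\<in>partition_box n K. if l' = l then e (lowered I C) l' else 0)"
        proof (rule sum.cong[OF refl])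
          fix l' assume "l' \<in> partition_box n K"
          then show "(\<Sum>x\<in>P. e (lowered I C) l' * (\<mu> l x * grothendieck_part l' x []))
            = (if l' = l then e (lowered I C) l' else 0)"
            using P(3)[of l l'] 3(1) by (simp add: sum_distrib_left[symmetric] n_def)
        qed
        finally show ?thesis using 3(1) finite_partition_box by simp
      qed
      have 3: "(\<Prod>i<length I. fps_nth (gseries X) (C i))
          = (\<Sum>m'\<in>S. (\<Sum>B\<in>grid I L. F C B * e (nat_list n B) m') * ?G m')" if C: "C \<in> grid I M" for C
      proof -
        have "(\<Sum>j<length I. C j) \<le> (\<Sum>j<length I. M)" by (rule sum_mono) (use C in \<open>auto simp: PiE_iff intro: less_imp_le\<close>)
        then have "length I + (\<Sum>j<length I. C j) < L" by (simp add: L_def n_def M_def)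
        from grothendieck_cauchy[OF X this]
        have "(\<Prod>i<length I. fps_nth (gseries X) (C i))
          = (\<Sum>B\<in>grid I L. F C B * grothendieck (nat_list n B) (alphabet X) [])" by (simp add: F_def n_def)
        also have "\<dots> = (\<Sum>B\<in>grid I L. \<Sum>m'\<in>S. F C B * e (nat_list n B) m' * ?G m')"
        proof (rule sum.cong[OF refl])
          fix B assume B: "B \<in> grid I L"
          have "grothendieck (nat_list n B) (alphabet X) [] = (\<Sum>m'\<in>partition_box n (int L). e (nat_list n B) m' * ?G m')"
            unfolding e_def by (rule grothendieck_eq_sum_box) (use B nz in \<open>auto simp: PiE_iff n_def less_imp_le\<close>)
          also have "\<dots> = (\<Sum>m'\<in>S. e (nat_list n B) m' * ?G m')"
          proof (rule sum.mono_neutral_left[OF S(1,3)], rule ballI)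
            fix m' assume m': "m' \<in> S - partition_box n (int L)"
            have "keys (Gam_elem (nat_list n B)) \<subseteq> partition_box n (int L)"
              by (rule keys_Gam_elem_box) (use B in \<open>auto simp: PiE_iff n_def less_imp_le\<close>)
            then show "e (nat_list n B) m' * ?G m' = 0" using m' by (auto simp: e_def in_keys_iff)
          qed
          finally show "F C B * grothendieck (nat_list n B) (alphabet X) []
            = (\<Sum>m'\<in>S. F C B * e (nat_list n B) m' * ?G m')"
            by (simp add: sum_distrib_left mult.assoc)
        qed
        also have "\<dots> = (\<Sum>m'\<in>S. \<Sum>B\<in>grid I L. F C B * e (nat_list n B) m' * ?G m')" by (rule sum.swap)
        finally show ?thesis by (simp add: sum_distrib_right)
      qed
      have "R \<epsilon> = (\<Sum>x\<in>P. \<mu> l x * grothendieck I (alphabet X @ x) [])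
        - (\<Sum>x\<in>P. \<Sum>C\<in>grid I M. (\<Prod>i<length I. fps_nth (gseries X) (C i)) * (\<mu> l x * grothendieck (lowered I C) x []))"
        unfolding R_def X_def[symmetric] by (simp add: right_diff_distrib sum_subtractf sum_distrib_left mult.left_commute)
      also have "(\<Sum>x\<in>P. \<Sum>C\<in>grid I M. (\<Prod>i<length I. fps_nth (gseries X) (C i)) * (\<mu> l x * grothendieck (lowered I C) x []))
        = (\<Sum>C\<in>grid I M. \<Sum>x\<in>P. (\<Prod>i<length I. fps_nth (gseries X) (C i)) * (\<mu> l x * grothendieck (lowered I C) x []))"
        by (rule sum.swap)
      also have "\<dots> = (\<Sum>C\<in>grid I M. (\<Sum>m'\<in>S. (\<Sum>B\<in>grid I L. F C B * e (nat_list n B) m') * ?G m') * e (lowered I C) l)"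
        by (rule sum.cong[OF refl]) (simp add: sum_distrib_left[symmetric] 2 3)
      also have "\<dots> = (\<Sum>C\<in>grid I M. \<Sum>m'\<in>S. (\<Sum>B\<in>grid I L. F C B * e (lowered I C) l * e (nat_list n B) m') * ?G m')"
        by (simp add: sum_distrib_left sum_distrib_right mult_ac)
      also have "\<dots> = (\<Sum>m'\<in>S. \<Sum>C\<in>grid I M. (\<Sum>B\<in>grid I L. F C B * e (lowered I C) l * e (nat_list n B) m') * ?G m')"
        by (rule sum.swap)
      also have "\<dots> = (\<Sum>m'\<in>S. (\<Sum>C\<in>grid I M. \<Sum>B\<in>grid I L. F C B * e (lowered I C) l * e (nat_list n B) m') * ?G m')"
        by (simp only: sum_distrib_right)
      finally show ?case
        unfolding points X_def[symmetric] 1 \<kappa>_def by (simp only: left_diff_distrib sum_subtractf)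
    qed
    ultimately have "(\<lambda>\<epsilon>. \<Sum>m'\<in>S. \<kappa> m' * grothendieck_part m' (alphabet (power_points w n \<epsilon>)) []) \<in> O[at 0](\<lambda>\<epsilon>. \<epsilon> ^ (W * M))"
      by (intro iffD2[OF landau_o.big.in_cong[OF ev]])
    then have "\<kappa> m = 0" by (rule separatesD[OF w(4) S(4) less(1)])
    then show ?thesis unfolding coeff \<kappa>_def n_def[symmetric] using 3(1) by simp
  qed
qed

section \<open>Evaluation of tensors and comparison of the two sides\<close>

definition eval_GamGam :: "GamGam \<Rightarrow> complex list \<Rightarrow> complex list \<Rightarrow> complex" where
  "eval_GamGam d xs ys = (\<Sum>(l, m)\<in>keys d.
     of_int (lookup d (l, m)) * grothendieck_part l xs [] * grothendieck_part m ys [])"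

lemma eval_GamGam_superset:
  assumes "finite S" "keys d \<subseteq> S"
  shows "eval_GamGam d xs ys = (\<Sum>(l, m)\<in>S.
     of_int (lookup d (l, m)) * grothendieck_part l xs [] * grothendieck_part m ys [])"
  unfolding eval_GamGam_def
  by (rule sum.mono_neutral_left) (use assms in \<open>auto simp: in_keys_iff\<close>)

text \<open>Independence is used twice, first in \<open>xs\<close> with \<open>ys\<close> fixed,
  then in \<open>ys\<close>.\<close>

lemma eval_GamGam_inject:
  assumes "\<And>xs ys. nonzero xs \<Longrightarrow> nonzero ys \<Longrightarrow> eval_GamGam d xs ys = eval_GamGam d' xs ys"
  shows "d = d'"
proof (rule poly_mapping_eqI)
  fix q :: "integer_partition \<times> integer_partition"
  obtain l m where q: "q = (l, m)" by (cases q)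
  define K where "K = insert q (keys d \<union> keys d')"
  define S T where "S = fst ` K" and "T = snd ` K"
  have fin: "finite S" "finite T" "finite (S \<times> T)" by (simp_all add: S_def T_def K_def)
  have sub: "keys d \<subseteq> S \<times> T" "keys d' \<subseteq> S \<times> T" "l \<in> S" "m \<in> T"
    by (force simp: S_def T_def K_def q)+
  define c where "c l m = complex_of_int (lookup d (l, m) - lookup d' (l, m))" for l m
  have "(\<Sum>l\<in>S. (\<Sum>m\<in>T. c l m * grothendieck_part m ys []) * grothendieck_part l xs []) = 0"
    if "nonzero xs" "nonzero ys" for xs ys
  proof -
    have "(\<Sum>l\<in>S. (\<Sum>m\<in>T. c l m * grothendieck_part m ys []) * grothendieck_part l xs [])
      = (\<Sum>(l, m)\<in>S \<times> T. c l m * grothendieck_part l xs [] * grothendieck_part m ys [])"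
      by (simp add: sum.cartesian_product[symmetric] sum_distrib_left sum_distrib_right mult_ac)
    also have "\<dots> = eval_GamGam d xs ys - eval_GamGam d' xs ys"
      unfolding eval_GamGam_superset[OF fin(3) sub(1)] eval_GamGam_superset[OF fin(3) sub(2)] sum_subtractf[symmetric]
      by (rule sum.cong) (auto simp: c_def algebra_simps)
    finally show ?thesis using assms[OF that] by simp
  qed
  then have "(\<Sum>m\<in>T. c l m * grothendieck_part m ys []) = 0" if "nonzero ys" for ys
    using grothendieck_independent[OF fin(1) _ sub(3), of "\<lambda>l. \<Sum>m\<in>T. c l m * grothendieck_part m ys []"] that
    by blast
  then have "c l m = 0" using grothendieck_independent[OF fin(2) _ sub(4), of "c l"] by blast
  then show "lookup d q = lookup d' q" by (simp add: c_def q)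
qed

lemma eval_GamGam_frag_extend:
  "eval_GamGam (frag_extend f x) xs ys
    = (\<Sum>i\<in>keys x. of_int (lookup x i) * eval_GamGam (f i) xs ys)"
proof -
  define S where "S = keys (frag_extend f x) \<union> (\<Union>i\<in>keys x. keys (f i))"
  have S: "finite S" "keys (frag_extend f x) \<subseteq> S"
    "\<And>i. i \<in> keys x \<Longrightarrow> keys (f i) \<subseteq> S" by (auto simp: S_def)
  let ?g = "\<lambda>q. grothendieck_part (fst q) xs [] * grothendieck_part (snd q) ys []"
  have ev: "eval_GamGam d xs ys = (\<Sum>q\<in>S. of_int (lookup d q) * ?g q)"
    if "keys d \<subseteq> S" for d
    using eval_GamGam_superset[OF S(1) that] by (simp add: case_prod_unfold mult.assoc)
  have "eval_GamGam (frag_extend f x) xs ys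
    = (\<Sum>q\<in>S. \<Sum>i\<in>keys x. of_int (lookup x i) * (of_int (lookup (f i) q) * ?g q))"
    unfolding ev[OF S(2)] by (simp add: frag_extend_def lookup_sum sum_distrib_right mult.assoc)
  also have "\<dots> = (\<Sum>i\<in>keys x. \<Sum>q\<in>S. of_int (lookup x i) * (of_int (lookup (f i) q) * ?g q))"
    by (rule sum.swap)
  also have "\<dots> = (\<Sum>i\<in>keys x. of_int (lookup x i) * eval_GamGam (f i) xs ys)"
    by (intro sum.cong refl) (simp add: ev[OF S(3)] sum_distrib_left)
  finally show ?thesis .
qed

text \<open>One \<open>d\<close> plays both roles: its coefficients are the image coefficients, and
  \<open>coproduct_coefficient\<close> identifies them with those of the bilinear expansion.\<close>

lemma bilinear_expansion_exists:
  "\<exists>d. has_image (length I) (coproduct_series I) d \<and>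
    (\<forall>xs ys. nonzero xs \<longrightarrow> nonzero ys \<longrightarrow> grothendieck I (xs @ ys) [] = eval_GamGam d xs ys)"
proof -
  define n where "n = length I"
  \<comment> \<open>The inserted 0 keeps the maximum meaningful for the empty sequence.\<close>
  define K where "K = Max (insert 0 (set I))"
  have K: "\<forall>x\<in>set I. x \<le> K" by (simp add: K_def)
  show ?thesis
  proof (rule grothendieck_bilinear[of I n K])
    fix P \<mu> D
    assume P: "finite P" "\<And>x. x \<in> P \<Longrightarrow> nonzero x"
      "\<And>l m. l \<in> partition_box n K \<Longrightarrow> m \<in> partition_box n K \<Longrightarrow>
        (\<Sum>x\<in>P. \<mu> l x * grothendieck_part m x []) = (if m = l then 1 else 0)"
      "\<And>l ys. l \<in> partition_box n K \<Longrightarrow> nonzero ys \<Longrightarrow>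
        (\<Sum>x\<in>P. \<mu> l x * grothendieck I (x @ ys) []) = (\<Sum>m\<in>partition_box n K. D l m * grothendieck_part m ys [])"
      "\<And>xs ys. nonzero xs \<Longrightarrow> nonzero ys \<Longrightarrow>
        grothendieck I (xs @ ys) [] = (\<Sum>l\<in>partition_box n K. \<Sum>m\<in>partition_box n K.
          D l m * grothendieck_part l xs [] * grothendieck_part m ys [])"
    have coeff: "of_int (image_coeff I l m) = (if l \<in> partition_box n K \<and> m \<in> partition_box n K then D l m else 0)" for l m
      using coproduct_coefficient[OF K P(1,2) P(3,4)[unfolded n_def]] by (simp add: n_def)
    define S where "S = partition_box n K \<times> partition_box n K"
    have S: "finite S" by (simp add: S_def finite_partition_box)
    define d where "d = (\<Sum>q\<in>S. single q (image_coeff I (fst q) (snd q)))"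
    have zero: "image_coeff I l m = 0" if "(l, m) \<notin> S" for l m
    proof -
      have "complex_of_int (image_coeff I l m) = 0" using coeff[of l m] that by (auto simp: S_def)
      then show ?thesis by simp
    qed
    have lookup: "lookup d (l, m) = image_coeff I l m" for l m
      using S zero[of l m] by (auto simp: d_def lookup_sum lookup_single when_def)
    have keys: "keys d \<subseteq> S"
    proof
      fix q assume "q \<in> keys d"
      then show "q \<in> S" using zero[of "fst q" "snd q"] lookup[of "fst q" "snd q"] by (cases "q \<in> S") (auto simp: in_keys_iff)
    qed
    have "has_image (length I) (coproduct_series I) d"
      unfolding has_image_def Let_def lookup
    proof (intro allI conjI)
      fix l m
      let ?S = "{(A, B). length A = length I \<and> length B = length I \<and>
        (\<lambda>(A, B). coproduct_series I A B * lookup (tensor (Gam_elem A) (Gam_elem B)) (l, m)) (A, B) \<noteq> 0}"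
      show "finite ?S"
        using finite_term_support[of I l m] unfolding term_support_def term_coeff_def .
      show "image_coeff I l m = (\<Sum>p\<in>?S.
          (\<lambda>(A, B). coproduct_series I A B * lookup (tensor (Gam_elem A) (Gam_elem B)) (l, m)) p)"
        unfolding image_coeff_def term_support_def term_coeff_def ..
    qed
    moreover have "grothendieck I (xs @ ys) [] = eval_GamGam d xs ys" if nz: "nonzero xs" "nonzero ys" for xs ys
    proof -
      have "eval_GamGam d xs ys = (\<Sum>(l, m)\<in>S. D l m * grothendieck_part l xs [] * grothendieck_part m ys [])"
        unfolding eval_GamGam_superset[OF S keys] by (rule sum.cong) (auto simp: lookup coeff S_def)
      then show ?thesis
        unfolding P(5)[OF nz] by (simp add: S_def sum.cartesian_product)
    qed
    ultimately show ?thesis by blast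
  qed (simp_all add: n_def K)
qed

lemma eval_coproduct_coeffs:
  assumes "nonzero xs" "nonzero ys"
  shows "eval_GamGam (coproduct_coeffs l) xs ys = grothendieck_part l (xs @ ys) []"
proof -
  obtain d where d: "\<And>xs ys. nonzero xs \<Longrightarrow> nonzero ys \<Longrightarrow>
      grothendieck_part l (xs @ ys) [] = eval_GamGam d xs ys"
    using bilinear_expansion_exists[of "map int (parts l)"] unfolding grothendieck_part_def by blast
  have "coproduct_coeffs l = d"
    unfolding coproduct_coeffs_def eval_GamGam_def[symmetric]
  proof (rule the_equality)
    show "\<forall>xs ys. nonzero xs \<longrightarrow> nonzero ys \<longrightarrow> grothendieck_part l (xs @ ys) [] = eval_GamGam d xs ys"
      using d by blast
  next
    fix d' assume "\<forall>xs ys. nonzero xs \<longrightarrow> nonzero ys \<longrightarrow> grothendieck_part l (xs @ ys) [] = eval_GamGam d' xs ys"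
    then show "d' = d" using d by (intro eval_GamGam_inject) simp
  qed
  then show ?thesis using d assms by simp
qed

lemma eval_coproduct:
  assumes "nonzero xs" "nonzero ys"
  shows "eval_GamGam (coproduct c) xs ys = eval_Gam c (xs @ ys) []"
  unfolding coproduct_def eval_GamGam_frag_extend eval_Gam_def
  by (simp add: eval_coproduct_coeffs[OF assms])

theorem theorem2p6:
  fixes I :: "int list" and n :: nat
  assumes "length I = n"
  defines "F \<equiv> separated_series n (t_monomial I)
                  (\<lambda>i. (1 - fps_X) ^ n * (\<Prod>j<n. geometric (t_inverse j)))"
  shows "finite_image n F \<and> coproduct (Gam_elem I) = groth_map n F"
proof -
  have F: "F = coproduct_series I" using assms(1) by (simp add: F_def coproduct_series_def)
  obtain d where d: "has_image (length I) (coproduct_series I) d"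
    "\<And>xs ys. nonzero xs \<Longrightarrow> nonzero ys \<Longrightarrow> grothendieck I (xs @ ys) [] = eval_GamGam d xs ys"
    using bilinear_expansion_exists[of I] by blast
  have img: "has_image n F d" using d(1) assms(1) F by simp
  have "straightening (Max (insert 0 (set I))) I (Gam_elem I)"
    by (rule straightening_Gam_elem) simp
  then have "grothendieck I as bs = eval_Gam (Gam_elem I) as bs" if "nonzero as" for as bs
    using that by (simp add: straightening_def)
  \<comment> \<open>By linearity the coproduct of \<open>G_I\<close>, evaluated at \<open>xs\<close>
    and \<open>ys\<close>, is \<open>G_I\<close> on the joint alphabet, and so is
    \<open>d\<close>.\<close>
  then have "coproduct (Gam_elem I) = d"
    using d(2) by (intro eval_GamGam_inject) (simp add: eval_coproduct)
  then show ?thesis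
    using img groth_map_eqI[OF img] by (auto simp: finite_image_def)
qed

end
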